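(* Let $(b^*,u^* )$ be a uniformly $\tau$-overtaking optimal process for the problem of minimizing $l(b)+\int_0^\infty f_0(x,u,t)\,dt$ subject to $\dot x=f(x,u,t)$, $u(t)\in U(t)$, $x(0)=b\in\mathcal C$. A solution $(\psi^*,\lambda^* )$ of the PMP system associated with $(x^*,u^* )$ is $\tau$-limiting if and only if it satisfies $$\text{either}\quad\lambda^*>0,\quad \psi^*(0)\in\lambda^*\,\partial^1_L(-J)(x^*(0),u^*;\infty_\tau),$$ $$\text{or}\quad\lambda^*=0,\quad \psi^*(0)\in\partial^0_L(-J)(x^*(0),u^*;\infty_\tau)\setminus\{0\}.$$
   Context: Setting. $\mathbb T=[0,\infty)$, $\mathbb X=\mathbb R^m$, $\mathbb U$ is a finite-dimensional Euclidean space; $f:\mathbb X\times\mathbb U\times\mathbb T\to\mathbb X$, $f_0:\mathbb X\times\mathbb U\times\mathbb T\to\mathbb R$, $l:\mathbb X\to\mathbb R$. $U$ maps each $t\in\mathbb T$ to a closed subset $U(t)$ of $\mathbb U$ and has Borel graph. The set $\mathfrak U$ of admissible controls consists of the measurable functions $u:\mathbb T\to\mathbb U$, bounded on every compact time interval, with $u(t)\in U(t)$ for a.a. $t$. Assumptions: $\mathcal C\subset\mathbb X$ is closed; $l$ is locally Lipschitz; $f$ is Borel measurable in $(t,u)$ and continuously differentiable in $x$; for each $u\in\mathfrak U$ the map $(t,x)\mapsto f(x,u(t),t)$ satisfies the sublinear growth condition ($\|f(x,u(t),t)\|\le L_u(t)(1+\|x\|)$ with $L_u$ locally integrable); $f_0$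 is measurable in $(t,u)$, continuously differentiable in $x$ and lower semicontinuous in $u$; $\partial f/\partial x$, $\partial f_0/\partial x$ are measurable in $(t,u)$ and locally Lipschitz in $x$. It is also understood that along admissible controls the right-hand sides are Carathéodory and that $f,f_0,\partial f/\partial x,\partial f_0/\partial x$ are, on bounded sets of $(x,u)$, bounded by locally integrable functions of $t$ and Lipschitz in $x$ with locally integrable constants. $\tau=(\tau_n)$ is an unboundedly increasing sequence of positive times. For $b\in\mathbb X$, $u\in\mathfrak U$, $x(b,u;\cdot)$ is the unique solution on $\mathbb T$ of $\dot x=f(x,u(t),t)$, $x(0)=b$; $J(b,u;T)=\int_0^T f_0(x(b,u;t),u(t),t)\,dt$; $x^*=x(b^*,u^*;\cdot)$, so $x^*(0)=b^*$. Optimality. $(b^*,u^* )\in\mathcal C\times\mathfrak U$ is uniformly $\tau$-overtaking optimal if $\liminf_{n\to\infty}\big(l(b^* )+J(b^*,u^*;\tau_n)-\inf_{(b,u)\in\mathcal C\times\mathfrak U}(l(b)+J(b,u;\tau_n))\big)\ge0$. PMP system. $H(x,u,\psi,\lambda,t)=\psi f(x,u,t)-\lambda f_0(x,u,t)$, $\lambda\ge0$ ($\psi f$ is the scalar product; $\psi$ is a row vector). A pair $(\psi,\lambda)$, $\lambda\ge 0$ constant, is a solution of the PMP system associated with $(x^*,u^* )$ if $-\dot\psi(t)=\frac{\partial H}{\partial x}(x^*(t),u^*(t),\psi(t),\lambda,t)$ and $\sup_{v\in U(t)}H(x^*(t),v,\psi(t),\lambda,t)=H(x^*(t),u^*(t),\psi(t),\lambda,t)$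 for a.e. $t\ge0$. It is nontrivial if $(\psi,\lambda)\neq(0,0)$. A nontrivial solution $(\psi^*,\lambda^* )$ is $\tau$-limiting if there are a subsequence $\tau'\subset\tau$ and triples $(x_n,\psi_n,\lambda_n)$ with constant $\lambda_n\ge0$, solving $\dot x=f(x,u^*(t),t)$, $-\dot\psi=\frac{\partial H}{\partial x}(x,u^*(t),\psi,\lambda_n,t)$, with $\psi_n(\tau'_n)=0$, which converge pointwise on $\mathbb T$ to $(x^*,\psi^*,\lambda^* )$. Subdifferentials at infinity. $\zeta$ is a proximal subgradient of $g$ at $b$ ($\zeta\in\partial_Pg(b)$) if for some $\sigma\ge0$ and neighborhood $\Omega$ of $b$, $g(\xi)\ge g(b)+\zeta(\xi-b)-\sigma\|\xi-b\|^2$ for all $\xi\in\Omega$. Let $\mathcal T=\{\tau_n: n\in\mathbb N\}$, and let $\partial_P(-J)(b,u^*;t)$ be the proximal subdifferential of $-J(\cdot,u^*;t)$ at $b$. $\partial^1_L(-J)(b,u^*;\infty_\tau)$ is the set of $\zeta$ for which there exist $b_n\in\mathbb X$, $t_n\in\mathcal T$, $\zeta_n\in\partial_P(-J)(b_n,u^*;t_n)$ with $b_n\to b$, $t_n\to\infty$, $\zeta_n\to\zeta$; $\partial^0_L(-J)(b,u^*;\infty_\tau)$ is the set of $\zeta$ for which there exist $b_n\in\mathbb X$, $t_n\in\mathcal T$, $s_n\in\mathbb T$, $\zeta_n\in\partial_P(-J)(b_n,u^*;t_n)$ with $b_n\to b$, $t_n\to\infty$, $s_n\to0$, $s_n\zeta_n\to\zeta$.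 *)

theory Defs
  imports "HOL-Analysis.Analysis"
begin

section \<open>Analytic preliminaries\<close>

definition locally_integrable :: "(real \<Rightarrow> real) \<Rightarrow> bool" where
  "locally_integrable g \<longleftrightarrow> (\<forall>T\<ge>0. g absolutely_integrable_on {0..T})"

definition locally_lipschitz :: "('a::metric_space \<Rightarrow> 'b::metric_space) \<Rightarrow> bool" where
  "locally_lipschitz g \<longleftrightarrow> (\<forall>x. \<exists>r>0. \<exists>L. L-lipschitz_on (ball x r) g)"

definition lower_semicontinuous :: "('a::topological_space \<Rightarrow> real) \<Rightarrow> bool" where
  "lower_semicontinuous g \<longleftrightarrow> (\<forall>v. \<forall>a<g v. \<forall>\<^sub>F w in nhds v. a < g w)"

definition grad :: "('a::real_inner \<Rightarrow> real) \<Rightarrow> 'a \<Rightarrow> 'a" where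
  "grad g x = (THE D. GDERIV g x :> D)"

text \<open>
  In the next definition \<open>d\<close> is a finite family of nonoverlapping compact intervals
  contained in \<open>[a, b]\<close>, and \<open>Inf k\<close>, \<open>Sup k\<close> are the endpoints of \<open>k\<close>.
\<close>

definition absolutely_continuous_on ::
    "real \<Rightarrow> real \<Rightarrow> (real \<Rightarrow> 'a::real_normed_vector) \<Rightarrow> bool" where
  "absolutely_continuous_on a b g \<longleftrightarrow>
     (\<forall>\<epsilon>>0. \<exists>\<delta>>0. \<forall>d S. d division_of S \<and> S \<subseteq> {a..b} \<and> (\<Sum>k\<in>d. Sup k - Inf k) < \<delta> \<longrightarrow>
        (\<Sum>k\<in>d. norm (g (Sup k) - g (Inf k))) < \<epsilon>)"

text \<open>Solutions of \<open>x' = F(t, x)\<close> on \<open>[0, \<infinity>)\<close> in the sense of Caratheodory.\<close>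

definition ode_solution ::
    "(real \<Rightarrow> 'a \<Rightarrow> 'a) \<Rightarrow> (real \<Rightarrow> 'a::real_normed_vector) \<Rightarrow> bool" where
  "ode_solution F x \<longleftrightarrow>
     (\<forall>T\<ge>0. absolutely_continuous_on 0 T x) \<and>
     (AE t in lebesgue_on {0..}. (x has_vector_derivative F t (x t)) (at t))"

section \<open>The control system\<close>

definition admissible_controls :: "(real \<Rightarrow> 'u::euclidean_space set) \<Rightarrow> (real \<Rightarrow> 'u) set" where
  "admissible_controls U =
     {u. u \<in> borel_measurable (lebesgue_on {0..}) \<and>
         (\<forall>T\<ge>0. bounded (u ` {0..T})) \<and>
         (AE t in lebesgue_on {0..}. u t \<in> U t)}"

text \<open>
  Measurability in \<open>(t, u)\<close> is meant with respect to the product of the Lebesgue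
  sigma-algebra in \<open>t\<close> and the Borel sigma-algebra in \<open>u\<close>.
\<close>

definition measurable_in_time_control ::
    "('a \<Rightarrow> 'u::euclidean_space \<Rightarrow> real \<Rightarrow> 'b::topological_space) \<Rightarrow> bool" where
  "measurable_in_time_control g \<longleftrightarrow>
     (\<forall>x. (\<lambda>(t, v). g x v t) \<in> borel_measurable (lebesgue_on {0..} \<Otimes>\<^sub>M borel))"

definition caratheodory_along ::
    "('a::topological_space \<Rightarrow> 'u \<Rightarrow> real \<Rightarrow> 'b::topological_space) \<Rightarrow> (real \<Rightarrow> 'u) \<Rightarrow> bool" where
  "caratheodory_along g u \<longleftrightarrow>
     (\<forall>x. (\<lambda>t. g x (u t) t) \<in> borel_measurable (lebesgue_on {0..})) \<and>
     (AE t in lebesgue_on {0..}. continuous_on UNIV (\<lambda>x. g x (u t) t))"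

definition bounded_lipschitz_on_bounded ::
    "('a::real_normed_vector \<Rightarrow> 'u::real_normed_vector \<Rightarrow> real \<Rightarrow> 'b::real_normed_vector) \<Rightarrow> bool" where
  "bounded_lipschitz_on_bounded g \<longleftrightarrow>
     (\<forall>B. bounded B \<longrightarrow>
        (\<exists>M. locally_integrable M \<and>
           (AE t in lebesgue_on {0..}. \<forall>(x, v)\<in>B. norm (g x v t) \<le> M t)) \<and>
        (\<exists>K. locally_integrable K \<and>
           (AE t in lebesgue_on {0..}. \<forall>v. (K t)-lipschitz_on {x. (x, v) \<in> B} (\<lambda>x. g x v t))))"

definition state_jacobian :: "(real^'m \<Rightarrow> 'u \<Rightarrow> real \<Rightarrow> real^'m) \<Rightarrow> real^'m \<Rightarrow> 'u \<Rightarrow> real \<Rightarrow> real^'m^'m" where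
  "state_jacobian f x v t = jacobian (\<lambda>y. f y v t) (at x)"

definition state_gradient :: "(real^'m \<Rightarrow> 'u \<Rightarrow> real \<Rightarrow> real) \<Rightarrow> real^'m \<Rightarrow> 'u \<Rightarrow> real \<Rightarrow> real^'m" where
  "state_gradient f\<^sub>0 x v t = grad (\<lambda>y. f\<^sub>0 y v t) x"

locale control_problem =
  fixes f :: "real^'m \<Rightarrow> 'u::euclidean_space \<Rightarrow> real \<Rightarrow> real^'m"
    and f\<^sub>0 :: "real^'m \<Rightarrow> 'u \<Rightarrow> real \<Rightarrow> real"
    and l :: "real^'m \<Rightarrow> real"
    and U :: "real \<Rightarrow> 'u set"
    and C :: "(real^'m) set"
  assumes U_closed: "\<And>t. t \<ge> 0 \<Longrightarrow> closed (U t)"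
    and U_borel_graph: "{(t, v). t \<ge> 0 \<and> v \<in> U t} \<in> sets borel"
    and C_closed: "closed C"
    and l_locally_lipschitz: "locally_lipschitz l"
    and f_borel: "\<And>x. (\<lambda>(t, v). f x v t) \<in> borel_measurable (restrict_space borel ({0..} \<times> UNIV))"
    and f_C1: "\<And>v t. t \<ge> 0 \<Longrightarrow>
         (\<forall>x. (\<lambda>y. f y v t) differentiable (at x)) \<and>
         continuous_on UNIV (\<lambda>x. state_jacobian f x v t)"
    and f_sublinear_growth:
      "\<And>u. u \<in> admissible_controls U \<Longrightarrow>
         \<exists>L. locally_integrable L \<and>
           (AE t in lebesgue_on {0..}. \<forall>x. norm (f x (u t) t) \<le> L t * (1 + norm x))"
    and f0_measurable: "measurable_in_time_control f\<^sub>0"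
    and f0_C1: "\<And>v t. t \<ge> 0 \<Longrightarrow>
         (\<forall>x. (\<lambda>y. f\<^sub>0 y v t) differentiable (at x)) \<and>
         continuous_on UNIV (\<lambda>x. state_gradient f\<^sub>0 x v t)"
    and f0_lsc: "\<And>x t. t \<ge> 0 \<Longrightarrow> lower_semicontinuous (\<lambda>v. f\<^sub>0 x v t)"
    and df_measurable: "measurable_in_time_control (state_jacobian f)"
    and df0_measurable: "measurable_in_time_control (state_gradient f\<^sub>0)"
    and df_locally_lipschitz:
      "\<And>v t. t \<ge> 0 \<Longrightarrow> locally_lipschitz (\<lambda>x. state_jacobian f x v t)"
    and df0_locally_lipschitz:
      "\<And>v t. t \<ge> 0 \<Longrightarrow> locally_lipschitz (\<lambda>x. state_gradient f\<^sub>0 x v t)"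
    and caratheodory:
      "\<And>u. u \<in> admissible_controls U \<Longrightarrow>
         caratheodory_along f u \<and> caratheodory_along f\<^sub>0 u \<and>
         caratheodory_along (state_jacobian f) u \<and> caratheodory_along (state_gradient f\<^sub>0) u"
    and f_bounds: "bounded_lipschitz_on_bounded f"
    and f0_bounds: "bounded_lipschitz_on_bounded f\<^sub>0"
    and df_bounds: "bounded_lipschitz_on_bounded (state_jacobian f)"
    and df0_bounds: "bounded_lipschitz_on_bounded (state_gradient f\<^sub>0)"

section \<open>Trajectories, cost and optimality\<close>

text \<open>
  Trajectories are functions on \<open>[0, \<infinity>)\<close>; \<open>extensional\<close> fixes their irrelevant values
  at negative times, so that the description below can be unique.
\<close>

definition trajectory :: "(real^'m \<Rightarrow> 'u \<Rightarrow> real \<Rightarrow> real^'m) \<Rightarrow> real^'m \<Rightarrow> (real \<Rightarrow> 'u) \<Rightarrow> real \<Rightarrow> real^'m" where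
  "trajectory f b u =
     (THE x. x \<in> extensional {0..} \<and> x 0 = b \<and> ode_solution (\<lambda>t y. f y (u t) t) x)"

definition cost ::
    "(real^'m \<Rightarrow> 'u \<Rightarrow> real \<Rightarrow> real^'m) \<Rightarrow> (real^'m \<Rightarrow> 'u \<Rightarrow> real \<Rightarrow> real) \<Rightarrow>
     real^'m \<Rightarrow> (real \<Rightarrow> 'u) \<Rightarrow> real \<Rightarrow> real" where
  "cost f f\<^sub>0 b u T = (LINT t:{0..T}|lebesgue. f\<^sub>0 (trajectory f b u t) (u t) t)"

definition unboundedly_increasing_positive :: "(nat \<Rightarrow> real) \<Rightarrow> bool" where
  "unboundedly_increasing_positive \<tau> \<longleftrightarrow>
     (\<forall>n. \<tau> n > 0) \<and> incseq \<tau> \<and> filterlim \<tau> at_top sequentially"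

text \<open>
  The infimum may be \<open>-\<infinity>\<close>, so the condition is stated in the extended reals. Since the
  infimum runs over a set containing the process itself, the lower limit below is
  nonnegative for every admissible process; a bound \<open>\<le> 0\<close> on the upper limit would be a
  stronger requirement.
\<close>

definition uniformly_overtaking_optimal ::
    "(real^'m \<Rightarrow> 'u::euclidean_space \<Rightarrow> real \<Rightarrow> real^'m) \<Rightarrow> (real^'m \<Rightarrow> 'u \<Rightarrow> real \<Rightarrow> real) \<Rightarrow>
     (real^'m \<Rightarrow> real) \<Rightarrow> (real \<Rightarrow> 'u set) \<Rightarrow> (real^'m) set \<Rightarrow> (nat \<Rightarrow> real) \<Rightarrow>
     real^'m \<Rightarrow> (real \<Rightarrow> 'u) \<Rightarrow> bool" where
  "uniformly_overtaking_optimal f f\<^sub>0 l U C \<tau> b\<^sub>s u\<^sub>s \<longleftrightarrow>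
     b\<^sub>s \<in> C \<and> u\<^sub>s \<in> admissible_controls U \<and>
     liminf (\<lambda>n. ereal (l b\<^sub>s + cost f f\<^sub>0 b\<^sub>s u\<^sub>s (\<tau> n)) -
       (INF (b, u)\<in>C \<times> admissible_controls U. ereal (l b + cost f f\<^sub>0 b u (\<tau> n)))) \<ge> 0"

section \<open>The PMP system\<close>

text \<open>The multiplier \<open>\<lambda>\<close> of the cost is written \<open>\<mu>\<close>.\<close>

definition hamiltonian ::
    "(real^'m \<Rightarrow> 'u \<Rightarrow> real \<Rightarrow> real^'m) \<Rightarrow> (real^'m \<Rightarrow> 'u \<Rightarrow> real \<Rightarrow> real) \<Rightarrow>
     real^'m \<Rightarrow> 'u \<Rightarrow> real^'m \<Rightarrow> real \<Rightarrow> real \<Rightarrow> real" where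
  "hamiltonian f f\<^sub>0 x v \<psi> \<mu> t = \<psi> \<bullet> f x v t - \<mu> * f\<^sub>0 x v t"

definition adjoint_solution ::
    "(real^'m \<Rightarrow> 'u \<Rightarrow> real \<Rightarrow> real^'m) \<Rightarrow> (real^'m \<Rightarrow> 'u \<Rightarrow> real \<Rightarrow> real) \<Rightarrow>
     (real \<Rightarrow> real^'m) \<Rightarrow> (real \<Rightarrow> 'u) \<Rightarrow> (real \<Rightarrow> real^'m) \<Rightarrow> real \<Rightarrow> bool" where
  "adjoint_solution f f\<^sub>0 x u \<psi> \<mu> \<longleftrightarrow>
     ode_solution (\<lambda>t p. - grad (\<lambda>y. hamiltonian f f\<^sub>0 y (u t) p \<mu> t) (x t)) \<psi>"

definition PMP_solution ::
    "(real^'m \<Rightarrow> 'u \<Rightarrow> real \<Rightarrow> real^'m) \<Rightarrow> (real^'m \<Rightarrow> 'u \<Rightarrow> real \<Rightarrow> real) \<Rightarrow> (real \<Rightarrow> 'u set) \<Rightarrow>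
     (real \<Rightarrow> real^'m) \<Rightarrow> (real \<Rightarrow> 'u) \<Rightarrow> (real \<Rightarrow> real^'m) \<Rightarrow> real \<Rightarrow> bool" where
  "PMP_solution f f\<^sub>0 U x u \<psi> \<mu> \<longleftrightarrow>
     \<mu> \<ge> 0 \<and> adjoint_solution f f\<^sub>0 x u \<psi> \<mu> \<and>
     (AE t in lebesgue_on {0..}.
        (SUP v\<in>U t. ereal (hamiltonian f f\<^sub>0 (x t) v (\<psi> t) \<mu> t)) =
        ereal (hamiltonian f f\<^sub>0 (x t) (u t) (\<psi> t) \<mu> t))"

definition nontrivial_multiplier :: "(real \<Rightarrow> real^'m) \<Rightarrow> real \<Rightarrow> bool" where
  "nontrivial_multiplier \<psi> \<mu> \<longleftrightarrow> \<not> ((\<forall>t\<ge>0. \<psi> t = 0) \<and> \<mu> = 0)"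

definition limiting_solution ::
    "(real^'m \<Rightarrow> 'u \<Rightarrow> real \<Rightarrow> real^'m) \<Rightarrow> (real^'m \<Rightarrow> 'u \<Rightarrow> real \<Rightarrow> real) \<Rightarrow> (real \<Rightarrow> 'u set) \<Rightarrow>
     (nat \<Rightarrow> real) \<Rightarrow> (real \<Rightarrow> real^'m) \<Rightarrow> (real \<Rightarrow> 'u) \<Rightarrow> (real \<Rightarrow> real^'m) \<Rightarrow> real \<Rightarrow> bool" where
  "limiting_solution f f\<^sub>0 U \<tau> x\<^sub>s u\<^sub>s \<psi>\<^sub>s \<mu>\<^sub>s \<longleftrightarrow>
     PMP_solution f f\<^sub>0 U x\<^sub>s u\<^sub>s \<psi>\<^sub>s \<mu>\<^sub>s \<and> nontrivial_multiplier \<psi>\<^sub>s \<mu>\<^sub>s \<and>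
     (\<exists>(r::nat \<Rightarrow> nat) x \<psi> \<mu>. strict_mono r \<and>
        (\<forall>n. \<mu> n \<ge> 0 \<and>
             ode_solution (\<lambda>t y. f y (u\<^sub>s t) t) (x n) \<and>
             adjoint_solution f f\<^sub>0 (x n) u\<^sub>s (\<psi> n) (\<mu> n) \<and>
             \<psi> n (\<tau> (r n)) = 0) \<and>
        (\<forall>t\<ge>0. (\<lambda>n. x n t) \<longlonglongrightarrow> x\<^sub>s t) \<and>
        (\<forall>t\<ge>0. (\<lambda>n. \<psi> n t) \<longlonglongrightarrow> \<psi>\<^sub>s t) \<and>
        \<mu> \<longlonglongrightarrow> \<mu>\<^sub>s)"

section \<open>Subdifferentials at infinity\<close>

definition proximal_subdifferential :: "('a::real_inner \<Rightarrow> real) \<Rightarrow> 'a \<Rightarrow> 'a set" where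
  "proximal_subdifferential g b =
     {\<zeta>. \<exists>\<sigma>\<ge>0. \<exists>\<Omega>. open \<Omega> \<and> b \<in> \<Omega> \<and>
          (\<forall>\<xi>\<in>\<Omega>. g \<xi> \<ge> g b + \<zeta> \<bullet> (\<xi> - b) - \<sigma> * (norm (\<xi> - b))\<^sup>2)}"

text \<open>
  The next two definitions are stated for a family \<open>G b t\<close> of functions of \<open>b\<close>; the
  theorem takes \<open>G b t = - J(b, u; t)\<close>.
\<close>

definition limiting_subdifferential_at_infinity ::
    "('a::real_inner \<Rightarrow> real \<Rightarrow> real) \<Rightarrow> (nat \<Rightarrow> real) \<Rightarrow> 'a \<Rightarrow> 'a set" where
  "limiting_subdifferential_at_infinity G \<tau> b =
     {\<zeta>. \<exists>b\<^sub>n t\<^sub>n \<zeta>\<^sub>n.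
          (\<forall>n::nat. t\<^sub>n n \<in> range \<tau> \<and>
               \<zeta>\<^sub>n n \<in> proximal_subdifferential (\<lambda>\<xi>. G \<xi> (t\<^sub>n n)) (b\<^sub>n n)) \<and>
          b\<^sub>n \<longlonglongrightarrow> b \<and> filterlim t\<^sub>n at_top sequentially \<and> \<zeta>\<^sub>n \<longlonglongrightarrow> \<zeta>}"

definition singular_subdifferential_at_infinity ::
    "('a::real_inner \<Rightarrow> real \<Rightarrow> real) \<Rightarrow> (nat \<Rightarrow> real) \<Rightarrow> 'a \<Rightarrow> 'a set" where
  "singular_subdifferential_at_infinity G \<tau> b =
     {\<zeta>. \<exists>b\<^sub>n t\<^sub>n (s\<^sub>n :: nat \<Rightarrow> real) \<zeta>\<^sub>n.
          (\<forall>n::nat. t\<^sub>n n \<in> range \<tau> \<and> s\<^sub>n n \<ge> 0 \<and>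
               \<zeta>\<^sub>n n \<in> proximal_subdifferential (\<lambda>\<xi>. G \<xi> (t\<^sub>n n)) (b\<^sub>n n)) \<and>
          b\<^sub>n \<longlonglongrightarrow> b \<and> filterlim t\<^sub>n at_top sequentially \<and> s\<^sub>n \<longlonglongrightarrow> 0 \<and>
          (\<lambda>n. s\<^sub>n n *\<^sub>R \<zeta>\<^sub>n n) \<longlonglongrightarrow> \<zeta>}"

end

theory Submission
  imports Defs
begin

text \<open>
  With the control \<open>u\<^sub>s\<close> frozen, the dynamics become \<open>x' = F t x\<close> with running cost \<open>g t x\<close>,
  and both functions are differentiable in \<open>x\<close> with derivatives \<open>A\<close> and \<open>q\<close> that are Lipschitz on
  bounded sets with integrable constants. The theorem is about this uncontrolled family of
  trajectories, and it rests on one identity. Let \<open>x\<close> and \<open>y\<close> be trajectories, and let \<open>\<psi>\<close> solve the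
  costate equation along \<open>x\<close> with multiplier \<open>1\<close> and \<open>\<psi> T = 0\<close>. The derivative of
  \<open>\<psi> \<bullet> (y - x)\<close> is \<open>q \<bullet> (y - x)\<close> plus \<open>\<psi>\<close> times the linearization error of \<open>F\<close>. Integrating over
  \<open>[0, T]\<close> gives \<open>J (y 0) - J (x 0) = - \<psi> 0 \<bullet> (y 0 - x 0) + O(|y 0 - x 0|\<^sup>2)\<close>
  (lemma \<open>cost_expansion\<close>), because trajectories depend on their initial values in a Lipschitz way.
  A function with such a two-sided quadratic expansion has its gradient as its only proximal
  subgradient, so \<open>\<partial>\<^sub>P(-J)\<close> at \<open>x 0\<close> is \<open>{\<psi> 0}\<close> (lemma \<open>proximal_subdifferential_total_cost\<close>).

  Consequently a costate with multiplier \<open>\<mu>\<^sub>n > 0\<close> that vanishes at the horizon \<open>t\<^sub>n\<close> is the same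
  thing as a proximal subgradient \<open>\<zeta>\<^sub>n\<close> for that horizon, through \<open>\<psi>\<^sub>n 0 = \<mu>\<^sub>n \<zeta>\<^sub>n\<close>.
  From a limiting solution one reads off \<open>\<zeta>\<^sub>n = \<psi>\<^sub>n 0 / \<mu>\<^sub>n\<close>; here \<open>\<mu>\<^sub>n\<close> is eventually
  positive. This is clear when the limit \<open>\<mu>\<^sub>s\<close> is positive. When \<open>\<mu>\<^sub>s = 0\<close>, the limit
  costate is nonzero at time \<open>0\<close>, while a costate with zero multiplier and zero terminal value is
  identically zero (lemma \<open>subgradients_from_terminal_costates\<close>). Conversely,
  given subgradients \<open>\<zeta>\<^sub>n\<close> and factors \<open>s\<^sub>n\<close>, one scales the normalized costates by \<open>s\<^sub>n\<close>;
  their values at time \<open>0\<close> converge, and the Gronwall inequality propagates the convergence to all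
  later times (lemma \<open>terminal_costates_from_subgradients\<close>). For \<open>\<mu>\<^sub>s > 0\<close> the factors are
  constantly \<open>\<mu>\<^sub>s\<close>, for \<open>\<mu>\<^sub>s = 0\<close> they tend to \<open>0\<close>, which gives the two alternatives.

  The costate that vanishes at \<open>T\<close> is obtained without solving an equation backwards: the map from
  the initial value to the value at \<open>T\<close> of a homogeneous costate is linear and injective, hence
  onto (lemma \<open>costate_exists_terminal\<close>).

  Solutions are understood in the sense of Caratheodory, so the argument is supported by a theory of
  absolutely continuous primitives: the fundamental theorem of calculus in both directions, a product
  rule, the Gronwall inequality and global existence for fields of linear growth.
\<close>

section \<open>Differentiation of absolutely continuous functions\<close>

text \<open>
  Fine tagged divisions split into two kinds of intervals. Where the tag is off \<open>N\<close>, the derivative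
  controls the increment up to a multiple of the length. The intervals with tag in \<open>N\<close> lie in an open set
  of small measure, so absolute continuity makes their increments small. The result is a
  Henstock-Kurzweil integral, so integrability of \<open>g\<close> is a conclusion.
\<close>

lemma ftc_absolutely_continuous:
  fixes h g :: "real \<Rightarrow> 'a::euclidean_space"
  assumes ab: "a \<le> b" and ac: "absolutely_continuous_on a b h" and N: "negligible N"
    and der: "\<And>t. t \<in> {a..b} - N \<Longrightarrow> (h has_vector_derivative g t) (at t within {a..b})"
  shows "(g has_integral (h b - h a)) {a..b}"
proof -
  define g' where "g' t = (if t \<in> N then 0 else g t)" for t
  have "(g' has_integral (h b - h a)) {a..b}"
    unfolding has_integral_real
  proof (intro allI impI)
    fix e :: real assume e: "e > 0"
    \<comment> \<open>Half of \<open>e\<close> is reserved for each kind of interval; the \<open>+ 1\<close> covers \<open>a = b\<close>.\<close>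
    define \<epsilon> where "\<epsilon> = e / (2 * (b - a + 1))"
    have \<epsilon>: "\<epsilon> > 0" and \<epsilon>b: "\<epsilon> * (b - a) < e / 2"
      using e ab by (auto simp: \<epsilon>_def field_simps)
    obtain \<delta> where \<delta>: "\<delta> > 0"
      and small: "\<And>d S. d division_of S \<Longrightarrow> S \<subseteq> {a..b} \<Longrightarrow> (\<Sum>k\<in>d. Sup k - Inf k) < \<delta> \<Longrightarrow>
                  (\<Sum>k\<in>d. norm (h (Sup k) - h (Inf k))) < e / 2"
      using ac e unfolding absolutely_continuous_on_def by (meson half_gt_zero)
    have Nm: "N \<in> lmeasurable" "N \<in> null_sets lebesgue"
      using N by (auto simp: negligible_imp_measurable negligible_iff_null_sets)
    obtain O' where O: "open O'" "N \<subseteq> O'" "O' - N \<in> lmeasurable" "emeasure lebesgue (O' - N) < ennreal \<delta>"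
      using sets_lebesgue_outer_open[of N \<delta>] \<delta> Nm by (metis fmeasurableD)
    have "measure lebesgue O' < \<delta>"
    proof -
      have "measure lebesgue (O' - N) < \<delta>"
        using O(3,4) \<delta> by (simp add: emeasure_eq_measure2 ennreal_less_iff)
      moreover have "measure lebesgue (O' - N) = measure lebesgue O'"
        using O(1) Nm(2) by (intro measure_Diff_null_set) auto
      ultimately show ?thesis by simp
    qed
    moreover have "O' \<in> lmeasurable"
      using fmeasurable.Un[OF O(3) Nm(1)] O(2) by (simp add: Un_absorb2)
    ultimately have O': "open O'" "N \<subseteq> O'" "O' \<in> lmeasurable" "measure lebesgue O' < \<delta>"
      using O by auto
    have "\<exists>d>0. \<forall>v\<in>{a..b}. \<bar>v - t\<bar> < d \<longrightarrow> norm (h v - h t - (v - t) *\<^sub>R g t) \<le> \<epsilon> * \<bar>v - t\<bar>"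
      if "t \<in> {a..b} - N" for t
      using der[OF that] \<epsilon> unfolding has_vector_derivative_def has_derivative_within_alt
      by (auto simp: real_norm_def)
    then obtain D where D: "\<And>t. t \<in> {a..b} - N \<Longrightarrow> D t > 0"
      and Dle: "\<And>t v. t \<in> {a..b} - N \<Longrightarrow> v \<in> {a..b} \<Longrightarrow> \<bar>v - t\<bar> < D t \<Longrightarrow>
                 norm (h v - h t - (v - t) *\<^sub>R g t) \<le> \<epsilon> * \<bar>v - t\<bar>"
      by metis
    define \<gamma> where "\<gamma> t = (if t \<in> N then O' else if t \<in> {a..b} then ball t (D t) else ball t 1)" for t
    have gau: "gauge \<gamma>"
      unfolding gauge_def \<gamma>_def using O' D by auto
    show "\<exists>\<gamma>. gauge \<gamma> \<and> (\<forall>\<D>. \<D> tagged_division_of {a..b} \<and> \<gamma> fine \<D> \<longrightarrow>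
            norm ((\<Sum>(x, k)\<in>\<D>. measure lborel k *\<^sub>R g' x) - (h b - h a)) < e)"
    proof (rule exI[of _ \<gamma>], intro conjI allI impI gau)
      fix p assume "p tagged_division_of {a..b} \<and> \<gamma> fine p"
      then have p: "p tagged_division_of {a..b}" and fine: "\<gamma> fine p" by auto
      have fin: "finite p" using p by auto
      have K: "\<exists>u v. k = {u..v} \<and> u \<le> v \<and> x \<in> {u..v} \<and> {u..v} \<subseteq> {a..b} \<and> {u..v} \<subseteq> \<gamma> x"
        if xk: "(x, k) \<in> p" for x k
      proof -
        obtain u v where "k = cbox u v" using tagged_division_ofD(4)[OF p xk] by blast
        moreover have "x \<in> k" "k \<subseteq> {a..b}" using tagged_division_ofD(2,3)[OF p xk] by auto
        moreover have "k \<subseteq> \<gamma> x" using fine xk by (auto simp: fine_def)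
        ultimately show ?thesis by (intro exI[of _ u] exI[of _ v]) auto
      qed
      have tel: "(\<Sum>(x,k)\<in>p. h (Sup k) - h (Inf k)) = h b - h a"
        using additive_tagged_division_1[OF ab p] by simp
      define p1 where "p1 = {xk\<in>p. fst xk \<in> N}"
      define p2 where "p2 = {xk\<in>p. fst xk \<notin> N}"
      have pp: "p = p1 \<union> p2" "p1 \<inter> p2 = {}" "p1 \<subseteq> p" "p2 \<subseteq> p" "finite p1" "finite p2"
        using fin by (auto simp: p1_def p2_def)
      define w where "w = (\<lambda>(x,k). measure lborel k *\<^sub>R g' x - (h (Sup k) - h (Inf k)))"
      have "(\<Sum>(x, k)\<in>p. measure lborel k *\<^sub>R g' x) - (h b - h a) = sum w p"
        unfolding w_def tel[symmetric] by (simp add: sum_subtractf[symmetric] case_prod_unfold)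
      also have "\<dots> = sum w p1 + sum w p2"
        using pp by (metis sum.union_disjoint)
      finally have split: "(\<Sum>(x, k)\<in>p. measure lborel k *\<^sub>R g' x) - (h b - h a) = sum w p1 + sum w p2" .
      have "norm (sum w p2) \<le> (\<Sum>(x,k)\<in>p2. \<epsilon> * measure lborel k)"
      proof (rule sum_norm_le, clarify)
        fix x k assume xk: "(x,k) \<in> p2"
        then have "(x,k) \<in> p" "x \<notin> N" by (auto simp: p2_def)
        then obtain u v where uv: "k = {u..v}" "u \<le> v" "x \<in> {u..v}" "{u..v} \<subseteq> {a..b}" "{u..v} \<subseteq> \<gamma> x"
          using K by blast
        have x: "x \<in> {a..b} - N" using uv \<open>x \<notin> N\<close> by auto
        then have "{u..v} \<subseteq> ball x (D x)" using uv by (simp add: \<gamma>_def)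
        then have d: "\<bar>u - x\<bar> < D x" "\<bar>v - x\<bar> < D x"
          using uv(2) by (auto simp: dist_real_def subset_iff abs_minus_commute)
        have "u \<in> {a..b}" "v \<in> {a..b}" using uv(2,4) by auto
        then have "norm (h v - h x - (v - x) *\<^sub>R g x) \<le> \<epsilon> * \<bar>v - x\<bar>"
             "norm (h u - h x - (u - x) *\<^sub>R g x) \<le> \<epsilon> * \<bar>u - x\<bar>"
          using d by (auto intro!: Dle[OF x] simp del: atLeastAtMost_iff)
        then have "norm ((h u - h x - (u - x) *\<^sub>R g x) - (h v - h x - (v - x) *\<^sub>R g x)) \<le> \<epsilon> * \<bar>u - x\<bar> + \<epsilon> * \<bar>v - x\<bar>"
          by (intro norm_triangle_le_diff) auto
        also have "\<dots> = \<epsilon> * (v - u)"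
          using uv by (auto simp: algebra_simps)
        also have "(h u - h x - (u - x) *\<^sub>R g x) - (h v - h x - (v - x) *\<^sub>R g x) = w (x,k)"
          using uv \<open>x \<notin> N\<close> by (simp add: w_def g'_def algebra_simps)
        finally show "norm (w (x,k)) \<le> \<epsilon> * measure lborel k" using uv by simp
      qed
      also have "\<dots> \<le> (\<Sum>(x,k)\<in>p. \<epsilon> * measure lborel k)"
        using fin pp \<epsilon> by (intro sum_mono2) auto
      also have "\<dots> = \<epsilon> * (b - a)"
        using additive_content_tagged_division[of p a b] p ab
        by (simp add: sum_distrib_left[symmetric] case_prod_unfold)
      finally have 2: "norm (sum w p2) < e / 2" using \<epsilon>b by linarith
      have p1t: "p1 tagged_division_of (\<Union>(snd ` p1))"
      proof -
        have "p1 tagged_partial_division_of {a..b}"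
          using p pp(3) by (auto simp: tagged_division_of_def intro: tagged_partial_division_subset)
        then show ?thesis by (rule tagged_partial_division_of_Union_self)
      qed
      have div: "snd ` p1 division_of (\<Union>(snd ` p1))"
        by (rule division_of_tagged_division[OF p1t])
      have sub: "\<Union>(snd ` p1) \<subseteq> {a..b} \<inter> O'"
      proof
        fix y assume "y \<in> \<Union>(snd ` p1)"
        then obtain x k where "(x,k) \<in> p" "x \<in> N" "y \<in> k" by (auto simp: p1_def)
        then show "y \<in> {a..b} \<inter> O'"
          using K[of x k] by (auto simp: \<gamma>_def)
      qed
      have "(\<Sum>k\<in>snd ` p1. Sup k - Inf k) = (\<Sum>k\<in>snd ` p1. measure lebesgue k)"
      proof (rule sum.cong[OF refl])
        fix k assume "k \<in> snd ` p1"
        then obtain x where "(x,k) \<in> p" by (auto simp: p1_def)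
        then show "Sup k - Inf k = measure lebesgue k" using K by fastforce
      qed
      also have "\<dots> = measure lebesgue (\<Union>(snd ` p1))"
        by (rule content_division[OF div])
      also have "\<dots> \<le> measure lebesgue O'"
        using sub O' lmeasurable_division[OF div] by (intro measure_mono_fmeasurable) auto
      finally have "(\<Sum>k\<in>snd ` p1. Sup k - Inf k) < \<delta>" using O' by linarith
      then have s: "(\<Sum>k\<in>snd ` p1. norm (h (Sup k) - h (Inf k))) < e / 2"
        using small[OF div] sub by blast
      have "norm (sum w p1) \<le> (\<Sum>(x,k)\<in>p1. norm (h (Sup k) - h (Inf k)))"
        by (rule sum_norm_le) (auto simp: w_def p1_def g'_def norm_minus_commute)
      also have "\<dots> = (\<Sum>k\<in>snd ` p1. norm (h (Sup k) - h (Inf k)))"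
      proof -
        \<comment> \<open>The transfer of the sum to \<open>snd ` p1\<close> asks for the value \<open>0\<close> on all degenerate intervals, including the empty one.\<close>
        define \<phi> where "\<phi> k = (if k = {} then 0 else norm (h (Sup k) - h (Inf k)))" for k
        have ne: "k \<noteq> {}" if "(x,k) \<in> p1" for x k
          using K[of x k] that by (auto simp: p1_def)
        have "(\<Sum>(x,k)\<in>p1. norm (h (Sup k) - h (Inf k))) = (\<Sum>(x,k)\<in>p1. \<phi> k)"
          by (rule sum.cong) (use ne in \<open>auto simp: \<phi>_def\<close>)
        also have "\<dots> = (\<Sum>k\<in>snd ` p1. \<phi> k)"
        proof (rule sum.over_tagged_division_lemma[OF p1t])
          fix u v :: real assume "box u v = {}"
          then have "cbox u v = {} \<or> u = v" by (auto simp: box_eq_empty)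
          then show "\<phi> (cbox u v) = 0" by (auto simp: \<phi>_def)
        qed
        also have "\<dots> = (\<Sum>k\<in>snd ` p1. norm (h (Sup k) - h (Inf k)))"
          by (rule sum.cong) (use ne in \<open>auto simp: \<phi>_def\<close>)
        finally show ?thesis .
      qed
      finally have 1: "norm (sum w p1) < e / 2" using s by linarith
      show "norm ((\<Sum>(x, k)\<in>p. measure lborel k *\<^sub>R g' x) - (h b - h a)) < e"
        unfolding split using 1 2 norm_triangle_ineq[of "sum w p1" "sum w p2"] by linarith
    qed
  qed
  then show ?thesis
    by (rule has_integral_spike[OF N, rotated]) (auto simp: g'_def)
qed

text \<open>
  The Lebesgue differentiation theorem on the line. At a bad point \<open>t\<close> there are arbitrarily short
  segments from \<open>t\<close> on which the integral differs from \<open>g t\<close> times the length by more than \<open>\<epsilon>\<close> times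
  the length. Disjoint segments of this kind form a partial tagged division, and the Henstock lemma
  bounds their total length. The Vitali covering lemma passes from disjoint segments to a cover of all
  bad points at the price of a factor 5.
\<close>

lemma indefinite_integral_has_derivative_ae:
  fixes g :: "real \<Rightarrow> 'a::euclidean_space"
  assumes int: "g integrable_on {a..b}"
  obtains N where "negligible N"
    "\<And>t. t \<in> {a<..<b} - N \<Longrightarrow> ((\<lambda>s. integral {a..s} g) has_vector_derivative g t) (at t)"
proof -
  define G where "G s = integral {a..s} g" for s
  have Gdiff: "integral {u..v} g = G v - G u" if "a \<le> u" "u \<le> v" "v \<le> b" for u v
    using Henstock_Kurzweil_Integration.integral_combine[of a u v g] integrable_subinterval_real[OF int, of a v] that
    unfolding G_def by (auto simp: algebra_simps)
  define bad where "bad \<epsilon> t v \<longleftrightarrow> v \<in> {a..b} \<and> v \<noteq> t \<and> norm (G v - G t - (v - t) *\<^sub>R g t) > \<epsilon> * \<bar>v - t\<bar>" for \<epsilon> t v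
  define E where "E \<epsilon> = {t\<in>{a<..<b}. \<forall>d>0. \<exists>v. bad \<epsilon> t v \<and> \<bar>v - t\<bar> < d}" for \<epsilon>
  have negE: "negligible (E \<epsilon>)" if \<epsilon>: "\<epsilon> > 0" for \<epsilon>
    unfolding negligible_outer_le
  proof (intro allI impI)
    fix e :: real assume e: "e > 0"
    define \<eta> where "\<eta> = e * \<epsilon> / 5"
    have \<eta>: "\<eta> > 0" using e \<epsilon> by (simp add: \<eta>_def)
    obtain \<gamma> where gau: "gauge \<gamma>" and hen: "\<And>p. \<lbrakk>p tagged_partial_division_of (cbox a b); \<gamma> fine p\<rbrakk> \<Longrightarrow>
             sum (\<lambda>(x,k). norm(measure lborel k *\<^sub>R g x - integral k g)) p < \<eta>"
      using Henstock_lemma[of g a b \<eta>] int \<eta> by auto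
    have "\<exists>v. bad \<epsilon> t v \<and> closed_segment t v \<subseteq> \<gamma> t \<and> \<bar>v - t\<bar> \<le> 1" if "t \<in> E \<epsilon>" for t
    proof -
      obtain d where d: "d > 0" "ball t d \<subseteq> \<gamma> t"
        using gau by (meson gauge_def openE)
      have "min d 1 > 0" using d by simp
      then obtain v where v: "bad \<epsilon> t v" "\<bar>v - t\<bar> < min d 1"
        using \<open>t \<in> E \<epsilon>\<close> unfolding E_def by blast
      have "closed_segment t v \<subseteq> ball t d"
        using v d by (intro closed_segment_subset) (auto simp: dist_real_def abs_minus_commute)
      then show ?thesis using v d by (intro exI[of _ v]) auto
    qed
    then obtain V where V: "\<And>t. t \<in> E \<epsilon> \<Longrightarrow> bad \<epsilon> t (V t)"
        "\<And>t. t \<in> E \<epsilon> \<Longrightarrow> closed_segment t (V t) \<subseteq> \<gamma> t" "\<And>t. t \<in> E \<epsilon> \<Longrightarrow> \<bar>V t - t\<bar> \<le> 1"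
      by metis
    \<comment> \<open>The segment from \<open>t\<close> to \<open>V t\<close> is a closed ball, as the covering lemma requires.\<close>
    define c where "c t = (t + V t) / 2" for t
    define r where "r t = \<bar>V t - t\<bar> / 2" for t
    have cb: "cball (c t) (r t) = closed_segment t (V t)" for t
      by (auto simp: c_def r_def closed_segment_eq_real_ivl cball_eq_atLeastAtMost abs_if field_simps)
    have r: "0 < r t \<and> r t \<le> 1" if "t \<in> E \<epsilon>" for t
      using V[OF that] by (auto simp: r_def bad_def)
    have cov: "E \<epsilon> \<subseteq> (\<Union>t\<in>E \<epsilon>. cball (c t) (r t))"
      unfolding cb by auto
    obtain C where C: "countable C" "C \<subseteq> E \<epsilon>"
      "pairwise (\<lambda>i j. disjnt (cball (c i) (r i)) (cball (c j) (r j))) C"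
      "E \<epsilon> \<subseteq> (\<Union>i\<in>C. cball (c i) (5 * r i))"
      by (rule Vitali_covering_lemma_cballs[OF cov, of 1]) (use r in auto)
    have bnd: "measure lebesgue (\<Union>i\<in>F. cball (c i) (5 * r i)) \<le> e" if F: "F \<subseteq> C" "finite F" for F
    proof -
      define p where "p = (\<lambda>t. (t, cball (c t) (r t))) ` F"
      have part: "p tagged_partial_division_of (cbox a b)"
        unfolding tagged_partial_division_of_def
      proof (intro conjI allI impI)
        show "finite p" using F by (simp add: p_def)
      next
        fix x k assume "(x,k) \<in> p"
        then have xk: "k = closed_segment x (V x)" "x \<in> F" by (auto simp: p_def cb)
        then have "x \<in> E \<epsilon>" using F C by auto
        then show "x \<in> k" "k \<subseteq> cbox a b"
          using xk V(1)[of x] by (auto simp: E_def bad_def closed_segment_eq_real_ivl split: if_splits)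
        show "\<exists>a b. k = cbox a b"
          using xk by (auto simp: closed_segment_eq_real_ivl)
      next
        fix x1 k1 x2 k2 assume "(x1,k1) \<in> p \<and> (x2,k2) \<in> p \<and> (x1,k1) \<noteq> (x2,k2)"
        then have "x1 \<in> C" "x2 \<in> C" "x1 \<noteq> x2" "k1 = cball (c x1) (r x1)" "k2 = cball (c x2) (r x2)"
          using F by (auto simp: p_def)
        then have "disjnt k1 k2" using C(3) unfolding pairwise_def by blast
        then show "interior k1 \<inter> interior k2 = {}"
          using interior_subset unfolding disjnt_def by blast
      qed
      have "\<gamma> fine p"
        unfolding fine_def p_def cb using F(1) C(2) V(2) by blast
      then have lt: "(\<Sum>(x,k)\<in>p. norm(measure lborel k *\<^sub>R g x - integral k g)) < \<eta>"
        using hen part by blast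
      have "(\<Sum>(x,k)\<in>p. norm(measure lborel k *\<^sub>R g x - integral k g)) =
            (\<Sum>t\<in>F. norm (measure lborel (cball (c t) (r t)) *\<^sub>R g t - integral (cball (c t) (r t)) g))"
        unfolding p_def by (subst sum.reindex) (auto simp: inj_on_def)
      also have "\<dots> \<ge> (\<Sum>t\<in>F. \<epsilon> * (2 * r t))"
      proof (rule sum_mono)
        fix t assume "t \<in> F"
        then have tE: "t \<in> E \<epsilon>" using F C by auto
        have vb: "V t \<in> {a..b}" and tb: "t \<in> {a..b}"
          and big: "norm (G (V t) - G t - (V t - t) *\<^sub>R g t) > \<epsilon> * \<bar>V t - t\<bar>"
          using V(1)[OF tE] tE by (auto simp: bad_def E_def)
        have "norm (measure lborel (cball (c t) (r t)) *\<^sub>R g t - integral (cball (c t) (r t)) g) =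
              norm (G (V t) - G t - (V t - t) *\<^sub>R g t)"
        proof (cases "t \<le> V t")
          case True
          then show ?thesis
            using Gdiff[of t "V t"] vb tb
            by (simp add: cb closed_segment_eq_real_ivl norm_minus_commute)
        next
          case False
          have "(t - V t) *\<^sub>R g t - (G t - G (V t)) = G (V t) - G t - (V t - t) *\<^sub>R g t"
            by (simp add: algebra_simps)
          moreover have "measure lborel (cball (c t) (r t)) = t - V t"
            "integral (cball (c t) (r t)) g = G t - G (V t)"
            using Gdiff[of "V t" t] vb tb False by (auto simp: cb closed_segment_eq_real_ivl)
          ultimately show ?thesis by (simp only:)
        qed
        then show "\<epsilon> * (2 * r t) \<le> norm (measure lborel (cball (c t) (r t)) *\<^sub>R g t - integral (cball (c t) (r t)) g)"
          using big by (simp add: r_def)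
      qed
      finally have le: "(\<Sum>t\<in>F. \<epsilon> * (2 * r t)) < \<eta>" using lt by linarith
      have rF: "0 < r t" if "t \<in> F" for t using that F C r by blast
      have "measure lebesgue (\<Union>i\<in>F. cball (c i) (5 * r i)) \<le> (\<Sum>i\<in>F. measure lebesgue (cball (c i) (5 * r i)))"
        using F by (intro measure_UNION_le) auto
      also have "\<dots> = (\<Sum>i\<in>F. 10 * r i)"
        using rF by (intro sum.cong) (auto simp: cball_eq_atLeastAtMost less_imp_le)
      also have "\<dots> = 5 / \<epsilon> * (\<Sum>t\<in>F. \<epsilon> * (2 * r t))"
        using \<epsilon> by (simp add: sum_distrib_left)
      also have "\<dots> \<le> 5 / \<epsilon> * \<eta>"
        using le \<epsilon> by (intro mult_left_mono) auto
      also have "\<dots> = e" using \<epsilon> by (simp add: \<eta>_def)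
      finally show ?thesis .
    qed
    show "\<exists>T. E \<epsilon> \<subseteq> T \<and> T \<in> lmeasurable \<and> measure lebesgue T \<le> e"
    proof (intro exI conjI)
      show "E \<epsilon> \<subseteq> (\<Union>i\<in>C. cball (c i) (5 * r i))" by fact
      show "(\<Union>i\<in>C. cball (c i) (5 * r i)) \<in> lmeasurable"
        by (rule fmeasurable_UN_bound[OF C(1), of _ _ e]) (use bnd e in auto)
      show "measure lebesgue (\<Union>i\<in>C. cball (c i) (5 * r i)) \<le> e"
        by (rule measure_UN_bound[OF C(1), of _ _ e]) (use bnd e in auto)
    qed
  qed
  define N where "N = (\<Union>n::nat. E (inverse (Suc n)))"
  have "negligible N"
    unfolding N_def by (intro negligible_countable_Union) (auto intro: negE)
  moreover have "((\<lambda>s. integral {a..s} g) has_vector_derivative g t) (at t)" if t: "t \<in> {a<..<b} - N" for t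
    unfolding has_vector_derivative_def has_derivative_at_alt G_def[symmetric]
  proof (intro conjI allI impI)
    show "bounded_linear (\<lambda>x. x *\<^sub>R g t)" by (rule bounded_linear_scaleR_left)
    fix e :: real assume e: "e > 0"
    then obtain n where n: "inverse (Suc n) < e" using reals_Archimedean by blast
    have "t \<notin> E (inverse (Suc n))" using t by (auto simp: N_def)
    then obtain d where d: "d > 0" "\<And>v. \<bar>v - t\<bar> < d \<Longrightarrow> \<not> bad (inverse (Suc n)) t v"
      using t unfolding E_def by blast
    let ?d = "min d (min (t - a) (b - t))"
    show "\<exists>d>0. \<forall>y. norm (y - t) < d \<longrightarrow> norm (G y - G t - (y - t) *\<^sub>R g t) \<le> e * norm (y - t)"
    proof (intro exI[of _ ?d] conjI allI impI)
      show "?d > 0" using d t by auto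
      fix y assume y: "norm (y - t) < ?d"
      then have yab: "y \<in> {a..b}" by auto
      have "norm (G y - G t - (y - t) *\<^sub>R g t) \<le> inverse (Suc n) * \<bar>y - t\<bar>"
      proof (cases "y = t")
        case False
        then show ?thesis using d(2)[of y] y yab unfolding bad_def by auto
      qed simp
      also have "\<dots> \<le> e * \<bar>y - t\<bar>" using n by (intro mult_right_mono) auto
      finally show "norm (G y - G t - (y - t) *\<^sub>R g t) \<le> e * norm (y - t)" by simp
    qed
  qed
  ultimately show ?thesis using that by blast
qed

section \<open>Absolutely continuous primitives\<close>

text \<open>
  Outside the exceptional set both sides are unchanged when the functions are set to zero on it.
\<close>

lemma integral_norm_bound_ae:
  fixes f :: "real \<Rightarrow> 'a::euclidean_space"
  assumes "f integrable_on S" "K integrable_on S" "negligible N"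
    and "\<And>t. t \<in> S - N \<Longrightarrow> norm (f t) \<le> K t"
  shows "norm (integral S f) \<le> integral S K"
proof -
  define f' where "f' t = (if t \<in> N then 0 else f t)" for t
  define K' where "K' t = (if t \<in> N then 0 else K t)" for t
  have "integral S f = integral S f'" "integral S K = integral S K'"
    using assms(3) by (auto intro!: integral_spike simp: f'_def K'_def)
  moreover have "f' integrable_on S" "K' integrable_on S"
    using assms(1-3) by (auto intro: integrable_spike simp: f'_def K'_def)
  ultimately show ?thesis
    using assms(4) by (auto intro!: integral_norm_bound_integral simp: f'_def K'_def)
qed

lemma absolutely_integrable_ae_bound:
  fixes f :: "real \<Rightarrow> 'a::euclidean_space"
  assumes "f \<in> borel_measurable (lebesgue_on S)" "S \<in> sets lebesgue"
    and "K integrable_on S" "negligible N" "\<And>t. t \<in> S - N \<Longrightarrow> norm (f t) \<le> K t"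
  shows "f absolutely_integrable_on S"
proof (rule measurable_bounded_by_integrable_imp_absolutely_integrable[OF assms(1,2)])
  show "(\<lambda>t. if t \<in> N then norm (f t) else K t) integrable_on S"
    using assms(3,4) by (auto intro: integrable_spike)
qed (use assms(5) in auto)

lemma absolutely_integrable_continuous_bilinear:
  fixes f :: "real \<Rightarrow> 'a::euclidean_space" and g :: "real \<Rightarrow> 'b::euclidean_space"
    and B :: "'a \<Rightarrow> 'b \<Rightarrow> 'c::euclidean_space"
  assumes B: "bounded_bilinear B" and f: "continuous_on {0..T} f" and g: "g absolutely_integrable_on {0..T}"
  shows "(\<lambda>t. B (f t) (g t)) absolutely_integrable_on {0..T}"
proof (rule absolutely_integrable_bounded_measurable_product[where h=B and f=f, OF _ _ _ _ g])
  show "bilinear B" using B by (simp add: bilinear_conv_bounded_bilinear)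
  show "f \<in> borel_measurable (lebesgue_on {0..T})"
    using f by (intro continuous_imp_measurable_on_sets_lebesgue) auto
  show "bounded (f ` {0..T})"
    using f by (intro compact_imp_bounded compact_continuous_image) auto
qed auto

lemma absolutely_continuous_on_lipschitz_compose:
  fixes f :: "real \<Rightarrow> 'a::real_normed_vector" and \<phi> :: "'a \<Rightarrow> 'b::real_normed_vector"
  assumes f: "absolutely_continuous_on a b f" and L: "L \<ge> 0"
    and lip: "\<And>s t. s \<in> {a..b} \<Longrightarrow> t \<in> {a..b} \<Longrightarrow> norm (h t - h s) \<le> L * norm (f t - f s)"
  shows "absolutely_continuous_on a b (h :: real \<Rightarrow> 'b)"
  unfolding absolutely_continuous_on_def
proof (intro allI impI)
  fix e :: real assume e: "e > 0"
  then have "e / (L + 1) > 0" using L by simp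
  then obtain d where d: "d > 0" and D: "\<And>D S. D division_of S \<Longrightarrow> S \<subseteq> {a..b} \<Longrightarrow>
      (\<Sum>k\<in>D. Sup k - Inf k) < d \<Longrightarrow> (\<Sum>k\<in>D. norm (f (Sup k) - f (Inf k))) < e / (L + 1)"
    using f unfolding absolutely_continuous_on_def by meson
  show "\<exists>\<delta>>0. \<forall>D S. D division_of S \<and> S \<subseteq> {a..b} \<and> (\<Sum>k\<in>D. Sup k - Inf k) < \<delta> \<longrightarrow>
           (\<Sum>k\<in>D. norm (h (Sup k) - h (Inf k))) < e"
  proof (intro exI[of _ d] conjI d allI impI; elim conjE)
    fix D S assume DS: "D division_of S" "S \<subseteq> {a..b}" "(\<Sum>k\<in>D. Sup k - Inf k) < d"
    have "(\<Sum>k\<in>D. norm (h (Sup k) - h (Inf k))) \<le> (\<Sum>k\<in>D. L * norm (f (Sup k) - f (Inf k)))"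
    proof (intro sum_mono lip)
      fix k assume "k \<in> D"
      then obtain u v where "k = {u..v}" "u \<le> v" "{u..v} \<subseteq> {a..b}"
        using division_ofD(2,3,4)[OF DS(1)] DS(2) by (metis atLeastatMost_empty_iff2 box_real(2) subset_trans)
      then show "Sup k \<in> {a..b}" "Inf k \<in> {a..b}" by auto
    qed
    also have "\<dots> = L * (\<Sum>k\<in>D. norm (f (Sup k) - f (Inf k)))"
      by (simp add: sum_distrib_left)
    also have "\<dots> \<le> L * (e / (L + 1))"
      using D[OF DS] L by (intro mult_left_mono) auto
    also have "\<dots> < e" using L e by (simp add: field_simps)
    finally show "(\<Sum>k\<in>D. norm (h (Sup k) - h (Inf k))) < e" .
  qed
qed

lemma absolutely_continuous_on_subset:
  assumes "absolutely_continuous_on a b f" "{c..d} \<subseteq> {a..b}"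
  shows "absolutely_continuous_on c d f"
  using assms unfolding absolutely_continuous_on_def by (meson subset_trans)

lemma absolutely_continuous_on_cong:
  assumes "absolutely_continuous_on a b f" "\<And>t. t \<in> {a..b} \<Longrightarrow> f t = g t"
  shows "absolutely_continuous_on a b g"
  using absolutely_continuous_on_lipschitz_compose[OF assms(1), of 1 g] assms(2) by simp

text \<open>
  The increment of a product splits as \<open>B (f v - f u) (g v) + B (f u) (g v - g u)\<close>, and the two
  undifferenced factors are bounded.
\<close>

lemma absolutely_continuous_on_bilinear:
  fixes f :: "real \<Rightarrow> 'a::real_normed_vector" and g :: "real \<Rightarrow> 'b::real_normed_vector"
    and B :: "'a \<Rightarrow> 'b \<Rightarrow> 'c::real_normed_vector"
  assumes B: "bounded_bilinear B"
    and f: "absolutely_continuous_on a b f" "bounded (f ` {a..b})"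
    and g: "absolutely_continuous_on a b g" "bounded (g ` {a..b})"
  shows "absolutely_continuous_on a b (\<lambda>t. B (f t) (g t))"
  unfolding absolutely_continuous_on_def
proof (intro allI impI)
  interpret bounded_bilinear B by fact
  fix e :: real assume e: "e > 0"
  obtain K where K: "K > 0" "\<And>x y. norm (B x y) \<le> norm x * norm y * K"
    using pos_bounded by blast
  obtain M where M: "M > 0" "\<And>t. t \<in> {a..b} \<Longrightarrow> norm (f t) \<le> M" "\<And>t. t \<in> {a..b} \<Longrightarrow> norm (g t) \<le> M"
  proof -
    obtain M1 M2 where "\<forall>x\<in>f ` {a..b}. norm x \<le> M1" "\<forall>x\<in>g ` {a..b}. norm x \<le> M2"
      using f(2) g(2) unfolding bounded_iff by blast
    then show ?thesis by (intro that[of "max 1 (max M1 M2)"]) (auto simp: le_max_iff_disj)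
  qed
  define \<epsilon> where "\<epsilon> = e / (2 * K * M)"
  have \<epsilon>: "\<epsilon> > 0" using e K M by (simp add: \<epsilon>_def)
  obtain d1 where d1: "d1 > 0" and D1: "\<And>D S. D division_of S \<Longrightarrow> S \<subseteq> {a..b} \<Longrightarrow>
      (\<Sum>k\<in>D. Sup k - Inf k) < d1 \<Longrightarrow> (\<Sum>k\<in>D. norm (f (Sup k) - f (Inf k))) < \<epsilon>"
    using f(1) \<epsilon> unfolding absolutely_continuous_on_def by meson
  obtain d2 where d2: "d2 > 0" and D2: "\<And>D S. D division_of S \<Longrightarrow> S \<subseteq> {a..b} \<Longrightarrow>
      (\<Sum>k\<in>D. Sup k - Inf k) < d2 \<Longrightarrow> (\<Sum>k\<in>D. norm (g (Sup k) - g (Inf k))) < \<epsilon>"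
    using g(1) \<epsilon> unfolding absolutely_continuous_on_def by meson
  show "\<exists>\<delta>>0. \<forall>D S. D division_of S \<and> S \<subseteq> {a..b} \<and> (\<Sum>k\<in>D. Sup k - Inf k) < \<delta> \<longrightarrow>
           (\<Sum>k\<in>D. norm (B (f (Sup k)) (g (Sup k)) - B (f (Inf k)) (g (Inf k)))) < e"
  proof (intro exI[of _ "min d1 d2"] conjI allI impI; (elim conjE)?)
    show "min d1 d2 > 0" using d1 d2 by simp
    fix D S assume DS: "D division_of S" "S \<subseteq> {a..b}" "(\<Sum>k\<in>D. Sup k - Inf k) < min d1 d2"
    have "(\<Sum>k\<in>D. norm (B (f (Sup k)) (g (Sup k)) - B (f (Inf k)) (g (Inf k)))) \<le>
          (\<Sum>k\<in>D. K * M * norm (f (Sup k) - f (Inf k)) + K * M * norm (g (Sup k) - g (Inf k)))"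
    proof (intro sum_mono)
      fix k assume "k \<in> D"
      then obtain u v where uv: "k = {u..v}" "u \<le> v" "{u..v} \<subseteq> {a..b}"
        using division_ofD(2,3,4)[OF DS(1)] DS(2) by (metis atLeastatMost_empty_iff2 box_real(2) subset_trans)
      have "B (f v) (g v) - B (f u) (g u) = B (f v - f u) (g v) + B (f u) (g v - g u)"
        by (simp add: diff_left diff_right)
      then have "norm (B (f v) (g v) - B (f u) (g u)) \<le> norm (f v - f u) * norm (g v) * K + norm (f u) * norm (g v - g u) * K"
        by (simp) (intro norm_triangle_le add_mono K)
      also have "\<dots> \<le> norm (f v - f u) * M * K + M * norm (g v - g u) * K"
        using M(2)[of u] M(3)[of v] uv K by (intro add_mono mult_right_mono mult_left_mono) auto
      finally show "norm (B (f (Sup k)) (g (Sup k)) - B (f (Inf k)) (g (Inf k))) \<le>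
         K * M * norm (f (Sup k) - f (Inf k)) + K * M * norm (g (Sup k) - g (Inf k))"
        using uv by (simp add: algebra_simps)
    qed
    also have "\<dots> = K * M * ((\<Sum>k\<in>D. norm (f (Sup k) - f (Inf k))) + (\<Sum>k\<in>D. norm (g (Sup k) - g (Inf k))))"
      by (simp add: sum.distrib sum_distrib_left algebra_simps)
    also have "\<dots> < K * M * (\<epsilon> + \<epsilon>)"
      using D1[of D S] D2[of D S] DS K M by (intro mult_strict_left_mono add_strict_mono) auto
    also have "\<dots> = e" using K M by (simp add: \<epsilon>_def)
    finally show "(\<Sum>k\<in>D. norm (B (f (Sup k)) (g (Sup k)) - B (f (Inf k)) (g (Inf k)))) < e" .
  qed
qed

text \<open>
  Truncating \<open>norm \<circ> g\<close> at a height \<open>n\<close> loses little of its integral, and the truncation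
  contributes at most \<open>n\<close> times the total length of the intervals.
\<close>

lemma absolutely_continuous_on_indefinite_integral:
  fixes g :: "real \<Rightarrow> 'a::euclidean_space"
  assumes g: "g absolutely_integrable_on {a..b}"
  shows "absolutely_continuous_on a b (\<lambda>t. integral {a..t} g)"
  unfolding absolutely_continuous_on_def
proof (intro allI impI)
  fix e :: real assume e: "e > 0"
  define w where "w t = norm (g t)" for t
  define m where "m n t = min (w t) (real n)" for n t
  have gi: "g integrable_on {a..b}" and wai: "w absolutely_integrable_on {a..b}" and wi: "w integrable_on {a..b}"
    using g unfolding w_def absolutely_integrable_on_def by auto
  have mi: "m n integrable_on {a..b}" for n
    using absolutely_integrable_min_1[OF wai, of "\<lambda>_. real n"]
    unfolding m_def by (auto simp: absolutely_integrable_on_def)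
  have "(\<lambda>n. integral {a..b} (m n)) \<longlonglongrightarrow> integral {a..b} w"
  proof (rule dominated_convergence(2)[OF mi wi])
    show "norm (m n t) \<le> w t" for n t by (simp add: m_def w_def)
    show "(\<lambda>n. m n t) \<longlonglongrightarrow> w t" for t
    proof (rule tendsto_eventually)
      obtain n0 where "w t \<le> real n0" using real_arch_simple by blast
      then show "\<forall>\<^sub>F n in sequentially. m n t = w t"
        unfolding eventually_sequentially m_def by (intro exI[of _ n0]) auto
    qed
  qed
  then obtain n where n: "integral {a..b} w - integral {a..b} (m n) < e / 2"
    using e LIMSEQ_D[of "\<lambda>n. integral {a..b} (m n)" "integral {a..b} w" "e/2"]
    by (force simp: abs_if split: if_splits)
  define \<delta> where "\<delta> = e / (2 * (real n + 1))"
  have \<delta>: "\<delta> > 0" "real n * \<delta> < e / 2" using e by (auto simp: \<delta>_def field_simps)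
  show "\<exists>\<delta>>0. \<forall>D S. D division_of S \<and> S \<subseteq> {a..b} \<and> (\<Sum>k\<in>D. Sup k - Inf k) < \<delta> \<longrightarrow>
           (\<Sum>k\<in>D. norm (integral {a..Sup k} g - integral {a..Inf k} g)) < e"
  proof (intro exI[of _ \<delta>] conjI \<delta> allI impI; elim conjE)
    fix D S assume D: "D division_of S" and S: "S \<subseteq> {a..b}" and small: "(\<Sum>k\<in>D. Sup k - Inf k) < \<delta>"
    have wm: "(\<lambda>t. w t - m n t) integrable_on {a..b}" using wi mi by (rule integrable_diff)
    have k: "\<exists>u v. k = {u..v} \<and> u \<le> v \<and> {u..v} \<subseteq> {a..b}" if "k \<in> D" for k
      using division_ofD(2,3,4)[OF D that] S by (metis atLeastatMost_empty_iff2 box_real(2) subset_trans)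
    have S_int: "f integrable_on S" if "f integrable_on {a..b}" for f :: "real \<Rightarrow> real"
      using integrable_on_subdivision[OF D that S] .
    have "(\<Sum>k\<in>D. norm (integral {a..Sup k} g - integral {a..Inf k} g)) \<le>
          (\<Sum>k\<in>D. real n * (Sup k - Inf k) + integral k (\<lambda>t. w t - m n t))"
    proof (rule sum_mono)
      fix k assume "k \<in> D"
      then obtain u v where uv: "k = {u..v}" "u \<le> v" "{u..v} \<subseteq> {a..b}" using k by blast
      have sub: "f integrable_on {u..v}" if "f integrable_on {a..b}" for f :: "real \<Rightarrow> real"
        using integrable_subinterval_real[OF that uv(3)] .
      have "integral {a..v} g - integral {a..u} g = integral {u..v} g"
        using Henstock_Kurzweil_Integration.integral_combine[of a u v g]
          integrable_subinterval_real[OF gi, of a v] uv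
        by (auto simp: algebra_simps)
      then have "norm (integral {a..v} g - integral {a..u} g) \<le> integral {u..v} w"
        using integral_norm_bound_integral[of g "{u..v}" w] sub[OF wi]
          integrable_subinterval_real[OF gi uv(3)] by (simp add: w_def)
      also have "\<dots> = integral {u..v} (m n) + integral {u..v} (\<lambda>t. w t - m n t)"
        using sub[OF wi] sub[OF mi] by (simp add: integral_diff)
      also have "integral {u..v} (m n) \<le> integral {u..v} (\<lambda>_. real n)"
        using sub[OF mi] by (intro integral_le) (auto simp: m_def)
      also have "\<dots> = real n * (v - u)" using uv by simp
      finally show "norm (integral {a..Sup k} g - integral {a..Inf k} g) \<le>
          real n * (Sup k - Inf k) + integral k (\<lambda>t. w t - m n t)"
        using uv by simp
    qed
    also have "\<dots> = real n * (\<Sum>k\<in>D. Sup k - Inf k) + integral S (\<lambda>t. w t - m n t)"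
      using integral_combine_division_topdown[OF S_int[OF wm] D] by (simp add: sum.distrib sum_distrib_left)
    also have "\<dots> \<le> real n * \<delta> + integral {a..b} (\<lambda>t. w t - m n t)"
      using small S_int[OF wm] wm S by (intro add_mono mult_left_mono integral_subset_le) (auto simp: m_def)
    also have "\<dots> < e" using n \<delta> wi mi by (simp add: integral_diff)
    finally show "(\<Sum>k\<in>D. norm (integral {a..Sup k} g - integral {a..Inf k} g)) < e" .
  qed
qed

text \<open>
  The integral form of \<open>x' = g\<close> almost everywhere on \<open>[0, T]\<close> with \<open>x\<close> absolutely continuous. This
  form is closed under the algebraic operations below, and it avoids exceptional null sets.
\<close>

definition primitive_on :: "real \<Rightarrow> (real \<Rightarrow> 'a::euclidean_space) \<Rightarrow> (real \<Rightarrow> 'a) \<Rightarrow> bool" where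
  "primitive_on T g x \<longleftrightarrow> g absolutely_integrable_on {0..T} \<and> (\<forall>t\<in>{0..T}. x t = x 0 + integral {0..t} g)"

lemma primitive_onD:
  assumes "primitive_on T g x"
  shows "g absolutely_integrable_on {0..T}" "g integrable_on {0..T}"
    "\<And>t. t \<in> {0..T} \<Longrightarrow> x t = x 0 + integral {0..t} g"
  using assms unfolding primitive_on_def absolutely_integrable_on_def by blast+

lemma primitive_on_indefinite_integral:
  assumes "g absolutely_integrable_on {0..T}"
  shows "primitive_on T g (\<lambda>t. c + integral {0..t} g)"
  using assms by (auto simp: primitive_on_def)

lemma primitive_on_subset:
  assumes "primitive_on T g x" "S \<le> T"
  shows "primitive_on S g x"
  unfolding primitive_on_def
proof (intro conjI ballI)
  show "g absolutely_integrable_on {0..S}"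
    using absolutely_integrable_on_subinterval[OF primitive_onD(1)[OF assms(1)], of 0 S] assms(2) by auto
  show "x t = x 0 + integral {0..t} g" if "t \<in> {0..S}" for t
    by (rule primitive_onD(3)[OF assms(1)]) (use that assms(2) in auto)
qed

lemma primitive_on_cong:
  assumes "primitive_on T g x" "\<And>t. t \<in> {0..T} \<Longrightarrow> x t = y t" "negligible N" "\<And>t. t \<in> {0..T} - N \<Longrightarrow> g t = h t"
  shows "primitive_on T h y"
  unfolding primitive_on_def
proof (intro conjI ballI)
  show "h absolutely_integrable_on {0..T}"
    using absolutely_integrable_spike[OF primitive_onD(1)[OF assms(1)] assms(3)] assms(4) by simp
  fix t assume t: "t \<in> {0..T}"
  have "integral {0..t} g = integral {0..t} h"
    by (rule integral_spike[OF assms(3)]) (use assms(4) t in auto)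
  then show "y t = y 0 + integral {0..t} h"
    using primitive_onD(3)[OF assms(1) t] assms(2)[OF t] assms(2)[of 0] t by (metis atLeastAtMost_iff order.refl order.trans)
qed

lemma primitive_on_continuous:
  assumes "primitive_on T g x"
  shows "continuous_on {0..T} x"
proof -
  have "continuous_on {0..T} (\<lambda>t. x 0 + integral {0..t} g)"
    by (intro continuous_intros indefinite_integral_continuous_1 primitive_onD(2)[OF assms])
  then show ?thesis by (rule continuous_on_eq) (simp add: primitive_onD(3)[OF assms, symmetric])
qed

lemma primitive_on_absolutely_continuous:
  assumes "primitive_on T g x"
  shows "absolutely_continuous_on 0 T x"
proof -
  have "absolutely_continuous_on 0 T (\<lambda>t. x 0 + integral {0..t} g)"
    by (rule absolutely_continuous_on_lipschitz_compose[where L=1,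
          OF absolutely_continuous_on_indefinite_integral[OF primitive_onD(1)[OF assms]]]) auto
  then show ?thesis by (rule absolutely_continuous_on_cong) (simp add: primitive_onD(3)[OF assms, symmetric])
qed

lemma primitive_on_has_derivative_ae:
  assumes "primitive_on T g x"
  obtains N where "negligible N" "\<And>t. t \<in> {0<..<T} - N \<Longrightarrow> (x has_vector_derivative g t) (at t)"
proof -
  obtain N where N: "negligible N"
    "\<And>t. t \<in> {0<..<T} - N \<Longrightarrow> ((\<lambda>s. integral {0..s} g) has_vector_derivative g t) (at t)"
    using indefinite_integral_has_derivative_ae[OF primitive_onD(2)[OF assms]] by blast
  have "(x has_vector_derivative g t) (at t)" if t: "t \<in> {0<..<T} - N" for t
  proof -
    have "((\<lambda>s. x 0 + integral {0..s} g) has_vector_derivative 0 + g t) (at t)"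
      by (intro has_vector_derivative_add has_vector_derivative_const N(2) t)
    then have "((\<lambda>s. x 0 + integral {0..s} g) has_vector_derivative g t) (at t)" by simp
    then show ?thesis
    proof (rule has_vector_derivative_transform_within_open[where S="{0<..<T}"])
      show "x 0 + integral {0..s} g = x s" if "s \<in> {0<..<T}" for s
        using primitive_onD(3)[OF assms, of s] that by auto
    qed (use t in auto)
  qed
  then show ?thesis using N(1) that by blast
qed

text \<open>
  With \<open>primitive_on_absolutely_continuous\<close> and \<open>primitive_on_has_derivative_ae\<close> this
  shows that primitives are exactly the absolutely continuous functions with an integrable derivative.
\<close>

lemma primitive_onI:
  fixes x :: "real \<Rightarrow> 'a::euclidean_space"
  assumes "absolutely_continuous_on 0 T x" "negligible N"
    and der: "\<And>t. t \<in> {0<..<T} - N \<Longrightarrow> (x has_vector_derivative g t) (at t)"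
    and g: "g absolutely_integrable_on {0..T}"
  shows "primitive_on T g x"
  unfolding primitive_on_def
proof (intro conjI ballI g)
  fix t assume t: "t \<in> {0..T}"
  have "(g has_integral (x t - x 0)) {0..t}"
  proof (rule ftc_absolutely_continuous)
    show "absolutely_continuous_on 0 t x" using assms(1) t by (auto intro: absolutely_continuous_on_subset)
    show "negligible (N \<union> {0, T})" using assms(2) by (simp add: negligible_Un)
    show "(x has_vector_derivative g s) (at s within {0..t})" if "s \<in> {0..t} - (N \<union> {0,T})" for s
      using der[of s] that t by (auto intro: has_vector_derivative_at_within)
  qed (use t in auto)
  then show "x t = x 0 + integral {0..t} g" by (simp add: integral_unique)
qed

lemma primitive_on_bilinear:
  fixes x :: "real \<Rightarrow> 'a::euclidean_space" and y :: "real \<Rightarrow> 'b::euclidean_space"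
    and B :: "'a \<Rightarrow> 'b \<Rightarrow> 'c::euclidean_space"
  assumes B: "bounded_bilinear B" and x: "primitive_on T g x" and y: "primitive_on T h y"
  shows "primitive_on T (\<lambda>t. B (x t) (h t) + B (g t) (y t)) (\<lambda>t. B (x t) (y t))"
proof -
  obtain N where N: "negligible N" "\<And>t. t \<in> {0<..<T} - N \<Longrightarrow> (x has_vector_derivative g t) (at t)"
    using primitive_on_has_derivative_ae[OF x] by blast
  obtain M where M: "negligible M" "\<And>t. t \<in> {0<..<T} - M \<Longrightarrow> (y has_vector_derivative h t) (at t)"
    using primitive_on_has_derivative_ae[OF y] by blast
  note cx = primitive_on_continuous[OF x] and cy = primitive_on_continuous[OF y]
  have bd: "bounded (x ` {0..T})" "bounded (y ` {0..T})"
    using cx cy by (auto intro!: compact_imp_bounded compact_continuous_image)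
  show ?thesis
  proof (rule primitive_onI)
    show "absolutely_continuous_on 0 T (\<lambda>t. B (x t) (y t))"
      by (intro absolutely_continuous_on_bilinear[OF B] primitive_on_absolutely_continuous[OF x]
          primitive_on_absolutely_continuous[OF y] bd)
    show "negligible (N \<union> M)" using N M by (simp add: negligible_Un)
    show "((\<lambda>t. B (x t) (y t)) has_vector_derivative B (x t) (h t) + B (g t) (y t)) (at t)"
      if "t \<in> {0<..<T} - (N \<union> M)" for t
      using bounded_bilinear.has_vector_derivative[OF B N(2) M(2)] that by auto
    have "(\<lambda>t. (\<lambda>a b. B b a) (y t) (g t)) absolutely_integrable_on {0..T}"
      by (rule absolutely_integrable_continuous_bilinear[OF bounded_bilinear.flip[OF B] cy primitive_onD(1)[OF x]])
    then show "(\<lambda>t. B (x t) (h t) + B (g t) (y t)) absolutely_integrable_on {0..T}"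
      by (intro set_integral_add absolutely_integrable_continuous_bilinear[OF B cx primitive_onD(1)[OF y]])
  qed
qed

text \<open>
  The exponential is Lipschitz on the bounded range of \<open>x\<close>, so the composition is again absolutely
  continuous and the chain rule holds wherever \<open>x\<close> is differentiable.
\<close>

lemma primitive_on_exp:
  fixes x :: "real \<Rightarrow> real"
  assumes x: "primitive_on T g x"
  shows "primitive_on T (\<lambda>t. g t * exp (x t)) (\<lambda>t. exp (x t))"
proof -
  obtain N where N: "negligible N" "\<And>t. t \<in> {0<..<T} - N \<Longrightarrow> (x has_vector_derivative g t) (at t)"
    using primitive_on_has_derivative_ae[OF x] by blast
  note cx = primitive_on_continuous[OF x]
  obtain M where M: "\<And>t. t \<in> {0..T} \<Longrightarrow> x t \<le> M"
  proof -
    have "bounded (x ` {0..T})" using cx by (auto intro!: compact_imp_bounded compact_continuous_image)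
    then obtain M where "\<forall>y\<in>x ` {0..T}. norm y \<le> M" unfolding bounded_iff by blast
    then show ?thesis by (intro that[of M]) (force simp: abs_le_iff)
  qed
  have lip: "\<bar>exp q - exp p\<bar> \<le> exp M * \<bar>q - p\<bar>" if "p \<le> M" "q \<le> M" for p q
  proof -
    have *: "exp q - exp p \<le> exp M * (q - p)" if "p \<le> q" "q \<le> M" for p q :: real
    proof -
      have "1 - exp (p - q) \<le> q - p" using exp_ge_add_one_self[of "p - q"] by linarith
      then have "exp q * (1 - exp (p - q)) \<le> exp M * (q - p)"
        using that by (intro mult_mono) auto
      moreover have "exp q * (1 - exp (p - q)) = exp q - exp p"
        by (simp add: right_diff_distrib exp_add[symmetric])
      ultimately show ?thesis by simp
    qed
    show ?thesis using *[of p q] *[of q p] that by (cases "p \<le> q") (auto simp: abs_if algebra_simps)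
  qed
  show ?thesis
  proof (rule primitive_onI[OF _ N(1)])
    show "absolutely_continuous_on 0 T (\<lambda>t. exp (x t))"
      by (rule absolutely_continuous_on_lipschitz_compose[OF primitive_on_absolutely_continuous[OF x], of "exp M"])
         (use lip M in auto)
    show "((\<lambda>t. exp (x t)) has_vector_derivative g t * exp (x t)) (at t)" if "t \<in> {0<..<T} - N" for t
      using N(2)[OF that] unfolding has_real_derivative_iff_has_vector_derivative[symmetric]
      by (auto intro!: derivative_eq_intros)
    have "(\<lambda>t. exp (x t) * g t) absolutely_integrable_on {0..T}"
      by (rule absolutely_integrable_continuous_bilinear[OF bounded_bilinear_mult _ primitive_onD(1)[OF x]])
         (intro continuous_intros cx)
    then show "(\<lambda>t. g t * exp (x t)) absolutely_integrable_on {0..T}" by (simp add: mult.commute)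
  qed
qed

lemma primitive_on_add:
  assumes "primitive_on T g x" "primitive_on T h y"
  shows "primitive_on T (\<lambda>t. g t + h t) (\<lambda>t. x t + y t)"
  unfolding primitive_on_def
proof (intro conjI ballI)
  show "(\<lambda>t. g t + h t) absolutely_integrable_on {0..T}"
    by (intro set_integral_add primitive_onD(1)[OF assms(1)] primitive_onD(1)[OF assms(2)])
  fix t assume t: "t \<in> {0..T}"
  have "integral {0..t} (\<lambda>t. g t + h t) = integral {0..t} g + integral {0..t} h"
    using t by (intro integral_add integrable_subinterval_real[OF primitive_onD(2)[OF assms(1)]]
       integrable_subinterval_real[OF primitive_onD(2)[OF assms(2)]]) auto
  then show "x t + y t = x 0 + y 0 + integral {0..t} (\<lambda>t. g t + h t)"
    using primitive_onD(3)[OF assms(1) t] primitive_onD(3)[OF assms(2) t] by simp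
qed

lemma primitive_on_scaleR:
  assumes "primitive_on T g x"
  shows "primitive_on T (\<lambda>t. c *\<^sub>R g t) (\<lambda>t. c *\<^sub>R x t)"
  unfolding primitive_on_def
proof (intro conjI ballI)
  show "(\<lambda>t. c *\<^sub>R g t) absolutely_integrable_on {0..T}"
    by (intro set_integrable_scaleR_right primitive_onD(1)[OF assms])
  show "c *\<^sub>R x t = c *\<^sub>R x 0 + integral {0..t} (\<lambda>t. c *\<^sub>R g t)" if "t \<in> {0..T}" for t
    by (subst primitive_onD(3)[OF assms that]) (simp add: scaleR_add_right)
qed

lemma primitive_on_diff:
  assumes "primitive_on T g x" "primitive_on T h y"
  shows "primitive_on T (\<lambda>t. g t - h t) (\<lambda>t. x t - y t)"
  using primitive_on_add[OF assms(1) primitive_on_scaleR[OF assms(2), of "-1"]] by simp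

lemma primitive_on_norm_le:
  assumes x: "primitive_on T g x" and K: "K integrable_on {0..T}" and N: "negligible N"
    and le: "\<And>t. t \<in> {0..T} - N \<Longrightarrow> norm (g t) \<le> K t" and t: "t \<in> {0..T}"
  shows "norm (x t) \<le> norm (x 0) + integral {0..t} K"
proof -
  have "norm (integral {0..t} g) \<le> integral {0..t} K"
    using t le by (intro integral_norm_bound_ae[OF integrable_subinterval_real[OF primitive_onD(2)[OF x]]
            integrable_subinterval_real[OF K] N]) auto
  then show ?thesis using primitive_onD(3)[OF x t] norm_triangle_ineq[of "x 0" "integral {0..t} g"] by simp
qed

lemma primitive_on_mono:
  fixes x :: "real \<Rightarrow> real"
  assumes x: "primitive_on T g x" and N: "negligible N"
    and le: "\<And>t. t \<in> {0..T} - N \<Longrightarrow> 0 \<le> g t" and t: "t \<in> {0..T}"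
  shows "x 0 \<le> x t"
proof -
  define g' where "g' t = (if t \<in> N then 0 else g t)" for t
  have "primitive_on T g' x"
    by (rule primitive_on_cong[OF x _ N]) (auto simp: g'_def)
  then have "x t = x 0 + integral {0..t} g'" using t by (rule primitive_onD(3))
  moreover have "integral {0..t} g' \<ge> 0"
    using le t by (intro integral_nonneg integrable_subinterval_real[OF primitive_onD(2)[OF \<open>primitive_on T g' x\<close>]])
      (auto simp: g'_def)
  ultimately show ?thesis by simp
qed

section \<open>Growth estimates\<close>

text \<open>
  The function \<open>(c + \<integral> K w) exp (- \<integral> K)\<close> is nonincreasing, since its derivative is
  \<open>K (w - (c + \<integral> K w)) exp (- \<integral> K)\<close>.
\<close>

lemma gronwall:
  fixes w K :: "real \<Rightarrow> real"
  assumes K: "K absolutely_integrable_on {0..T}" "\<And>t. t \<in> {0..T} \<Longrightarrow> 0 \<le> K t"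
    and w: "continuous_on {0..T} w"
    and le: "\<And>t. t \<in> {0..T} \<Longrightarrow> w t \<le> c + integral {0..t} (\<lambda>s. K s * w s)"
    and t: "t \<in> {0..T}"
  shows "w t \<le> c * exp (integral {0..t} K)"
proof -
  have "(\<lambda>s. w s * K s) absolutely_integrable_on {0..T}"
    by (rule absolutely_integrable_continuous_bilinear[OF bounded_bilinear_mult w K(1)])
  then have Kw: "(\<lambda>s. K s * w s) absolutely_integrable_on {0..T}" by (simp add: mult.commute)
  define h where "h t = c + integral {0..t} (\<lambda>s. K s * w s)" for t
  have h: "primitive_on T (\<lambda>s. K s * w s) h"
    unfolding h_def by (rule primitive_on_indefinite_integral[OF Kw])
  have "primitive_on T K (\<lambda>t. 0 + integral {0..t} K)" by (rule primitive_on_indefinite_integral[OF K(1)])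
  then have "primitive_on T (\<lambda>t. (-1) *\<^sub>R K t) (\<lambda>t. (-1) *\<^sub>R (0 + integral {0..t} K))" by (rule primitive_on_scaleR)
  then have "primitive_on T (\<lambda>t. - K t) (\<lambda>t. - integral {0..t} K)" by simp
  from primitive_on_exp[OF this]
  have E: "primitive_on T (\<lambda>t. - K t * exp (- integral {0..t} K)) (\<lambda>t. exp (- integral {0..t} K))" .
  from primitive_on_scaleR[OF primitive_on_bilinear[OF bounded_bilinear_mult h E], of "-1"]
  have P: "primitive_on T (\<lambda>t. (-1) *\<^sub>R (h t * (- K t * exp (- integral {0..t} K)) + K t * w t * exp (- integral {0..t} K)))
           (\<lambda>t. (-1) *\<^sub>R (h t * exp (- integral {0..t} K)))" .
  have "(-1) *\<^sub>R (h 0 * exp (- integral {0..0} K)) \<le> (-1) *\<^sub>R (h t * exp (- integral {0..t} K))"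
  proof (rule primitive_on_mono[OF P negligible_empty _ t])
    fix t assume "t \<in> {0..T} - {}"
    then have "0 \<le> K t * (h t - w t) * exp (- integral {0..t} K)" using le[of t] K(2)[of t] by (simp add: h_def)
    then show "0 \<le> (-1) *\<^sub>R (h t * (- K t * exp (- integral {0..t} K)) + K t * w t * exp (- integral {0..t} K))"
      by (simp add: algebra_simps)
  qed
  then have "h t * exp (- integral {0..t} K) \<le> c" by (simp add: h_def)
  then have "h t \<le> c * exp (integral {0..t} K)" by (simp add: exp_minus field_simps)
  then show ?thesis using le[OF t] by (simp add: h_def)
qed

text \<open>
  Uniqueness backwards in time: \<open>|x|\<^sup>2 exp (2 \<integral> K)\<close> is nondecreasing, because the derivative
  of \<open>|x|\<^sup>2\<close> is at least \<open>- 2 K |x|\<^sup>2\<close>.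
\<close>

lemma zero_at_end_imp_zero_at_start:
  fixes x :: "real \<Rightarrow> 'a::euclidean_space"
  assumes x: "primitive_on T g x" and K: "K absolutely_integrable_on {0..T}" and N: "negligible N"
    and le: "\<And>t. t \<in> {0..T} - N \<Longrightarrow> norm (g t) \<le> K t * norm (x t)" and T: "0 \<le> T" "x T = 0"
  shows "x 0 = 0"
proof -
  have "primitive_on T K (\<lambda>t. 0 + integral {0..t} K)" by (rule primitive_on_indefinite_integral[OF K(1)])
  from primitive_on_exp[OF primitive_on_scaleR[OF this, of 2]]
  have E: "primitive_on T (\<lambda>t. 2 * K t * exp (2 * integral {0..t} K)) (\<lambda>t. exp (2 * integral {0..t} K))" by simp
  from primitive_on_bilinear[OF bounded_bilinear_mult primitive_on_bilinear[OF bounded_bilinear_inner x x] E]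
  have P: "primitive_on T (\<lambda>t. (x t \<bullet> x t) * (2 * K t * exp (2 * integral {0..t} K)) + (x t \<bullet> g t + g t \<bullet> x t) * exp (2 * integral {0..t} K))
     (\<lambda>t. (x t \<bullet> x t) * exp (2 * integral {0..t} K))" .
  have "(x 0 \<bullet> x 0) * exp (2 * integral {0..0} K) \<le> (x T \<bullet> x T) * exp (2 * integral {0..T} K)"
  proof (rule primitive_on_mono[OF P N])
    fix t assume t: "t \<in> {0..T} - N"
    have "\<bar>x t \<bullet> g t\<bar> \<le> norm (x t) * (K t * norm (x t))"
      using Cauchy_Schwarz_ineq2[of "x t" "g t"] mult_left_mono[OF le[OF t] norm_ge_zero[of "x t"]] by linarith
    also have "\<dots> = K t * (x t \<bullet> x t)" by (simp add: power2_norm_eq_inner[symmetric] power2_eq_square)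
    finally have "0 \<le> 2 * (K t * (x t \<bullet> x t) + x t \<bullet> g t)" by simp
    then have "0 \<le> 2 * (K t * (x t \<bullet> x t) + x t \<bullet> g t) * exp (2 * integral {0..t} K)" by simp
    then show "0 \<le> (x t \<bullet> x t) * (2 * K t * exp (2 * integral {0..t} K)) + (x t \<bullet> g t + g t \<bullet> x t) * exp (2 * integral {0..t} K)"
      by (simp add: algebra_simps inner_commute)
  qed (use T in auto)
  then have "x 0 \<bullet> x 0 \<le> 0" using T by simp
  then show ?thesis by (meson inner_gt_zero_iff not_less)
qed

section \<open>Caratheodory differential equations\<close>

lemma AE_lebesgue_on_nonneg_iff:
  "(AE t in lebesgue_on {0::real..}. P t) \<longleftrightarrow> (\<exists>N. negligible N \<and> (\<forall>t\<ge>0. t \<notin> N \<longrightarrow> P t))"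
proof -
  have "(AE t in lebesgue_on {0::real..}. P t) \<longleftrightarrow> (AE t in lebesgue. 0 \<le> t \<longrightarrow> P t)"
    by (subst AE_restrict_space_iff) auto
  also have "\<dots> \<longleftrightarrow> (\<exists>N. negligible N \<and> (\<forall>t\<ge>0. t \<notin> N \<longrightarrow> P t))"
    unfolding eventually_ae_filter negligible_iff_null_sets by auto
  finally show ?thesis .
qed

definition caratheodory :: "(real \<Rightarrow> 'a::euclidean_space \<Rightarrow> 'b::euclidean_space) \<Rightarrow> bool" where
  "caratheodory G \<longleftrightarrow> (\<forall>z. (\<lambda>t. G t z) \<in> borel_measurable (lebesgue_on {0..})) \<and>
     (\<forall>t\<ge>0. continuous_on UNIV (G t))"

text \<open>
  Along a path that takes countably many values the field is measurable by hypothesis. The path \<open>x\<close>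
  is a pointwise limit of its values at the time points rounded down to multiples of \<open>1 / (n + 1)\<close>,
  and continuity in the state carries measurability to the limit.
\<close>

lemma caratheodory_measurable_along:
  assumes G: "caratheodory G" and x: "continuous_on S x"
    and S: "closed S" "convex S" "S \<subseteq> {0..}"
  shows "(\<lambda>t. G t (x t)) \<in> borel_measurable (lebesgue_on S)"
proof (cases "S = {}")
  case True
  then have "space (lebesgue_on S) = {}" by simp
  then show ?thesis by (simp add: measurable_def)
next
  case False
  have Sl: "S \<in> sets lebesgue" using S(1) by (intro sets_completionI_sets) auto
  \<comment> \<open>Extends \<open>x\<close> to the whole line, since rounding may leave \<open>S\<close>.\<close>
  define y where "y t = x (closest_point S t)" for t
  have y: "continuous_on UNIV y"
    unfolding y_def
    by (rule continuous_on_compose2[OF x continuous_on_closest_point[OF S(2,1) False]])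
      (use closest_point_in_set[OF S(1) False] in auto)
  define q where "q n t = real_of_int \<lfloor>real (Suc n) * t\<rfloor> / real (Suc n)" for n t
  have q: "(\<lambda>n. q n t) \<longlonglongrightarrow> t" for t
  proof (rule tendsto_sandwich)
    show "\<forall>\<^sub>F n in sequentially. t - 1 / real (Suc n) \<le> q n t"
    proof (rule always_eventually, rule allI)
      fix n
      define c where "c = real (Suc n)"
      have c: "c > 0" by (simp add: c_def)
      have "c * t - 1 \<le> real_of_int \<lfloor>c * t\<rfloor>" by linarith
      then have "(c * t - 1) / c \<le> real_of_int \<lfloor>c * t\<rfloor> / c" using c by (intro divide_right_mono) auto
      then show "t - 1 / real (Suc n) \<le> q n t"
        unfolding q_def c_def[symmetric] using c by (simp add: diff_divide_distrib)
    qed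
    show "\<forall>\<^sub>F n in sequentially. q n t \<le> t"
    proof (rule always_eventually, rule allI)
      fix n
      define c where "c = real (Suc n)"
      have c: "c > 0" by (simp add: c_def)
      have "real_of_int \<lfloor>c * t\<rfloor> \<le> c * t" by linarith
      then have "real_of_int \<lfloor>c * t\<rfloor> / c \<le> c * t / c" using c by (intro divide_right_mono) auto
      then show "q n t \<le> t" unfolding q_def c_def[symmetric] using c by simp
    qed
    show "(\<lambda>n. t - 1 / real (Suc n)) \<longlonglongrightarrow> t"
      using tendsto_diff[OF tendsto_const[of t] LIMSEQ_inverse_real_of_nat] by (simp add: inverse_eq_divide)
  qed simp
  have "(\<lambda>t. G t (y t)) \<in> borel_measurable (lebesgue_on S)"
  proof (rule borel_measurable_LIMSEQ_metric)
    fix n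
    show "(\<lambda>t. G t (y (q n t))) \<in> borel_measurable (lebesgue_on S)"
      unfolding q_def
    proof (rule measurable_compose_countable[where f="\<lambda>i t. G t (y (real_of_int i / real (Suc n)))"])
      show "(\<lambda>t. G t (y (real_of_int i / real (Suc n)))) \<in> borel_measurable (lebesgue_on S)" for i
        by (rule measurable_restrict_mono[of _ _ "{0..}"]) (use G S in \<open>auto simp: caratheodory_def\<close>)
      show "(\<lambda>t. \<lfloor>real (Suc n) * t\<rfloor>) \<in> measurable (lebesgue_on S) (count_space UNIV)"
        by (intro measurable_compose[OF _ measurable_real_floor] continuous_imp_measurable_on_sets_lebesgue continuous_intros Sl)
    qed
  next
    fix t assume "t \<in> space (lebesgue_on S)"
    then have t: "t \<ge> 0" using S(3) by auto
    have yq: "(\<lambda>n. y (q n t)) \<longlonglongrightarrow> y t"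
      by (rule continuous_on_tendsto_compose[OF y q]) auto
    have "continuous_on UNIV (G t)" using G t by (simp add: caratheodory_def)
    then show "(\<lambda>n. G t (y (q n t))) \<longlonglongrightarrow> G t (y t)"
      by (rule continuous_on_tendsto_compose[OF _ yq]) auto
  qed
  then show ?thesis
    by (rule measurable_cong[THEN iffD1, rotated]) (simp add: y_def closest_point_self)
qed

text \<open>
  Substituting \<open>x t = exp (2 \<kappa> t) y t\<close>, where \<open>\<kappa>\<close> is the integral of \<open>K\<close>, turns the integral
  equation into a fixed point problem for \<open>y\<close>. In the supremum norm it is a contraction with factor
  \<open>1/2\<close>, since \<open>\<integral> K exp (2 \<kappa>) = (exp (2 \<kappa>) - 1) / 2\<close>. The weight spares a subdivision of \<open>[0, T]\<close>.
\<close>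

lemma picard:
  fixes G :: "real \<Rightarrow> 'a::euclidean_space \<Rightarrow> 'a"
  assumes T: "0 \<le> T" and G: "caratheodory G"
    and K: "K absolutely_integrable_on {0..T}" "\<And>t. t \<in> {0..T} \<Longrightarrow> 0 \<le> K t"
    and M: "M absolutely_integrable_on {0..T}" and N: "negligible N"
    and lip: "\<And>t y z. t \<in> {0..T} - N \<Longrightarrow> norm (G t y - G t z) \<le> K t * norm (y - z)"
    and zero: "\<And>t. t \<in> {0..T} - N \<Longrightarrow> norm (G t 0) \<le> M t"
  obtains x where "x 0 = b" "primitive_on T (\<lambda>t. G t (x t)) x"
proof -
  have ai: "(\<lambda>t. G t (x t)) absolutely_integrable_on {0..T}" if x: "continuous_on {0..T} x" for x
  proof (rule absolutely_integrable_ae_bound[OF caratheodory_measurable_along[OF G x] _ _ N])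
    have "(\<lambda>t. norm (x t) * K t) absolutely_integrable_on {0..T}"
      by (rule absolutely_integrable_continuous_bilinear[OF bounded_bilinear_mult _ K(1)]) (intro continuous_intros x)
    then have "(\<lambda>t. M t + norm (x t) * K t) absolutely_integrable_on {0..T}"
      by (intro set_integral_add M)
    then show "(\<lambda>t. M t + norm (x t) * K t) integrable_on {0..T}"
      by (simp add: absolutely_integrable_on_def)
    fix t assume t: "t \<in> {0..T} - N"
    have "norm (G t (x t)) \<le> norm (G t 0) + norm (G t (x t) - G t 0)"
      by (metis add.commute diff_add_cancel norm_triangle_ineq)
    then show "norm (G t (x t)) \<le> M t + norm (x t) * K t"
      using zero[OF t] lip[OF t, of "x t" 0] by (simp add: mult.commute)
  qed auto
  define \<kappa> where "\<kappa> t = integral {0..t} K" for t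
  have \<kappa>: "primitive_on T K \<kappa>"
    using primitive_on_indefinite_integral[OF K(1), of 0] by (simp add: \<kappa>_def[abs_def])
  note c\<kappa> = primitive_on_continuous[OF \<kappa>]
  have E: "primitive_on T (\<lambda>t. (2 * K t) * exp (2 * \<kappa> t)) (\<lambda>t. exp (2 * \<kappa> t))"
    using primitive_on_exp[OF primitive_on_scaleR[OF \<kappa>, of 2]] by simp
  \<comment> \<open>Bounded continuous functions live on the whole line; outside \<open>[0, T]\<close> they are continued by constants.\<close>
  define clip where "clip t = max 0 (min T t)" for t
  have clip: "clip t \<in> {0..T}" for t using T by (auto simp: clip_def)
  have clip_id: "clip t = t" if "t \<in> {0..T}" for t using that by (auto simp: clip_def)
  define \<phi> where "\<phi> y s = exp (- 2 * \<kappa> s) *\<^sub>R (b + integral {0..s} (\<lambda>r. G r (exp (2 * \<kappa> r) *\<^sub>R y r)))"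
    for y :: "real \<Rightarrow> 'a" and s
  define \<Phi> where "\<Phi> y = Bcontfun (\<lambda>t. \<phi> (apply_bcontfun y) (clip t))" for y :: "real \<Rightarrow>\<^sub>C 'a"
  have cw: "continuous_on {0..T} (\<lambda>r. exp (2 * \<kappa> r) *\<^sub>R apply_bcontfun y r)" for y :: "real \<Rightarrow>\<^sub>C 'a"
    by (intro continuous_intros c\<kappa> continuous_on_apply_bcontfun)
  have \<phi>c: "continuous_on {0..T} (\<phi> (apply_bcontfun y))" for y
    unfolding \<phi>_def
    by (intro continuous_intros c\<kappa> indefinite_integral_continuous_1
          ai[OF cw, unfolded absolutely_integrable_on_def, THEN conjunct1])
  have \<Phi>: "apply_bcontfun (\<Phi> y) t = \<phi> (apply_bcontfun y) (clip t)" for y t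
  proof -
    have "continuous_on UNIV (\<lambda>t. \<phi> (apply_bcontfun y) (clip t))"
      by (rule continuous_on_compose2[OF \<phi>c]) (use clip in \<open>auto simp: clip_def[abs_def] intro!: continuous_intros\<close>)
    moreover have "bounded (range (\<lambda>t. \<phi> (apply_bcontfun y) (clip t)))"
    proof (rule bounded_subset)
      show "bounded (\<phi> (apply_bcontfun y) ` {0..T})"
        using \<phi>c by (auto intro!: compact_imp_bounded compact_continuous_image)
    qed (use clip in auto)
    ultimately show ?thesis by (simp add: \<Phi>_def bcontfun_def Bcontfun_inverse)
  qed
  have "dist (\<Phi> y) (\<Phi> z) \<le> 1/2 * dist y z" for y z
  proof (rule dist_bound)
    fix t0
    define s where "s = clip t0"
    have s: "s \<in> {0..T}" using clip by (simp add: s_def)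
    let ?w = "\<lambda>y r. G r (exp (2 * \<kappa> r) *\<^sub>R apply_bcontfun y r)"
    have wi: "?w y integrable_on {0..s}" for y
      by (rule integrable_subinterval_real[OF ai[OF cw, unfolded absolutely_integrable_on_def, THEN conjunct1]])
        (use s in auto)
    have Ei: "(\<lambda>r. (2 * K r) * exp (2 * \<kappa> r)) integrable_on {0..s}"
      by (rule integrable_subinterval_real[OF primitive_onD(2)[OF E]]) (use s in auto)
    have "norm (integral {0..s} (?w y) - integral {0..s} (?w z)) = norm (integral {0..s} (\<lambda>r. ?w y r - ?w z r))"
      by (simp add: integral_diff wi)
    also have "\<dots> \<le> integral {0..s} (\<lambda>r. (dist y z / 2) * ((2 * K r) * exp (2 * \<kappa> r)))"
    proof (rule integral_norm_bound_ae[OF _ _ N])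
      fix r assume "r \<in> {0..s} - N"
      then have r: "r \<in> {0..T} - N" using s by auto
      have "norm (?w y r - ?w z r) \<le> K r * norm (exp (2 * \<kappa> r) *\<^sub>R (apply_bcontfun y r - apply_bcontfun z r))"
        using lip[OF r] by (simp add: scaleR_diff_right)
      also have "\<dots> = K r * exp (2 * \<kappa> r) * dist (apply_bcontfun y r) (apply_bcontfun z r)"
        by (simp add: dist_norm)
      also have "\<dots> \<le> K r * exp (2 * \<kappa> r) * dist y z"
        using K(2)[of r] r by (intro mult_left_mono Bounded_Continuous_Function.dist_bounded) auto
      finally show "norm (?w y r - ?w z r) \<le> (dist y z / 2) * ((2 * K r) * exp (2 * \<kappa> r))"
        by (simp add: algebra_simps)
    qed (rule integrable_diff[OF wi wi], rule integrable_on_mult_right[OF Ei])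
    also have "\<dots> = (dist y z / 2) * (exp (2 * \<kappa> s) - 1)"
    proof -
      have "integral {0..s} (\<lambda>r. (2 * K r) * exp (2 * \<kappa> r)) = exp (2 * \<kappa> s) - 1"
        using primitive_onD(3)[OF E s] by (simp add: \<kappa>_def)
      then show ?thesis by (simp only: integral_mult_right)
    qed
    finally have le: "norm (integral {0..s} (?w y) - integral {0..s} (?w z)) \<le> (dist y z / 2) * (exp (2 * \<kappa> s) - 1)" .
    have "dist (apply_bcontfun (\<Phi> y) t0) (apply_bcontfun (\<Phi> z) t0) =
          exp (- 2 * \<kappa> s) * norm (integral {0..s} (?w y) - integral {0..s} (?w z))"
      unfolding \<Phi> s_def[symmetric] \<phi>_def dist_norm scaleR_diff_right[symmetric] by simp
    also have "\<dots> \<le> exp (- 2 * \<kappa> s) * ((dist y z / 2) * (exp (2 * \<kappa> s) - 1))"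
      by (intro mult_left_mono le) simp
    also have "\<dots> = (dist y z / 2) * (1 - exp (- 2 * \<kappa> s))"
      by (simp add: algebra_simps exp_add[symmetric])
    also have "\<dots> \<le> (dist y z / 2) * 1"
      by (intro mult_left_mono) auto
    finally show "dist (apply_bcontfun (\<Phi> y) t0) (apply_bcontfun (\<Phi> z) t0) \<le> 1/2 * dist y z" by simp
  qed
  then obtain y where y: "\<Phi> y = y"
    using banach_fix_type[of "1/2" \<Phi>] by auto
  define x where "x t = exp (2 * \<kappa> t) *\<^sub>R apply_bcontfun y t" for t
  have x: "x t = b + integral {0..t} (\<lambda>r. G r (x r))" if t: "t \<in> {0..T}" for t
  proof -
    have "apply_bcontfun y t = \<phi> (apply_bcontfun y) t"
      using \<Phi>[of y t] y clip_id[OF t] by simp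
    then have "x t = exp (2 * \<kappa> t) *\<^sub>R exp (- 2 * \<kappa> t) *\<^sub>R (b + integral {0..t} (\<lambda>r. G r (x r)))"
      by (simp add: x_def \<phi>_def)
    then show ?thesis by (simp add: exp_add[symmetric])
  qed
  have x0: "x 0 = b" using x[of 0] T by simp
  have "primitive_on T (\<lambda>t. G t (x t)) x"
    unfolding primitive_on_def
  proof (intro conjI ballI)
    show "(\<lambda>t. G t (x t)) absolutely_integrable_on {0..T}"
      by (rule ai) (unfold x_def, rule cw)
    show "x t = x 0 + integral {0..t} (\<lambda>t. G t (x t))" if "t \<in> {0..T}" for t
      unfolding x0 by (rule x[OF that])
  qed
  with x0 show ?thesis using that by blast
qed

text \<open>
  Gronwall applied to \<open>c + |x|\<close>. The summand \<open>c\<close> serves two purposes: \<open>c = 1\<close> gives a priori bounds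
  for fields of linear growth, and small \<open>c\<close> bounds the difference of solutions of nearby equations.
\<close>

lemma linear_growth_bound:
  assumes x: "primitive_on T g x" and N: "negligible N"
    and L: "L absolutely_integrable_on {0..T}" "\<And>t. t \<in> {0..T} \<Longrightarrow> 0 \<le> L t"
    and le: "\<And>t. t \<in> {0..T} - N \<Longrightarrow> norm (g t) \<le> L t * (c + norm (x t))" and c: "0 \<le> c" and t: "t \<in> {0..T}"
  shows "norm (x t) \<le> (c + norm (x 0)) * exp (integral {0..T} L)"
proof -
  have cx: "continuous_on {0..T} (\<lambda>t. c + norm (x t))"
    by (intro continuous_intros primitive_on_continuous[OF x])
  have "(\<lambda>t. (c + norm (x t)) * L t) absolutely_integrable_on {0..T}"
    by (rule absolutely_integrable_continuous_bilinear[OF bounded_bilinear_mult cx L(1)])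
  then have I: "(\<lambda>t. L t * (c + norm (x t))) integrable_on {0..T}"
    by (simp add: mult.commute absolutely_integrable_on_def)
  have "c + norm (x t) \<le> (c + norm (x 0)) * exp (integral {0..t} L)"
  proof (rule gronwall[OF L cx _ t])
    fix s assume s: "s \<in> {0..T}"
    show "c + norm (x s) \<le> c + norm (x 0) + integral {0..s} (\<lambda>t. L t * (c + norm (x t)))"
      using primitive_on_norm_le[OF x I N le s] by simp
  qed
  also have "\<dots> \<le> (c + norm (x 0)) * exp (integral {0..T} L)"
  proof -
    have LT: "L integrable_on {0..T}" using L(1) by (simp add: absolutely_integrable_on_def)
    have "L integrable_on {0..t}" by (rule integrable_subinterval_real[OF LT]) (use t in auto)
    then have "integral {0..t} L \<le> integral {0..T} L"
      using t L(2) by (intro integral_subset_le LT) auto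
    then show ?thesis using c by (intro mult_left_mono) auto
  qed
  finally show ?thesis using c by simp
qed

text \<open>
  A property \<open>P t k\<close> of a bound \<open>k\<close> at time \<open>t\<close>, such as a norm bound or a Lipschitz constant,
  holds almost everywhere on \<open>[0, T]\<close> with bounds that form a nonnegative integrable function.
\<close>

definition integrably_bounded :: "real \<Rightarrow> (real \<Rightarrow> real \<Rightarrow> bool) \<Rightarrow> bool" where
  "integrably_bounded T P \<longleftrightarrow> (\<exists>K N. K absolutely_integrable_on {0..T} \<and> (\<forall>t\<in>{0..T}. 0 \<le> K t) \<and>
     negligible N \<and> (\<forall>t\<in>{0..T} - N. P t (K t)))"

lemma integrably_boundedE:
  assumes "integrably_bounded T P"
  obtains K N where "K absolutely_integrable_on {0..T}" "\<And>t. t \<in> {0..T} \<Longrightarrow> 0 \<le> K t" "negligible N"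
    "\<And>t. t \<in> {0..T} - N \<Longrightarrow> P t (K t)"
proof -
  obtain K N where *: "K absolutely_integrable_on {0..T}" "\<forall>t\<in>{0..T}. 0 \<le> K t"
     "negligible N" "\<forall>t\<in>{0..T} - N. P t (K t)"
    using assms unfolding integrably_bounded_def by (elim exE conjE)
  show ?thesis
    by (rule that[OF *(1) _ *(3)]) (use *(2,4) in simp_all)
qed

lemma integrably_boundedI:
  assumes "K absolutely_integrable_on {0..T}" "\<And>t. t \<in> {0..T} \<Longrightarrow> 0 \<le> K t" "negligible N"
    "\<And>t. t \<in> {0..T} - N \<Longrightarrow> P t (K t)"
  shows "integrably_bounded T P"
  unfolding integrably_bounded_def
  by (rule exI[of _ K], rule exI[of _ N]) (use assms in simp)

text \<open>
  For properties that persist when the bound grows, the sum of the two bounds serves both.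
\<close>

lemma integrably_bounded_conj:
  assumes P: "integrably_bounded T P" and Q: "integrably_bounded T Q"
    and monoP: "\<And>t k k'. P t k \<Longrightarrow> k \<le> k' \<Longrightarrow> P t k'"
    and monoQ: "\<And>t k k'. Q t k \<Longrightarrow> k \<le> k' \<Longrightarrow> Q t k'"
  shows "integrably_bounded T (\<lambda>t k. P t k \<and> Q t k)"
proof -
  obtain K N where K: "K absolutely_integrable_on {0..T}" "\<And>t. t \<in> {0..T} \<Longrightarrow> 0 \<le> K t" "negligible N"
    "\<And>t. t \<in> {0..T} - N \<Longrightarrow> P t (K t)" using P by (rule integrably_boundedE) (rule that; simp)
  obtain L M where L: "L absolutely_integrable_on {0..T}" "\<And>t. t \<in> {0..T} \<Longrightarrow> 0 \<le> L t" "negligible M"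
    "\<And>t. t \<in> {0..T} - M \<Longrightarrow> Q t (L t)" using Q by (rule integrably_boundedE) (rule that; simp)
  show ?thesis
  proof (rule integrably_boundedI)
    show "(\<lambda>t. K t + L t) absolutely_integrable_on {0..T}" by (intro set_integral_add K L)
    show "negligible (N \<union> M)" using K L by (simp add: negligible_Un)
    show "0 \<le> K t + L t" if "t \<in> {0..T}" for t using K(2)[OF that] L(2)[OF that] by simp
    fix t assume "t \<in> {0..T} - (N \<union> M)"
    then have t: "t \<in> {0..T}" "t \<in> {0..T} - N" "t \<in> {0..T} - M" by auto
    show "P t (K t + L t) \<and> Q t (K t + L t)"
      using monoP[OF K(4)[OF t(2)], of "K t + L t"] monoQ[OF L(4)[OF t(3)], of "K t + L t"] K(2)[OF t(1)] L(2)[OF t(1)] by simp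
  qed
qed

text \<open>
  The right-hand sides treated below. Both trajectories and costates solve equations of this kind.
\<close>

definition linear_growth_field :: "(real \<Rightarrow> 'a::euclidean_space \<Rightarrow> 'a) \<Rightarrow> bool" where
  "linear_growth_field G \<longleftrightarrow> caratheodory G \<and>
     (\<forall>T\<ge>0. integrably_bounded T (\<lambda>t k. \<forall>z. norm (G t z) \<le> k * (1 + norm z))) \<and>
     (\<forall>T\<ge>0. \<forall>R. integrably_bounded T (\<lambda>t k. k-lipschitz_on (cball 0 R) (G t)))"

lemma linear_growth_field_growthE:
  assumes G: "linear_growth_field G" and T: "0 \<le> T"
  obtains L N where "L absolutely_integrable_on {0..T}" "\<And>t. t \<in> {0..T} \<Longrightarrow> 0 \<le> L t" "negligible N"
    "\<And>t z. t \<in> {0..T} - N \<Longrightarrow> norm (G t z) \<le> L t * (1 + norm z)"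
proof -
  have "integrably_bounded T (\<lambda>t k. \<forall>z. norm (G t z) \<le> k * (1 + norm z))"
    using G T by (simp add: linear_growth_field_def)
  then obtain L N where L: "L absolutely_integrable_on {0..T}" "\<And>t. t \<in> {0..T} \<Longrightarrow> 0 \<le> L t" "negligible N"
    "\<And>t. t \<in> {0..T} - N \<Longrightarrow> \<forall>z. norm (G t z) \<le> L t * (1 + norm z)" by (rule integrably_boundedE) (rule that; simp)
  show ?thesis
    by (rule that[OF L(1-3)]) (use L(4) in simp_all)
qed

lemma linear_growth_field_lipschitzE:
  assumes G: "linear_growth_field G" and T: "0 \<le> T"
  obtains K N where "K absolutely_integrable_on {0..T}" "\<And>t. t \<in> {0..T} \<Longrightarrow> 0 \<le> K t" "negligible N"
    "\<And>t y z. t \<in> {0..T} - N \<Longrightarrow> y \<in> cball 0 R \<Longrightarrow> z \<in> cball 0 R \<Longrightarrow> norm (G t y - G t z) \<le> K t * norm (y - z)"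
proof -
  have "integrably_bounded T (\<lambda>t k. k-lipschitz_on (cball 0 R) (G t))"
    using G T by (simp add: linear_growth_field_def)
  then obtain K N where K: "K absolutely_integrable_on {0..T}" "\<And>t. t \<in> {0..T} \<Longrightarrow> 0 \<le> K t" "negligible N"
    "\<And>t. t \<in> {0..T} - N \<Longrightarrow> (K t)-lipschitz_on (cball 0 R) (G t)" by (rule integrably_boundedE) (rule that; simp)
  show ?thesis
  proof (rule that[OF K(1-3)])
    show "norm (G t y - G t z) \<le> K t * norm (y - z)"
      if "t \<in> {0..T} - N" "y \<in> cball 0 R" "z \<in> cball 0 R" for t y z
      using lipschitz_onD[OF K(4)[OF that(1)] that(2,3)] by (simp add: dist_norm)
  qed
qed

definition solves :: "(real \<Rightarrow> 'a::euclidean_space \<Rightarrow> 'a) \<Rightarrow> real \<Rightarrow> (real \<Rightarrow> 'a) \<Rightarrow> bool" where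
  "solves G T x \<longleftrightarrow> primitive_on T (\<lambda>t. G t (x t)) x"

text \<open>
  The bound is uniform over all solutions that start in a fixed ball. This is what allows one
  Lipschitz constant to be used for all of them.
\<close>

lemma solves_bounded:
  assumes G: "linear_growth_field G" and T: "0 \<le> T"
  obtains R where "\<And>x t. solves G T x \<Longrightarrow> norm (x 0) \<le> \<rho> \<Longrightarrow> t \<in> {0..T} \<Longrightarrow> x t \<in> cball 0 R"
proof -
  obtain L N where L: "L absolutely_integrable_on {0..T}" "\<And>t. t \<in> {0..T} \<Longrightarrow> 0 \<le> L t" "negligible N"
    "\<And>t z. t \<in> {0..T} - N \<Longrightarrow> norm (G t z) \<le> L t * (1 + norm z)"
    using G T by (rule linear_growth_field_growthE) (rule that; simp)
  show ?thesis
  proof (rule that)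
    fix x t assume x: "solves G T x" "norm (x 0) \<le> \<rho>" "t \<in> {0..T}"
    have "norm (x t) \<le> (1 + norm (x 0)) * exp (integral {0..T} L)"
      using x L by (intro linear_growth_bound[of T "\<lambda>t. G t (x t)" x N L]) (auto simp: solves_def)
    also have "\<dots> \<le> (1 + \<rho>) * exp (integral {0..T} L)"
      using x by (intro mult_right_mono) auto
    finally show "x t \<in> cball 0 ((1 + \<rho>) * exp (integral {0..T} L))" by simp
  qed
qed

lemma solves_dependence:
  assumes x: "solves G T x" and y: "solves G T y"
    and K: "K absolutely_integrable_on {0..T}" "\<And>t. t \<in> {0..T} \<Longrightarrow> 0 \<le> K t" and N: "negligible N"
    and lip: "\<And>t. t \<in> {0..T} - N \<Longrightarrow> norm (G t (y t) - G t (x t)) \<le> K t * norm (y t - x t)" and t: "t \<in> {0..T}"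
  shows "norm (y t - x t) \<le> norm (y 0 - x 0) * exp (integral {0..T} K)"
  using linear_growth_bound[OF primitive_on_diff[OF y[unfolded solves_def] x[unfolded solves_def]] N K _ order.refl t] lip
  by simp

lemma solves_unique:
  assumes G: "linear_growth_field G" and xy: "solves G T x" "solves G T y" "x 0 = y 0" and t: "t \<in> {0..T}"
  shows "x t = y t"
proof -
  have T: "0 \<le> T" using t by auto
  obtain R where R: "\<And>x' t. solves G T x' \<Longrightarrow> norm (x' 0) \<le> norm (x 0) \<Longrightarrow> t \<in> {0..T} \<Longrightarrow> x' t \<in> cball 0 R"
    using solves_bounded[OF G T, of "norm (x 0)"] by blast
  obtain K N where K: "K absolutely_integrable_on {0..T}" "\<And>t. t \<in> {0..T} \<Longrightarrow> 0 \<le> K t" "negligible N"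
    "\<And>t y z. t \<in> {0..T} - N \<Longrightarrow> y \<in> cball 0 R \<Longrightarrow> z \<in> cball 0 R \<Longrightarrow> norm (G t y - G t z) \<le> K t * norm (y - z)"
    using G T by (rule linear_growth_field_lipschitzE[where R=R]) (rule that; simp)
  have "norm (y t - x t) \<le> norm (y 0 - x 0) * exp (integral {0..T} K)"
    by (rule solves_dependence[OF xy(1,2) K(1-3) _ t]) (use K(4) R xy in auto)
  then show ?thesis using xy by simp
qed

text \<open>
  Outside a ball of radius \<open>R\<close> the field is replaced by its value at the nearest point of the ball.
  The new field is globally Lipschitz and inherits the growth bound, and for \<open>R\<close> equal to the a priori
  bound its solution never leaves the ball, so it solves the original equation.
\<close>

lemma solves_exists_interval:
  fixes G :: "real \<Rightarrow> 'a::euclidean_space \<Rightarrow> 'a"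
  assumes G: "linear_growth_field G" and T: "0 \<le> T"
  obtains x where "x 0 = b" "solves G T x"
proof -
  obtain L N where L: "L absolutely_integrable_on {0..T}" "\<And>t. t \<in> {0..T} \<Longrightarrow> 0 \<le> L t" "negligible N"
    "\<And>t z. t \<in> {0..T} - N \<Longrightarrow> norm (G t z) \<le> L t * (1 + norm z)"
    using G T by (rule linear_growth_field_growthE) (rule that; simp)
  define R where "R = (1 + norm b) * exp (integral {0..T} L)"
  have R: "R \<ge> 0" by (simp add: R_def)
  obtain K M where K: "K absolutely_integrable_on {0..T}" "\<And>t. t \<in> {0..T} \<Longrightarrow> 0 \<le> K t" "negligible M"
    "\<And>t y z. t \<in> {0..T} - M \<Longrightarrow> y \<in> cball 0 R \<Longrightarrow> z \<in> cball 0 R \<Longrightarrow> norm (G t y - G t z) \<le> K t * norm (y - z)"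
    using G T by (rule linear_growth_field_lipschitzE[where R=R]) (rule that; simp)
  define P :: "'a \<Rightarrow> 'a" where "P = closest_point (cball 0 R)"
  have P: "P z \<in> cball 0 R" for z
    unfolding P_def by (rule closest_point_in_set) (use R in auto)
  have Plip: "norm (P y - P z) \<le> norm (y - z)" for y z
    using closest_point_lipschitz[of "cball 0 R" y z] R by (auto simp: P_def dist_norm)
  have P_id: "P z = z" if "z \<in> cball 0 R" for z
    unfolding P_def by (rule closest_point_self[OF that])
  have P0: "norm (P z) \<le> norm z" for z
    using Plip[of z 0] P_id[of 0] R by simp
  define H where "H t z = G t (P z)" for t z
  have "caratheodory H"
  proof -
    have "continuous_on UNIV P"
      unfolding P_def by (rule continuous_on_closest_point) (use R in auto)
    then show ?thesis
      using G unfolding linear_growth_field_def caratheodory_def H_def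
      by (auto intro: continuous_on_compose2)
  qed
  moreover have "norm (H t y - H t z) \<le> K t * norm (y - z)" if "t \<in> {0..T} - (N \<union> M)" for t y z
  proof -
    have "norm (H t y - H t z) \<le> K t * norm (P y - P z)"
      unfolding H_def using that P by (intro K(4)) auto
    also have "\<dots> \<le> K t * norm (y - z)"
      using K(2) that by (intro mult_left_mono Plip) auto
    finally show ?thesis .
  qed
  moreover have Hg: "norm (H t z) \<le> L t * (1 + norm z)" if "t \<in> {0..T} - (N \<union> M)" for t z
  proof -
    have "norm (H t z) \<le> L t * (1 + norm (P z))"
      unfolding H_def using that by (intro L(4)) auto
    also have "\<dots> \<le> L t * (1 + norm z)"
      using L(2) that P0 by (intro mult_left_mono) auto
    finally show ?thesis .
  qed
  moreover have NM: "negligible (N \<union> M)" using L K by (simp add: negligible_Un)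
  ultimately obtain x where x: "x 0 = b" "primitive_on T (\<lambda>t. H t (x t)) x"
    using picard[OF T _ K(1,2) L(1), of H "N \<union> M" b] by (metis add.right_neutral mult.right_neutral norm_zero)
  have "x t \<in> cball 0 R" if "t \<in> {0..T}" for t
    using linear_growth_bound[OF x(2) NM L(1,2) Hg _ that] x(1) by (simp add: R_def)
  then have "primitive_on T (\<lambda>t. G t (x t)) x"
    by (intro primitive_on_cong[OF x(2) _ negligible_empty]) (auto simp: H_def P_id)
  then show ?thesis using x(1) that by (auto simp: solves_def)
qed

text \<open>
  By uniqueness the solutions on different intervals \<open>[0, T]\<close> agree where both are defined, so the
  diagonal \<open>t \<mapsto> X t t\<close> extends all of them.
\<close>

lemma solves_exists:
  fixes G :: "real \<Rightarrow> 'a::euclidean_space \<Rightarrow> 'a"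
  assumes G: "linear_growth_field G"
  obtains x where "x 0 = b" "\<And>T. 0 \<le> T \<Longrightarrow> solves G T x"
proof -
  have "\<exists>x. x 0 = b \<and> solves G T x" if "0 \<le> T" for T
    using solves_exists_interval[OF G that, of b] by blast
  then obtain X where X: "\<And>T. 0 \<le> T \<Longrightarrow> X T 0 = b" "\<And>T. 0 \<le> T \<Longrightarrow> solves G T (X T)"
    by metis
  define x where "x t = X t t" for t
  have eq: "X T t = x t" if "t \<in> {0..T}" for t T
  proof -
    have t: "0 \<le> t" "0 \<le> T" "t \<le> T" using that by auto
    have "solves G t (X T)"
      using X(2)[OF t(2)] t(3) unfolding solves_def by (rule primitive_on_subset)
    from solves_unique[OF G this X(2)[OF t(1)], of t] show ?thesis
      using X(1) t by (simp add: x_def)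
  qed
  show ?thesis
  proof (rule that)
    show "x 0 = b" using X(1) by (simp add: x_def)
    fix T :: real assume T: "0 \<le> T"
    show "solves G T x"
      using X(2)[OF T] unfolding solves_def
      by (rule primitive_on_cong[OF _ _ negligible_empty]) (use eq in auto)
  qed
qed

lemma absolutely_continuous_on_imp_continuous:
  assumes "absolutely_continuous_on a b f"
  shows "continuous_on {a..b} f"
  unfolding continuous_on_iff
proof (intro ballI allI impI)
  fix t e :: real assume t: "t \<in> {a..b}" and e: "0 < e"
  obtain d where d: "d > 0" and D: "\<And>D S. D division_of S \<Longrightarrow> S \<subseteq> {a..b} \<Longrightarrow>
      (\<Sum>k\<in>D. Sup k - Inf k) < d \<Longrightarrow> (\<Sum>k\<in>D. norm (f (Sup k) - f (Inf k))) < e"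
    using assms e unfolding absolutely_continuous_on_def by meson
  have *: "norm (f v - f u) < e" if "u \<le> v" "{u..v} \<subseteq> {a..b}" "v - u < d" for u v
  proof -
    have "{{u..v}} division_of {u..v}"
      using division_of_self[of u v] that by simp
    from D[OF this] show ?thesis using that by simp
  qed
  show "\<exists>d>0. \<forall>s\<in>{a..b}. dist s t < d \<longrightarrow> dist (f s) (f t) < e"
  proof (intro exI[of _ d] conjI d ballI impI)
    fix s assume "s \<in> {a..b}" "dist s t < d"
    then show "dist (f s) (f t) < e"
      using *[of s t] *[of t s] t by (cases "s \<le> t") (auto simp: dist_norm norm_minus_commute)
  qed
qed

lemma ode_solution_iff_solves:
  fixes G :: "real \<Rightarrow> 'a::euclidean_space \<Rightarrow> 'a"
  assumes G: "linear_growth_field G"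
  shows "ode_solution G x \<longleftrightarrow> (\<forall>T\<ge>0. solves G T x)"
proof
  assume x: "ode_solution G x"
  then obtain N where N: "negligible N" "\<And>t. 0 \<le> t \<Longrightarrow> t \<notin> N \<Longrightarrow> (x has_vector_derivative G t (x t)) (at t)"
    unfolding ode_solution_def AE_lebesgue_on_nonneg_iff by blast
  show "\<forall>T\<ge>0. solves G T x"
    unfolding solves_def
  proof (intro allI impI)
    fix T :: real assume T: "0 \<le> T"
    have ac: "absolutely_continuous_on 0 T x" using x T by (simp add: ode_solution_def)
    note cx = absolutely_continuous_on_imp_continuous[OF ac]
    obtain L M where L: "L absolutely_integrable_on {0..T}" "\<And>t. t \<in> {0..T} \<Longrightarrow> 0 \<le> L t" "negligible M"
      "\<And>t z. t \<in> {0..T} - M \<Longrightarrow> norm (G t z) \<le> L t * (1 + norm z)"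
      using G T by (rule linear_growth_field_growthE) (rule that; simp)
    have "(\<lambda>t. (1 + norm (x t)) * L t) absolutely_integrable_on {0..T}"
      by (rule absolutely_integrable_continuous_bilinear[OF bounded_bilinear_mult _ L(1)]) (intro continuous_intros cx)
    then have I: "(\<lambda>t. L t * (1 + norm (x t))) integrable_on {0..T}"
      by (simp add: mult.commute absolutely_integrable_on_def)
    show "primitive_on T (\<lambda>t. G t (x t)) x"
    proof (rule primitive_onI[OF ac N(1)])
      show "(\<lambda>t. G t (x t)) absolutely_integrable_on {0..T}"
        by (rule absolutely_integrable_ae_bound[OF caratheodory_measurable_along[OF _ cx] _ I L(3)])
          (use G L in \<open>auto simp: linear_growth_field_def\<close>)
    qed (use N in auto)
  qed
next
  assume x: "\<forall>T\<ge>0. solves G T x"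
  then have "\<exists>N. negligible N \<and> (\<forall>t\<in>{0<..<real n} - N. (x has_vector_derivative G t (x t)) (at t))" for n
    using primitive_on_has_derivative_ae[of "real n" "\<lambda>t. G t (x t)" x] unfolding solves_def by (metis of_nat_0_le_iff)
  then obtain N where N: "\<And>n. negligible (N n)"
    "\<And>n t. t \<in> {0<..<real n} - N n \<Longrightarrow> (x has_vector_derivative G t (x t)) (at t)"
    by metis
  show "ode_solution G x"
    unfolding ode_solution_def AE_lebesgue_on_nonneg_iff
  proof (intro conjI allI impI exI)
    show "absolutely_continuous_on 0 T x" if "0 \<le> T" for T
      using x that primitive_on_absolutely_continuous unfolding solves_def by blast
    show "negligible (insert 0 (\<Union>n. N n))"
      using N(1) by (intro negligible_insert[THEN iffD2] negligible_countable_Union) auto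
    fix t :: real assume t: "0 \<le> t" "t \<notin> insert 0 (\<Union>n. N n)"
    obtain n where "t < real n" using reals_Archimedean2 by blast
    then show "(x has_vector_derivative G t (x t)) (at t)"
      using t by (intro N(2)[of t n]) auto
  qed
qed

lemma solves_continuous: "solves G T x \<Longrightarrow> continuous_on {0..T} x"
  unfolding solves_def by (rule primitive_on_continuous)

lemma continuous_on_nonneg_reals:
  fixes x :: "real \<Rightarrow> 'a::metric_space"
  assumes "\<And>T. 0 \<le> T \<Longrightarrow> continuous_on {0..T} x"
  shows "continuous_on {0..} x"
  unfolding continuous_on_iff
proof (intro ballI allI impI)
  fix t e :: real assume t: "t \<in> {0..}" and e: "0 < e"
  have "continuous_on {0..t+1} x" using t by (intro assms) auto
  then obtain d where d: "d > 0" "\<And>s. s \<in> {0..t+1} \<Longrightarrow> dist s t < d \<Longrightarrow> dist (x s) (x t) < e"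
    using t e unfolding continuous_on_iff by (metis atLeastAtMost_iff atLeast_iff le_add_same_cancel1 zero_le_one)
  show "\<exists>d>0. \<forall>s\<in>{0..}. dist s t < d \<longrightarrow> dist (x s) (x t) < e"
    by (rule exI[of _ "min d 1"]) (use d t in \<open>auto simp: dist_real_def abs_less_iff\<close>)
qed

section \<open>Matrices, linearization and proximal subgradients\<close>

lemma bounded_bilinear_matrix_vector_mult: "bounded_bilinear (\<lambda>(M::real^'n^'m) v. M *v v)"
  unfolding bilinear_conv_bounded_bilinear[symmetric] bilinear_def
  by (intro conjI allI linearI)
    (simp_all add: matrix_vector_mult_add_rdistrib matrix_vector_right_distrib scaleR_matrix_vector_assoc
       matrix_vector_mult_scaleR)

lemma bounded_bilinear_vector_matrix_mult: "bounded_bilinear (\<lambda>v (M::real^'n^'m). v v* M)"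
proof -
  have 1: "(a + b) v* M = a v* M + b v* M" "(c *\<^sub>R a) v* M = c *\<^sub>R (a v* M)" for a b :: "real^'m" and M :: "real^'n^'m" and c
    using matrix_vector_right_distrib[of "transpose M" a b] matrix_vector_mult_scaleR[of "transpose M" c a] by simp_all
  have 2: "a v* (M + M') = a v* M + a v* M'" "a v* (c *\<^sub>R M) = c *\<^sub>R (a v* M)" for a :: "real^'m" and M M' :: "real^'n^'m" and c
    unfolding vector_matrix_mult_def vec_eq_iff by (simp_all add: algebra_simps sum.distrib sum_distrib_left)
  show ?thesis
    unfolding bilinear_conv_bounded_bilinear[symmetric] bilinear_def
    by (intro conjI allI linearI) (simp_all add: 1 2)
qed

lemma norm_matrix_vector_mult_le:
  fixes M :: "real^'n^'m"
  shows "norm (M *v v) \<le> norm M * norm v"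
proof -
  have "norm (M *v v) \<le> L2_set (\<lambda>i. norm (M $ i) * norm v) UNIV"
    unfolding norm_vec_def[of "M *v v"]
    by (intro L2_set_mono) (simp_all add: matrix_vector_mul_component Cauchy_Schwarz_ineq2)
  also have "\<dots> = norm M * norm v"
    by (simp add: norm_vec_def[of M] L2_set_left_distrib)
  finally show ?thesis .
qed

text \<open>
  By duality: pair \<open>v v* M\<close> with itself and move \<open>M\<close> to the other side.
\<close>

lemma norm_vector_matrix_mult_le:
  fixes M :: "real^'n^'m"
  shows "norm (v v* M) \<le> norm M * norm v"
proof (cases "v v* M = 0")
  case False
  have "norm (v v* M) * norm (v v* M) = v \<bullet> (M *v (v v* M))"
    by (simp add: dot_lmul_matrix[symmetric] power2_norm_eq_inner[symmetric] power2_eq_square)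
  also have "\<dots> \<le> norm v * norm (M *v (v v* M))" by (rule norm_cauchy_schwarz)
  also have "\<dots> \<le> norm v * (norm M * norm (v v* M))"
    by (intro mult_left_mono norm_matrix_vector_mult_le) auto
  finally have "norm (v v* M) * norm (v v* M) \<le> (norm M * norm v) * norm (v v* M)" by (simp add: mult_ac)
  then show ?thesis by (rule mult_right_le_imp_le) (use False in simp)
qed simp

text \<open>
  The mean value inequality for \<open>f\<close> minus its linearization at \<open>x\<close>, whose derivative on the segment
  from \<open>x\<close> to \<open>y\<close> is at most \<open>c |y - x|\<close>.
\<close>

lemma linearization_error:
  fixes f :: "'a::real_normed_vector \<Rightarrow> 'b::real_normed_vector"
  assumes S: "convex S" "x \<in> S" "y \<in> S" and c: "0 \<le> c"
    and f': "\<And>z. z \<in> S \<Longrightarrow> (f has_derivative f' z) (at z)"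
    and lip: "\<And>z h. z \<in> S \<Longrightarrow> norm (f' z h - f' x h) \<le> c * norm (z - x) * norm h"
  shows "norm (f y - f x - f' x (y - x)) \<le> c * (norm (y - x))\<^sup>2"
proof -
  define I where "I = closed_segment x y"
  have IS: "I \<subseteq> S" using S unfolding I_def by (intro closed_segment_subset)
  have "norm (f y - f x - f' x (y - x)) \<le> norm (y - x) * (c * norm (y - x))"
  proof (rule differentiable_bound_linearization)
    show "x + t *\<^sub>R (y - x) \<in> I" if "t \<in> {0..1}" for t
      using that unfolding I_def closed_segment_def by (auto simp: algebra_simps intro!: exI[of _ t])
    show "(f has_derivative f' z) (at z within I)" if "z \<in> I" for z
      using f' IS that by (auto intro: has_derivative_at_withinI)
    show "onorm (f' z - f' x) \<le> c * norm (y - x)" if z: "z \<in> I" for z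
    proof (rule onorm_bound)
      show "0 \<le> c * norm (y - x)" using c by simp
      fix h :: 'a
      have "norm (z - x) \<le> norm (y - x)"
        using segment_bound1[of z x y] z by (simp add: I_def norm_minus_commute)
      then have "c * norm (z - x) * norm h \<le> c * norm (y - x) * norm h"
        using c by (intro mult_right_mono mult_left_mono) auto
      with lip[of z h] z IS show "norm ((f' z - f' x) h) \<le> c * norm (y - x) * norm h" by auto
    qed
  qed (simp add: I_def)
  then show ?thesis by (simp add: power2_eq_square algebra_simps)
qed

text \<open>
  The lower half of the expansion says that \<open>p\<close> is a proximal subgradient. If \<open>\<zeta>\<close> is another one
  and \<open>\<xi> = b + e (\<zeta> - p)\<close>, then \<open>G \<xi> - G b - p \<bullet> (\<xi> - b)\<close> is at least \<open>e |\<zeta> - p|\<^sup>2\<close> up to a term of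
  order \<open>e\<^sup>2\<close>, while the upper half of the expansion bounds it by a term of order \<open>e\<^sup>2\<close>.
\<close>

lemma proximal_subdifferential_eq_gradient:
  fixes G :: "'a::real_inner \<Rightarrow> real"
  assumes \<sigma>: "0 \<le> \<sigma>" and r: "0 < r"
    and exp: "\<And>\<xi>. \<xi> \<in> ball b r \<Longrightarrow> \<bar>G \<xi> - G b - p \<bullet> (\<xi> - b)\<bar> \<le> \<sigma> * (norm (\<xi> - b))\<^sup>2"
  shows "proximal_subdifferential G b = {p}"
proof (intro equalityI subsetI; (elim singletonE)?)
  fix \<zeta> assume "\<zeta> = p"
  have lower: "G \<xi> \<ge> G b + p \<bullet> (\<xi> - b) - \<sigma> * (norm (\<xi> - b))\<^sup>2" if "\<xi> \<in> ball b r" for \<xi>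
    using exp[OF that] by linarith
  show "\<zeta> \<in> proximal_subdifferential G b"
    unfolding proximal_subdifferential_def \<open>\<zeta> = p\<close>
    by (rule CollectI, rule exI[of _ \<sigma>], rule conjI[OF \<sigma>], rule exI[of _ "ball b r"]) (use r lower in auto)
next
  fix \<zeta> assume "\<zeta> \<in> proximal_subdifferential G b"
  then obtain \<sigma>' \<Omega> where \<Omega>: "0 \<le> \<sigma>'" "open \<Omega>" "b \<in> \<Omega>"
    and lower: "\<And>\<xi>. \<xi> \<in> \<Omega> \<Longrightarrow> G \<xi> \<ge> G b + \<zeta> \<bullet> (\<xi> - b) - \<sigma>' * (norm (\<xi> - b))\<^sup>2"
    unfolding proximal_subdifferential_def by blast
  obtain r' where r': "0 < r'" "ball b r' \<subseteq> \<Omega>" using \<Omega> openE by blast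
  define v where "v = \<zeta> - p"
  show "\<zeta> \<in> {p}"
  proof (rule ccontr)
    assume "\<zeta> \<notin> {p}"
    then have v: "norm v > 0" by (simp add: v_def)
    \<comment> \<open>The first bound keeps the step inside both neighbourhoods, the second makes the quadratic terms too small.\<close>
    define e where "e = min (min r r' / (2 * norm v)) (1 / (2 * (\<sigma> + \<sigma>' + 1)))"
    have e: "e > 0" using r r' v \<sigma> \<Omega> by (auto simp: e_def intro!: divide_pos_pos)
    have "e * norm v \<le> min r r' / 2"
      using mult_right_mono[of e "min r r' / (2 * norm v)" "norm v"] v by (simp add: e_def)
    then have ev: "e * norm v < r" "e * norm v < r'" using r r' by auto
    define \<xi> where "\<xi> = b + e *\<^sub>R v"
    have \<xi>: "\<xi> - b = e *\<^sub>R v" "\<xi> \<in> ball b r" "\<xi> \<in> \<Omega>"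
      using ev e r' by (auto simp: \<xi>_def dist_norm subset_iff)
    have "v \<bullet> (\<xi> - b) \<le> (\<sigma> + \<sigma>') * (norm (\<xi> - b))\<^sup>2"
      using lower[OF \<xi>(3)] exp[OF \<xi>(2)] by (simp add: v_def inner_diff_left algebra_simps abs_le_iff)
    then have "e * (norm v)\<^sup>2 \<le> (\<sigma> + \<sigma>') * (e * e * (norm v)\<^sup>2)"
      unfolding \<xi>(1) using e by (simp add: power2_norm_eq_inner[symmetric] power_mult_distrib power2_eq_square mult_ac)
    then have "1 * (e * (norm v)\<^sup>2) \<le> ((\<sigma> + \<sigma>') * e) * (e * (norm v)\<^sup>2)"
      by (simp add: mult_ac)
    then have "1 \<le> (\<sigma> + \<sigma>') * e"
      by (rule mult_right_le_imp_le) (use e v in simp)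
    also have "\<dots> \<le> (\<sigma> + \<sigma>') * (1 / (2 * (\<sigma> + \<sigma>' + 1)))"
      using \<sigma> \<Omega> by (intro mult_left_mono) (auto simp: e_def)
    also have "\<dots> < 1" using \<sigma> \<Omega> by (simp add: field_simps)
    finally show False by simp
  qed
qed

section \<open>Costates and the expansion of the cost\<close>

text \<open>
  A control system whose control has been frozen: \<open>A\<close> and \<open>q\<close> are the state derivatives of the dynamics
  \<open>F\<close> and of the running cost \<open>g\<close>.
\<close>

locale smooth_system =
  fixes F :: "real \<Rightarrow> real^'m \<Rightarrow> real^'m" and g :: "real \<Rightarrow> real^'m \<Rightarrow> real"
    and A :: "real \<Rightarrow> real^'m \<Rightarrow> real^'m^'m" and q :: "real \<Rightarrow> real^'m \<Rightarrow> real^'m"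
  assumes F_field: "linear_growth_field F"
    and g_caratheodory: "caratheodory g" and A_caratheodory: "caratheodory A" and q_caratheodory: "caratheodory q"
    and F_derivative: "\<And>t x. 0 \<le> t \<Longrightarrow> (F t has_derivative (\<lambda>h. A t x *v h)) (at x)"
    and g_derivative: "\<And>t x. 0 \<le> t \<Longrightarrow> (g t has_derivative (\<lambda>h. q t x \<bullet> h)) (at x)"
    and bounds: "\<And>T R. 0 \<le> T \<Longrightarrow> integrably_bounded T (\<lambda>t k.
        (\<forall>x\<in>cball 0 R. norm (g t x) \<le> k \<and> norm (A t x) \<le> k \<and> norm (q t x) \<le> k) \<and>
        k-lipschitz_on (cball 0 R) (A t) \<and> k-lipschitz_on (cball 0 R) (q t))"
begin

text \<open>
  The right-hand side \<open>- \<partial>H/\<partial>x\<close> of the costate equation, written with the derivatives of \<open>F\<close> and \<open>g\<close>.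
\<close>

definition costate_field :: "(real \<Rightarrow> real^'m) \<Rightarrow> real \<Rightarrow> real \<Rightarrow> real^'m \<Rightarrow> real^'m" where
  "costate_field x \<mu> t p = \<mu> *\<^sub>R q t (x t) - p v* A t (x t)"

lemma boundsE:
  assumes T: "0 \<le> T"
  obtains K N where "K absolutely_integrable_on {0..T}" "\<And>t. t \<in> {0..T} \<Longrightarrow> 0 \<le> K t" "negligible N"
    "\<And>t x. t \<in> {0..T} - N \<Longrightarrow> x \<in> cball 0 R \<Longrightarrow> norm (g t x) \<le> K t"
    "\<And>t x. t \<in> {0..T} - N \<Longrightarrow> x \<in> cball 0 R \<Longrightarrow> norm (A t x) \<le> K t"
    "\<And>t x. t \<in> {0..T} - N \<Longrightarrow> x \<in> cball 0 R \<Longrightarrow> norm (q t x) \<le> K t"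
    "\<And>t x y. t \<in> {0..T} - N \<Longrightarrow> x \<in> cball 0 R \<Longrightarrow> y \<in> cball 0 R \<Longrightarrow> norm (A t x - A t y) \<le> K t * norm (x - y)"
    "\<And>t x y. t \<in> {0..T} - N \<Longrightarrow> x \<in> cball 0 R \<Longrightarrow> y \<in> cball 0 R \<Longrightarrow> norm (q t x - q t y) \<le> K t * norm (x - y)"
proof -
  obtain K N where K: "K absolutely_integrable_on {0..T}" "\<And>t. t \<in> {0..T} \<Longrightarrow> 0 \<le> K t" "negligible N"
    and b: "\<And>t. t \<in> {0..T} - N \<Longrightarrow>
        (\<forall>x\<in>cball 0 R. norm (g t x) \<le> K t \<and> norm (A t x) \<le> K t \<and> norm (q t x) \<le> K t) \<and>
        (K t)-lipschitz_on (cball 0 R) (A t) \<and> (K t)-lipschitz_on (cball 0 R) (q t)"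
    using bounds[OF T, of R] by (rule integrably_boundedE) (rule that; simp)
  show ?thesis
  proof (rule that[OF K])
    fix t and x y :: "real^'m" assume t: "t \<in> {0..T} - N" and x: "x \<in> cball 0 R"
    show "norm (g t x) \<le> K t" "norm (A t x) \<le> K t" "norm (q t x) \<le> K t"
      using b[OF t] x by auto
    assume y: "y \<in> cball 0 R"
    show "norm (A t x - A t y) \<le> K t * norm (x - y)" "norm (q t x - q t y) \<le> K t * norm (x - y)"
      using lipschitz_onD[of "K t" "cball 0 R" "A t" x y] lipschitz_onD[of "K t" "cball 0 R" "q t" x y] b[OF t] x y
      by (simp_all add: dist_norm)
  qed
qed

lemma path_bounded:
  fixes x :: "real \<Rightarrow> real^'m"
  assumes "continuous_on {0..T} x"
  obtains R where "\<And>t. t \<in> {0..T} \<Longrightarrow> x t \<in> cball 0 R"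
proof -
  have "bounded (x ` {0..T})" using assms by (auto intro!: compact_imp_bounded compact_continuous_image)
  then show ?thesis using that unfolding bounded_iff by (metis image_eqI mem_cball_0)
qed

text \<open>
  Affine in \<open>p\<close>, with coefficients that are bounded by integrable functions since \<open>x\<close> is bounded on
  compact intervals.
\<close>

lemma costate_field_linear_growth:
  assumes x: "\<And>T. 0 \<le> T \<Longrightarrow> continuous_on {0..T} x"
  shows "linear_growth_field (costate_field x \<mu>)"
proof -
  note bb = bounded_bilinear_vector_matrix_mult[where 'n='m and 'm='m]
  have cx: "continuous_on {0..} x" by (rule continuous_on_nonneg_reals[OF x])
  have car: "caratheodory (costate_field x \<mu>)"
    unfolding caratheodory_def costate_field_def
  proof (intro conjI allI impI)
    fix p
    have 1: "(\<lambda>t. q t (x t)) \<in> borel_measurable (lebesgue_on {0..})" "(\<lambda>t. A t (x t)) \<in> borel_measurable (lebesgue_on {0..})"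
      by (rule caratheodory_measurable_along[OF q_caratheodory cx] caratheodory_measurable_along[OF A_caratheodory cx]; simp)+
    have "continuous_on UNIV (\<lambda>M::real^'m^'m. p v* M)"
      by (intro linear_continuous_on bounded_bilinear.bounded_linear_right[OF bb])
    then have "(\<lambda>t. p v* A t (x t)) \<in> borel_measurable (lebesgue_on {0..})"
      using measurable_compose[OF 1(2) borel_measurable_continuous_onI] by blast
    then show "(\<lambda>t. \<mu> *\<^sub>R q t (x t) - p v* A t (x t)) \<in> borel_measurable (lebesgue_on {0..})"
      using 1(1) by (intro borel_measurable_diff borel_measurable_scaleR borel_measurable_const)
  next
    fix t
    show "continuous_on UNIV (\<lambda>p. \<mu> *\<^sub>R q t (x t) - p v* A t (x t))"
      by (intro continuous_intros linear_continuous_on bounded_bilinear.bounded_linear_left[OF bb])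
  qed
  have "\<exists>K N. K absolutely_integrable_on {0..T} \<and> (\<forall>t\<in>{0..T}. 0 \<le> K t) \<and> negligible N \<and>
     (\<forall>t\<in>{0..T} - N. norm (q t (x t)) \<le> K t \<and> norm (A t (x t)) \<le> K t)" if T: "0 \<le> T" for T
  proof -
    obtain R where R: "\<And>t. t \<in> {0..T} \<Longrightarrow> x t \<in> cball 0 R" using path_bounded[OF x[OF T]] by blast
    obtain K N where K: "K absolutely_integrable_on {0..T}" "\<And>t. t \<in> {0..T} \<Longrightarrow> 0 \<le> K t" "negligible N"
      "\<And>t x. t \<in> {0..T} - N \<Longrightarrow> x \<in> cball 0 R \<Longrightarrow> norm (A t x) \<le> K t"
      "\<And>t x. t \<in> {0..T} - N \<Longrightarrow> x \<in> cball 0 R \<Longrightarrow> norm (q t x) \<le> K t"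
      using T by (rule boundsE[where R=R]) (rule that; simp)
    show ?thesis
      by (rule exI[of _ K], rule exI[of _ N]) (use K R in auto)
  qed
  note ex = this
  have growth: "integrably_bounded T (\<lambda>t k. \<forall>z. norm (costate_field x \<mu> t z) \<le> k * (1 + norm z))" if T: "0 \<le> T" for T
  proof -
    obtain K N where K: "K absolutely_integrable_on {0..T}" "\<forall>t\<in>{0..T}. 0 \<le> K t" "negligible N"
     "\<forall>t\<in>{0..T} - N. norm (q t (x t)) \<le> K t \<and> norm (A t (x t)) \<le> K t" using ex[OF T] by (elim exE conjE)
    show ?thesis
    proof (rule integrably_boundedI)
      show "(\<lambda>t. (\<bar>\<mu>\<bar> + 1) *\<^sub>R K t) absolutely_integrable_on {0..T}" by (intro set_integrable_scaleR_right K)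
      show "0 \<le> (\<bar>\<mu>\<bar> + 1) *\<^sub>R K t" if "t \<in> {0..T}" for t using K(2) that by simp
      fix t assume t: "t \<in> {0..T} - N"
      show "\<forall>z. norm (costate_field x \<mu> t z) \<le> (\<bar>\<mu>\<bar> + 1) *\<^sub>R K t * (1 + norm z)"
      proof
        fix z
        have k: "norm (q t (x t)) \<le> K t" "norm (A t (x t)) \<le> K t" "0 \<le> K t" using K t by auto
        have "norm (costate_field x \<mu> t z) \<le> \<bar>\<mu>\<bar> * norm (q t (x t)) + norm (A t (x t)) * norm z"
          unfolding costate_field_def by (rule norm_triangle_le_diff) (use norm_vector_matrix_mult_le[of z "A t (x t)"] in simp)
        also have "\<dots> \<le> \<bar>\<mu>\<bar> * K t + K t * norm z"
          using k by (intro add_mono mult_right_mono mult_left_mono) auto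
        also have "\<dots> \<le> (\<bar>\<mu>\<bar> + 1) *\<^sub>R K t * (1 + norm z)"
          using k by (simp add: algebra_simps)
        finally show "norm (costate_field x \<mu> t z) \<le> (\<bar>\<mu>\<bar> + 1) *\<^sub>R K t * (1 + norm z)" .
      qed
    qed (use K in auto)
  qed
  have lip: "integrably_bounded T (\<lambda>t k. k-lipschitz_on (cball 0 R) (costate_field x \<mu> t))" if T: "0 \<le> T" for T R
  proof -
    obtain K N where K: "K absolutely_integrable_on {0..T}" "\<forall>t\<in>{0..T}. 0 \<le> K t" "negligible N"
     "\<forall>t\<in>{0..T} - N. norm (q t (x t)) \<le> K t \<and> norm (A t (x t)) \<le> K t" using ex[OF T] by (elim exE conjE)
    show ?thesis
    proof (rule integrably_boundedI)
      show "K absolutely_integrable_on {0..T}" by (rule K)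
      show "0 \<le> K t" if "t \<in> {0..T}" for t using K(2) that by simp
      fix t assume t: "t \<in> {0..T} - N"
      have k: "norm (A t (x t)) \<le> K t" "0 \<le> K t" using K t by auto
      show "(K t)-lipschitz_on (cball 0 R) (costate_field x \<mu> t)"
      proof (rule lipschitz_onI)
        fix y z
        have "costate_field x \<mu> t y - costate_field x \<mu> t z = - ((y - z) v* A t (x t))"
          by (simp add: costate_field_def bounded_bilinear.diff_left[OF bb])
        then have "dist (costate_field x \<mu> t y) (costate_field x \<mu> t z) \<le> norm (A t (x t)) * norm (y - z)"
          using norm_vector_matrix_mult_le[of "y - z" "A t (x t)"] by (simp add: dist_norm)
        also have "\<dots> \<le> K t * norm (y - z)" using k by (intro mult_right_mono mult_left_mono) auto
        finally show "dist (costate_field x \<mu> t y) (costate_field x \<mu> t z) \<le> K t * dist y z" by (simp add: dist_norm)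
      qed (use k in simp)
    qed (use K in auto)
  qed
  show ?thesis using car growth lip by (simp add: linear_growth_field_def)
qed

lemma costate_add:
  assumes "solves (costate_field x \<mu>) T \<psi>" "solves (costate_field x \<nu>) T \<phi>"
  shows "solves (costate_field x (\<mu> + \<nu>)) T (\<lambda>t. \<psi> t + \<phi> t)"
proof -
  have "costate_field x \<mu> t (\<psi> t) + costate_field x \<nu> t (\<phi> t) = costate_field x (\<mu> + \<nu>) t (\<psi> t + \<phi> t)" for t
    by (simp add: costate_field_def bounded_bilinear.add_left[OF bounded_bilinear_vector_matrix_mult] algebra_simps)
  then show ?thesis using primitive_on_add[OF assms[unfolded solves_def]] by (simp add: solves_def)
qed

lemma costate_scaleR:
  assumes "solves (costate_field x \<mu>) T \<psi>"
  shows "solves (costate_field x (c * \<mu>)) T (\<lambda>t. c *\<^sub>R \<psi> t)"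
proof -
  have "c *\<^sub>R costate_field x \<mu> t (\<psi> t) = costate_field x (c * \<mu>) t (c *\<^sub>R \<psi> t)" for t
    by (simp add: costate_field_def bounded_bilinear.scaleR_left[OF bounded_bilinear_vector_matrix_mult] algebra_simps)
  then show ?thesis using primitive_on_scaleR[OF assms[unfolded solves_def], of c] by (simp add: solves_def)
qed

lemma homogeneous_costate_zero_backward:
  assumes T: "0 \<le> T" and \<psi>: "solves (costate_field x 0) T \<psi>" "\<psi> T = 0" and x: "continuous_on {0..T} x"
  shows "\<psi> 0 = 0"
proof -
  obtain R where R: "\<And>t. t \<in> {0..T} \<Longrightarrow> x t \<in> cball 0 R" using path_bounded[OF x] by blast
  obtain K N where K: "K absolutely_integrable_on {0..T}" "\<And>t. t \<in> {0..T} \<Longrightarrow> 0 \<le> K t" "negligible N"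
    "\<And>t x. t \<in> {0..T} - N \<Longrightarrow> x \<in> cball 0 R \<Longrightarrow> norm (A t x) \<le> K t"
    using T by (rule boundsE[where R=R]) (rule that; simp)
  show ?thesis
  proof (rule zero_at_end_imp_zero_at_start[OF \<psi>(1)[unfolded solves_def] _ K(3) _ T \<psi>(2)])
    show "K absolutely_integrable_on {0..T}" by (rule K)
    fix t assume t: "t \<in> {0..T} - N"
    have "norm (A t (x t)) \<le> K t" using K(4)[OF t] R t by auto
    then have "norm (A t (x t)) * norm (\<psi> t) \<le> K t * norm (\<psi> t)"
      by (intro mult_right_mono mult_left_mono) auto
    then show "norm (costate_field x 0 t (\<psi> t)) \<le> K t * norm (\<psi> t)"
      using norm_vector_matrix_mult_le[of "\<psi> t" "A t (x t)"] by (simp add: costate_field_def)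
  qed
qed

text \<open>
  The value at \<open>T\<close> of a homogeneous costate is a linear function of its initial value. It is injective
  by uniqueness backwards in time, hence onto. So the value at \<open>T\<close> of any particular solution can
  be cancelled by that of a homogeneous one.
\<close>

lemma costate_exists_terminal:
  assumes x: "\<And>T. 0 \<le> T \<Longrightarrow> continuous_on {0..T} x" and T: "0 \<le> T"
  obtains \<psi> where "\<psi> T = 0" "\<And>S. 0 \<le> S \<Longrightarrow> solves (costate_field x \<mu>) S \<psi>"
proof -
  note lg = costate_field_linear_growth[OF x]
  have "\<exists>\<psi>. \<psi> 0 = p \<and> (\<forall>S\<ge>0. solves (costate_field x 0) S \<psi>)" for p
    using solves_exists[OF lg, of p] by blast
  then obtain \<Psi> where \<Psi>: "\<And>p. \<Psi> p 0 = p" "\<And>p S. 0 \<le> S \<Longrightarrow> solves (costate_field x 0) S (\<Psi> p)"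
    by metis
  have uniq: "\<Psi> p T = \<psi> T" if "solves (costate_field x 0) T \<psi>" "\<psi> 0 = p" for \<psi> p
    by (rule solves_unique[OF lg \<Psi>(2)[OF T] that(1)]) (use that T \<Psi> in auto)
  have lin: "linear (\<lambda>p. \<Psi> p T)"
  proof (rule linearI)
    show "\<Psi> (p + p') T = \<Psi> p T + \<Psi> p' T" for p p'
      by (rule uniq) (use costate_add[OF \<Psi>(2)[OF T] \<Psi>(2)[OF T], of p p'] \<Psi> in auto)
    show "\<Psi> (c *\<^sub>R p) T = c *\<^sub>R \<Psi> p T" for c p
      by (rule uniq) (use costate_scaleR[OF \<Psi>(2)[OF T], of c p] \<Psi> in auto)
  qed
  have "p = 0" if "\<Psi> p T = 0" for p
    using homogeneous_costate_zero_backward[OF T \<Psi>(2)[OF T] that x[OF T]] \<Psi>(1) by simp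
  then have "inj (\<lambda>p. \<Psi> p T)" using linear_injective_0[OF lin] by blast
  then have "surj (\<lambda>p. \<Psi> p T)" by (rule linear_inj_imp_surj[OF lin])
  obtain \<phi> where \<phi>: "\<phi> 0 = 0" "\<And>S. 0 \<le> S \<Longrightarrow> solves (costate_field x \<mu>) S \<phi>"
    using solves_exists[OF lg, of 0] by blast
  obtain p where p: "- \<phi> T = \<Psi> p T" using \<open>surj _\<close> by (rule surjE)
  show ?thesis
  proof (rule that)
    show "\<Psi> p T + \<phi> T = 0" using p[symmetric] by simp
    show "solves (costate_field x \<mu>) S (\<lambda>t. \<Psi> p t + \<phi> t)" if "0 \<le> S" for S
      using costate_add[OF \<Psi>(2)[OF that] \<phi>(2)[OF that]] by simp
  qed
qed

lemma running_cost_integrable: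
  assumes x: "continuous_on {0..T} x" and T: "0 \<le> T"
  shows "(\<lambda>t. g t (x t)) absolutely_integrable_on {0..T}"
proof -
  obtain R where R: "\<And>t. t \<in> {0..T} \<Longrightarrow> x t \<in> cball 0 R" using path_bounded[OF x] by blast
  obtain K N where K: "K absolutely_integrable_on {0..T}" "negligible N"
    "\<And>t x. t \<in> {0..T} - N \<Longrightarrow> x \<in> cball 0 R \<Longrightarrow> norm (g t x) \<le> K t"
    using T by (rule boundsE[where R=R]) (rule that; simp)
  show ?thesis
    by (rule absolutely_integrable_ae_bound[OF caratheodory_measurable_along[OF g_caratheodory x] _ _ K(2)])
      (use K R in \<open>auto simp: absolutely_integrable_on_def\<close>)
qed

text \<open>
  The constant \<open>\<sigma>\<close> works for all \<open>y\<close> starting within distance \<open>1\<close> of \<open>x 0\<close>, because these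
  trajectories stay in one ball, on which single integrable Lipschitz constants are available.
\<close>

lemma cost_expansion:
  assumes T: "0 \<le> T" and x: "solves F T x" and \<psi>: "solves (costate_field x 1) T \<psi>" "\<psi> T = 0"
  obtains \<sigma> where "0 \<le> \<sigma>" "\<And>y. solves F T y \<Longrightarrow> norm (y 0 - x 0) \<le> 1 \<Longrightarrow>
     \<bar>integral {0..T} (\<lambda>t. g t (y t)) - integral {0..T} (\<lambda>t. g t (x t)) + \<psi> 0 \<bullet> (y 0 - x 0)\<bar> \<le> \<sigma> * (norm (y 0 - x 0))\<^sup>2"
proof -
  obtain R where R: "\<And>y t. solves F T y \<Longrightarrow> norm (y 0) \<le> norm (x 0) + 1 \<Longrightarrow> t \<in> {0..T} \<Longrightarrow> y t \<in> cball 0 R"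
    using solves_bounded[OF F_field T, of "norm (x 0) + 1"] by blast
  obtain L M where L: "L absolutely_integrable_on {0..T}" "\<And>t. t \<in> {0..T} \<Longrightarrow> 0 \<le> L t" "negligible M"
    "\<And>t y z. t \<in> {0..T} - M \<Longrightarrow> y \<in> cball 0 R \<Longrightarrow> z \<in> cball 0 R \<Longrightarrow> norm (F t y - F t z) \<le> L t * norm (y - z)"
    using F_field T by (rule linear_growth_field_lipschitzE[where R=R]) (rule that; simp)
  obtain K N where K: "K absolutely_integrable_on {0..T}" "\<And>t. t \<in> {0..T} \<Longrightarrow> 0 \<le> K t" "negligible N"
    "\<And>t x y. t \<in> {0..T} - N \<Longrightarrow> x \<in> cball 0 R \<Longrightarrow> y \<in> cball 0 R \<Longrightarrow> norm (A t x - A t y) \<le> K t * norm (x - y)"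
    "\<And>t x y. t \<in> {0..T} - N \<Longrightarrow> x \<in> cball 0 R \<Longrightarrow> y \<in> cball 0 R \<Longrightarrow> norm (q t x - q t y) \<le> K t * norm (x - y)"
    using T by (rule boundsE[where R=R]) (rule that; simp)
  obtain P where P: "\<And>t. t \<in> {0..T} \<Longrightarrow> norm (\<psi> t) \<le> P"
    using path_bounded[OF solves_continuous[OF \<psi>(1)]] by (metis mem_cball_0)
  have P0: "0 \<le> P" using P[of 0] T norm_ge_zero[of "\<psi> 0"] by (meson atLeastAtMost_iff order.refl order.trans)
  define E where "E = exp (integral {0..T} L)"
  define c where "c = (1 + P) * E\<^sup>2"
  have c0: "0 \<le> c" using P0 by (simp add: c_def)
  have KT: "K integrable_on {0..T}" using K(1) by (simp add: absolutely_integrable_on_def)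
  have "0 \<le> integral {0..T} K" by (rule integral_nonneg[OF KT]) (use K(2) in auto)
  show ?thesis
  proof (rule that[of "c * integral {0..T} K"])
    show "0 \<le> c * integral {0..T} K" using c0 \<open>0 \<le> integral {0..T} K\<close> by simp
    fix y assume y: "solves F T y" "norm (y 0 - x 0) \<le> 1"
    have xR: "x t \<in> cball 0 R" and yR: "y t \<in> cball 0 R" if "t \<in> {0..T}" for t
      using R[OF x _ that] R[OF y(1) _ that] y(2) norm_triangle_ineq2[of "y 0" "x 0"] by auto
    define d where "d t = y t - x t" for t
    have d: "primitive_on T (\<lambda>t. F t (y t) - F t (x t)) d"
      unfolding d_def using primitive_on_diff[OF y(1)[unfolded solves_def] x[unfolded solves_def]] .
    have dE: "norm (d t) \<le> norm (d 0) * E" if "t \<in> {0..T}" for t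
      unfolding d_def E_def
      by (rule solves_dependence[OF x y(1) L(1-3) _ that]) (use L(4) xR yR in auto)
    define \<rho> where "\<rho> t = F t (y t) - F t (x t) - A t (x t) *v d t" for t
    define \<theta> where "\<theta> t = g t (y t) - g t (x t) - q t (x t) \<bullet> d t" for t
    \<comment> \<open>In the derivative of \<open>\<psi> \<bullet> d\<close> the terms with \<open>A\<close> cancel up to the linearization error \<open>\<rho>\<close>.\<close>
    have "primitive_on T (\<lambda>t. \<psi> t \<bullet> (F t (y t) - F t (x t)) + costate_field x 1 t (\<psi> t) \<bullet> d t) (\<lambda>t. \<psi> t \<bullet> d t)"
      by (rule primitive_on_bilinear[OF bounded_bilinear_inner \<psi>(1)[unfolded solves_def] d])
    moreover have "\<psi> t \<bullet> (F t (y t) - F t (x t)) + costate_field x 1 t (\<psi> t) \<bullet> d t = \<psi> t \<bullet> \<rho> t + q t (x t) \<bullet> d t" for t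
      by (simp add: costate_field_def \<rho>_def inner_diff_left inner_diff_right dot_lmul_matrix)
    ultimately have prod: "primitive_on T (\<lambda>t. \<psi> t \<bullet> \<rho> t + q t (x t) \<bullet> d t) (\<lambda>t. \<psi> t \<bullet> d t)" by simp
    have gi: "(\<lambda>t. g t (y t)) integrable_on {0..T}" "(\<lambda>t. g t (x t)) integrable_on {0..T}"
      using running_cost_integrable[OF solves_continuous[OF y(1)] T] running_cost_integrable[OF solves_continuous[OF x] T]
      by (simp_all add: absolutely_integrable_on_def)
    have ri: "(\<lambda>t. g t (y t) - g t (x t) - (\<psi> t \<bullet> \<rho> t + q t (x t) \<bullet> d t)) integrable_on {0..T}"
      by (intro integrable_diff gi primitive_onD(2)[OF prod])
    have "0 = \<psi> 0 \<bullet> d 0 + integral {0..T} (\<lambda>t. \<psi> t \<bullet> \<rho> t + q t (x t) \<bullet> d t)"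
      using primitive_onD(3)[OF prod, of T] T \<psi>(2) by simp
    then have "integral {0..T} (\<lambda>t. g t (y t)) - integral {0..T} (\<lambda>t. g t (x t)) + \<psi> 0 \<bullet> d 0 =
      integral {0..T} (\<lambda>t. g t (y t) - g t (x t)) - integral {0..T} (\<lambda>t. \<psi> t \<bullet> \<rho> t + q t (x t) \<bullet> d t)"
      by (simp add: integral_diff gi)
    also have "\<dots> = integral {0..T} (\<lambda>t. g t (y t) - g t (x t) - (\<psi> t \<bullet> \<rho> t + q t (x t) \<bullet> d t))"
      by (rule integral_diff[symmetric]) (intro integrable_diff gi primitive_onD(2)[OF prod])+
    finally have eq: "integral {0..T} (\<lambda>t. g t (y t)) - integral {0..T} (\<lambda>t. g t (x t)) + \<psi> 0 \<bullet> d 0 =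
      integral {0..T} (\<lambda>t. g t (y t) - g t (x t) - (\<psi> t \<bullet> \<rho> t + q t (x t) \<bullet> d t))" .
    have "norm (integral {0..T} (\<lambda>t. g t (y t) - g t (x t) - (\<psi> t \<bullet> \<rho> t + q t (x t) \<bullet> d t))) \<le>
          integral {0..T} (\<lambda>t. (c * (norm (d 0))\<^sup>2) * K t)"
    proof (rule integral_norm_bound_ae[OF ri integrable_on_mult_right[OF KT] K(3)])
      fix t assume t: "t \<in> {0..T} - N"
      then have t': "t \<in> {0..T}" "0 \<le> t" by auto
      have \<rho>: "norm (\<rho> t) \<le> K t * (norm (d t))\<^sup>2"
        unfolding \<rho>_def d_def
      proof (rule linearization_error[where S="cball 0 R" and f'="\<lambda>z h. A t z *v h"])
        fix z h assume z: "z \<in> cball (0::real^'m) R"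
        have "norm (A t z *v h - A t (x t) *v h) \<le> norm (A t z - A t (x t)) * norm h"
          using norm_matrix_vector_mult_le[of "A t z - A t (x t)" h]
          by (simp add: bounded_bilinear.diff_left[OF bounded_bilinear_matrix_vector_mult])
        also have "\<dots> \<le> (K t * norm (z - x t)) * norm h"
          using K(4)[OF t z xR[OF t'(1)]] by (intro mult_right_mono mult_left_mono) auto
        finally show "norm (A t z *v h - A t (x t) *v h) \<le> K t * norm (z - x t) * norm h" by (simp add: mult_ac)
      qed (use xR[OF t'(1)] yR[OF t'(1)] F_derivative[OF t'(2)] K(2)[OF t'(1)] in auto)
      have \<theta>: "norm (\<theta> t) \<le> K t * (norm (d t))\<^sup>2"
        unfolding \<theta>_def d_def
      proof (rule linearization_error[where S="cball 0 R" and f'="\<lambda>z h. q t z \<bullet> h"])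
        fix z h assume z: "z \<in> cball (0::real^'m) R"
        have "norm (q t z \<bullet> h - q t (x t) \<bullet> h) \<le> norm (q t z - q t (x t)) * norm h"
          using Cauchy_Schwarz_ineq2[of "q t z - q t (x t)" h] by (simp add: inner_diff_left)
        also have "\<dots> \<le> (K t * norm (z - x t)) * norm h"
          using K(5)[OF t z xR[OF t'(1)]] by (intro mult_right_mono) auto
        finally show "norm (q t z \<bullet> h - q t (x t) \<bullet> h) \<le> K t * norm (z - x t) * norm h" .
      qed (use xR[OF t'(1)] yR[OF t'(1)] g_derivative[OF t'(2)] K(2)[OF t'(1)] in auto)
      have "norm (\<psi> t \<bullet> \<rho> t) \<le> P * (K t * (norm (d t))\<^sup>2)"
        using Cauchy_Schwarz_ineq2[of "\<psi> t" "\<rho> t"] mult_mono[OF P[OF t'(1)] \<rho> P0] by simp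
      moreover have "g t (y t) - g t (x t) - (\<psi> t \<bullet> \<rho> t + q t (x t) \<bullet> d t) = \<theta> t - \<psi> t \<bullet> \<rho> t"
        by (simp add: \<theta>_def)
      ultimately have "norm (g t (y t) - g t (x t) - (\<psi> t \<bullet> \<rho> t + q t (x t) \<bullet> d t)) \<le>
          K t * (norm (d t))\<^sup>2 + P * (K t * (norm (d t))\<^sup>2)"
        using \<theta> norm_triangle_ineq4[of "\<theta> t" "\<psi> t \<bullet> \<rho> t"] by simp
      also have "\<dots> = (1 + P) * K t * (norm (d t))\<^sup>2" by (simp add: algebra_simps)
      also have "\<dots> \<le> (1 + P) * K t * (norm (d 0) * E)\<^sup>2"
        using P0 K(2)[OF t'(1)] dE[OF t'(1)] by (intro mult_left_mono power_mono) auto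
      finally show "norm (g t (y t) - g t (x t) - (\<psi> t \<bullet> \<rho> t + q t (x t) \<bullet> d t)) \<le> (c * (norm (d 0))\<^sup>2) * K t"
        by (simp add: c_def power_mult_distrib algebra_simps)
    qed
    then show "\<bar>integral {0..T} (\<lambda>t. g t (y t)) - integral {0..T} (\<lambda>t. g t (x t)) + \<psi> 0 \<bullet> (y 0 - x 0)\<bar> \<le>
        c * integral {0..T} K * (norm (y 0 - x 0))\<^sup>2"
      using eq by (simp add: d_def[of 0] mult_ac)
  qed
qed

text \<open>
  Trajectories with convergent initial values stay in one ball and converge uniformly on compact
  intervals.
\<close>

lemma solves_convergence:
  assumes x: "solves F T x" and xn: "\<And>n. solves F T (xn n)" and T: "0 \<le> T"
    and lim: "(\<lambda>n. xn n 0) \<longlonglongrightarrow> x 0"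
  obtains R \<delta> where "\<And>n t. t \<in> {0..T} \<Longrightarrow> xn n t \<in> cball 0 R" "\<And>t. t \<in> {0..T} \<Longrightarrow> x t \<in> cball 0 R"
    "\<And>n t. t \<in> {0..T} \<Longrightarrow> norm (xn n t - x t) \<le> \<delta> n" "\<delta> \<longlonglongrightarrow> 0"
proof -
  obtain \<rho> where \<rho>: "\<And>n. norm (xn n 0) \<le> \<rho>"
    using convergent_imp_bounded[OF lim] unfolding bounded_iff by blast
  obtain R where R: "\<And>y t. solves F T y \<Longrightarrow> norm (y 0) \<le> max \<rho> (norm (x 0)) \<Longrightarrow> t \<in> {0..T} \<Longrightarrow> y t \<in> cball 0 R"
    using solves_bounded[OF F_field T, of "max \<rho> (norm (x 0))"] by blast
  obtain L M where L: "L absolutely_integrable_on {0..T}" "\<And>t. t \<in> {0..T} \<Longrightarrow> 0 \<le> L t" "negligible M"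
    "\<And>t y z. t \<in> {0..T} - M \<Longrightarrow> y \<in> cball 0 R \<Longrightarrow> z \<in> cball 0 R \<Longrightarrow> norm (F t y - F t z) \<le> L t * norm (y - z)"
    using F_field T by (rule linear_growth_field_lipschitzE[where R=R]) (rule that; simp)
  have xR: "x t \<in> cball 0 R" and xnR: "xn n t \<in> cball 0 R" if "t \<in> {0..T}" for t n
    using R[OF x _ that] R[OF xn _ that, of n] \<rho>[of n] by (auto simp: le_max_iff_disj)
  show ?thesis
  proof (rule that[of R "\<lambda>n. norm (xn n 0 - x 0) * exp (integral {0..T} L)"])
    show "norm (xn n t - x t) \<le> norm (xn n 0 - x 0) * exp (integral {0..T} L)" if "t \<in> {0..T}" for n t
      by (rule solves_dependence[OF x xn L(1-3) _ that]) (use L(4) xR xnR in auto)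
    have "(\<lambda>n. norm (xn n 0 - x 0)) \<longlonglongrightarrow> 0"
      using lim by (simp add: LIM_zero tendsto_norm_zero)
    then show "(\<lambda>n. norm (xn n 0 - x 0) * exp (integral {0..T} L)) \<longlonglongrightarrow> 0"
      by (rule tendsto_mult_left_zero)
  qed (use xR xnR in auto)
qed

lemma state_convergence:
  assumes "solves F t x" "\<And>n. solves F t (xn n)" "0 \<le> t" "(\<lambda>n. xn n 0) \<longlonglongrightarrow> x 0"
  shows "(\<lambda>n. xn n t) \<longlonglongrightarrow> x t"
proof -
  obtain \<delta> where \<delta>: "\<And>n s. s \<in> {0..t} \<Longrightarrow> norm (xn n s - x s) \<le> \<delta> n" "\<delta> \<longlonglongrightarrow> 0"
    using assms by (rule solves_convergence) (rule that; simp)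
  have "(\<lambda>n. xn n t - x t) \<longlonglongrightarrow> 0"
    by (rule Lim_null_comparison[OF _ \<delta>(2)]) (use \<delta>(1)[of t] assms(3) in auto)
  then show ?thesis by (simp add: LIM_zero_iff)
qed

text \<open>
  The difference \<open>w\<close> of two costates satisfies a linear equation with an inhomogeneity that is small
  because \<open>xn\<close> is uniformly close to \<open>x\<close> and \<open>\<mu>n\<close> is close to \<open>\<mu>\<close>.
\<close>

lemma costate_convergence:
  assumes x: "solves F T x" and xn: "\<And>n. solves F T (xn n)" and T: "0 \<le> T"
    and xlim: "(\<lambda>n. xn n 0) \<longlonglongrightarrow> x 0"
    and \<psi>: "solves (costate_field x \<mu>) T \<psi>" and \<psi>n: "\<And>n. solves (costate_field (xn n) (\<mu>n n)) T (\<psi>n n)"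
    and \<psi>lim: "(\<lambda>n. \<psi>n n 0) \<longlonglongrightarrow> \<psi> 0" and \<mu>lim: "\<mu>n \<longlonglongrightarrow> \<mu>"
  shows "(\<lambda>n. \<psi>n n T) \<longlonglongrightarrow> \<psi> T"
proof -
  note bb = bounded_bilinear_vector_matrix_mult[where 'n='m and 'm='m]
  obtain R \<delta> where xnR: "\<And>n t. t \<in> {0..T} \<Longrightarrow> xn n t \<in> cball 0 R" and xR: "\<And>t. t \<in> {0..T} \<Longrightarrow> x t \<in> cball 0 R"
    and \<delta>: "\<And>n t. t \<in> {0..T} \<Longrightarrow> norm (xn n t - x t) \<le> \<delta> n" "\<delta> \<longlonglongrightarrow> 0"
    using x xn T xlim by (rule solves_convergence) (rule that; simp)
  obtain K N where K: "K absolutely_integrable_on {0..T}" "\<And>t. t \<in> {0..T} \<Longrightarrow> 0 \<le> K t" "negligible N"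
    "\<And>t x. t \<in> {0..T} - N \<Longrightarrow> x \<in> cball 0 R \<Longrightarrow> norm (A t x) \<le> K t"
    "\<And>t x. t \<in> {0..T} - N \<Longrightarrow> x \<in> cball 0 R \<Longrightarrow> norm (q t x) \<le> K t"
    "\<And>t x y. t \<in> {0..T} - N \<Longrightarrow> x \<in> cball 0 R \<Longrightarrow> y \<in> cball 0 R \<Longrightarrow> norm (A t x - A t y) \<le> K t * norm (x - y)"
    "\<And>t x y. t \<in> {0..T} - N \<Longrightarrow> x \<in> cball 0 R \<Longrightarrow> y \<in> cball 0 R \<Longrightarrow> norm (q t x - q t y) \<le> K t * norm (x - y)"
    using T by (rule boundsE[where R=R]) (rule that; simp)
  obtain P where P: "\<And>t. t \<in> {0..T} \<Longrightarrow> norm (\<psi> t) \<le> P"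
    using path_bounded[OF solves_continuous[OF \<psi>]] by (metis mem_cball_0)
  have P0: "0 \<le> P" using P[of 0] T norm_ge_zero[of "\<psi> 0"] by (meson atLeastAtMost_iff order.refl order.trans)
  define c where "c n = P * \<delta> n + \<bar>\<mu>n n - \<mu>\<bar> + \<bar>\<mu>\<bar> * \<delta> n" for n
  have \<delta>0: "0 \<le> \<delta> n" for n using \<delta>(1)[of 0 n] T norm_ge_zero[of "xn n 0 - x 0"] by (meson atLeastAtMost_iff order.refl order.trans)
  have c0: "0 \<le> c n" for n using P0 \<delta>0 by (simp add: c_def)
  have "(\<lambda>n. \<bar>\<mu>n n - \<mu>\<bar>) \<longlonglongrightarrow> 0" using \<mu>lim by (simp add: LIM_zero tendsto_rabs_zero)
  then have "(\<lambda>n. P * \<delta> n + \<bar>\<mu>n n - \<mu>\<bar> + \<bar>\<mu>\<bar> * \<delta> n) \<longlonglongrightarrow> P * 0 + 0 + \<bar>\<mu>\<bar> * 0"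
    by (intro tendsto_intros \<delta>(2))
  then have c_lim: "c \<longlonglongrightarrow> 0" by (simp add: c_def[abs_def])
  have "norm (\<psi>n n T - \<psi> T) \<le> (c n + norm (\<psi>n n 0 - \<psi> 0)) * exp (integral {0..T} K)" for n
  proof (rule linear_growth_bound[OF primitive_on_diff[OF \<psi>n[unfolded solves_def] \<psi>[unfolded solves_def]] K(3,1,2) _ c0])
    fix t assume t: "t \<in> {0..T} - N"
    then have t': "t \<in> {0..T}" by auto
    note xx = xnR[OF t', of n] xR[OF t']
    have k0: "0 \<le> K t" using K(2)[OF t'] .
    define w where "w = \<psi>n n t - \<psi> t"
    define DA where "DA = A t (xn n t) - A t (x t)"
    define Dq where "Dq = q t (xn n t) - q t (x t)"
    have DA: "norm DA \<le> K t * \<delta> n" and Dq: "norm Dq \<le> K t * \<delta> n"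
      using K(6)[OF t xx] K(7)[OF t xx] mult_left_mono[OF \<delta>(1)[OF t', of n] k0] unfolding DA_def Dq_def by linarith+
    have "costate_field (xn n) (\<mu>n n) t (\<psi>n n t) - costate_field x \<mu> t (\<psi> t) =
       (\<mu>n n - \<mu>) *\<^sub>R q t (xn n t) + \<mu> *\<^sub>R Dq - w v* A t (xn n t) - \<psi> t v* DA"
      unfolding costate_field_def w_def DA_def Dq_def bounded_bilinear.diff_left[OF bb] bounded_bilinear.diff_right[OF bb]
      by (simp add: algebra_simps)
    also have "norm \<dots> \<le> norm ((\<mu>n n - \<mu>) *\<^sub>R q t (xn n t)) + norm (\<mu> *\<^sub>R Dq) + norm (w v* A t (xn n t)) + norm (\<psi> t v* DA)"
      by (intro order_trans[OF norm_triangle_ineq4] add_mono norm_triangle_ineq order.refl)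
    also have "\<dots> \<le> \<bar>\<mu>n n - \<mu>\<bar> * K t + \<bar>\<mu>\<bar> * (K t * \<delta> n) + K t * norm w + (K t * \<delta> n) * P"
    proof (intro add_mono)
      show "norm ((\<mu>n n - \<mu>) *\<^sub>R q t (xn n t)) \<le> \<bar>\<mu>n n - \<mu>\<bar> * K t"
        using K(5)[OF t xx(1)] by (simp add: mult_left_mono)
      show "norm (\<mu> *\<^sub>R Dq) \<le> \<bar>\<mu>\<bar> * (K t * \<delta> n)" using Dq by (simp add: mult_left_mono)
      have "norm (A t (xn n t)) * norm w \<le> K t * norm w"
        using K(4)[OF t xx(1)] by (intro mult_right_mono mult_left_mono) auto
      then show "norm (w v* A t (xn n t)) \<le> K t * norm w" using norm_vector_matrix_mult_le[of w "A t (xn n t)"] by linarith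
      have "norm DA * norm (\<psi> t) \<le> (K t * \<delta> n) * P"
        using DA P[OF t'] k0 \<delta>0 by (intro mult_mono) auto
      then show "norm (\<psi> t v* DA) \<le> (K t * \<delta> n) * P" using norm_vector_matrix_mult_le[of "\<psi> t" DA] by linarith
    qed
    also have "\<dots> = K t * (c n + norm w)" by (simp add: c_def algebra_simps)
    finally show "norm (costate_field (xn n) (\<mu>n n) t (\<psi>n n t) - costate_field x \<mu> t (\<psi> t)) \<le> K t * (c n + norm (\<psi>n n t - \<psi> t))"
      by (simp add: w_def)
  qed (use T in auto)
  then have le: "\<forall>n. norm (\<psi>n n T - \<psi> T) \<le> (c n + norm (\<psi>n n 0 - \<psi> 0)) * exp (integral {0..T} K)" by blast
  have "(\<lambda>n. norm (\<psi>n n 0 - \<psi> 0)) \<longlonglongrightarrow> 0" using \<psi>lim by (simp add: LIM_zero tendsto_norm_zero)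
  then have "(\<lambda>n. (c n + norm (\<psi>n n 0 - \<psi> 0)) * exp (integral {0..T} K)) \<longlonglongrightarrow> (0 + 0) * exp (integral {0..T} K)"
    by (intro tendsto_intros c_lim)
  then have "(\<lambda>n. (c n + norm (\<psi>n n 0 - \<psi> 0)) * exp (integral {0..T} K)) \<longlonglongrightarrow> 0" by simp
  then have "(\<lambda>n. \<psi>n n T - \<psi> T) \<longlonglongrightarrow> 0"
    by (rule Lim_null_comparison[rotated]) (use le in auto)
  then show ?thesis by (simp add: LIM_zero_iff)
qed

end

section \<open>Limits of terminal costates and subgradients at infinity\<close>

lemma strict_mono_subsequence_of_divergent:
  fixes k :: "nat \<Rightarrow> nat"
  assumes "filterlim k at_top sequentially"
  obtains h :: "nat \<Rightarrow> nat" where "strict_mono h" "strict_mono (k \<circ> h)"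
proof -
  have step: "\<exists>y>a. k a < k y" for a
  proof -
    have "\<forall>\<^sub>F n in sequentially. Suc (k a) \<le> k n" using assms by (simp add: filterlim_at_top)
    moreover have "\<forall>\<^sub>F n in sequentially. a < n" by (rule eventually_gt_at_top)
    ultimately have "\<forall>\<^sub>F n in sequentially. Suc (k a) \<le> k n \<and> a < n" by (rule eventually_conj)
    then obtain n where "Suc (k a) \<le> k n \<and> a < n" using eventually_happens'[OF sequentially_bot] by blast
    then show ?thesis by (intro exI[of _ n]) auto
  qed
  have "\<exists>h. \<forall>n. True \<and> (h n < h (Suc n) \<and> k (h n) < k (h (Suc n)))"
    by (rule dependent_nat_choice) (use step in auto)
  then obtain h where "\<And>n. h n < h (Suc n)" "\<And>n. k (h n) < k (h (Suc n))" by blast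
  then show ?thesis using that[of h] by (simp add: strict_mono_Suc_iff)
qed

context smooth_system
begin

definition flow :: "real^'m \<Rightarrow> real \<Rightarrow> real^'m" where
  "flow b = (SOME x. x 0 = b \<and> (\<forall>T\<ge>0. solves F T x))"

lemma flow: "flow b 0 = b" "0 \<le> T \<Longrightarrow> solves F T (flow b)"
proof -
  have "\<exists>x. x 0 = b \<and> (\<forall>T\<ge>0. solves F T x)"
    using solves_exists[OF F_field, of b] by blast
  then have "flow b 0 = b \<and> (\<forall>T\<ge>0. solves F T (flow b))"
    unfolding flow_def by (rule someI_ex)
  then show "flow b 0 = b" "0 \<le> T \<Longrightarrow> solves F T (flow b)" by auto
qed

definition total_cost :: "real^'m \<Rightarrow> real \<Rightarrow> real" where
  "total_cost b T = integral {0..T} (\<lambda>t. g t (flow b t))"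

lemma total_cost_eq:
  assumes "solves F T x"
  shows "total_cost (x 0) T = integral {0..T} (\<lambda>t. g t (x t))"
  unfolding total_cost_def
proof (rule Henstock_Kurzweil_Integration.integral_cong)
  fix t assume t: "t \<in> {0..T}"
  then have "flow (x 0) t = x t"
    by (intro solves_unique[OF F_field flow(2) assms flow(1)]) auto
  then show "g t (flow (x 0) t) = g t (x t)" by simp
qed

lemma proximal_subdifferential_total_cost:
  assumes T: "0 \<le> T" and x: "solves F T x" and \<psi>: "solves (costate_field x 1) T \<psi>" "\<psi> T = 0"
  shows "proximal_subdifferential (\<lambda>b. - total_cost b T) (x 0) = {\<psi> 0}"
proof -
  obtain \<sigma> where \<sigma>: "0 \<le> \<sigma>" "\<And>y. solves F T y \<Longrightarrow> norm (y 0 - x 0) \<le> 1 \<Longrightarrow>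
     \<bar>integral {0..T} (\<lambda>t. g t (y t)) - integral {0..T} (\<lambda>t. g t (x t)) + \<psi> 0 \<bullet> (y 0 - x 0)\<bar> \<le> \<sigma> * (norm (y 0 - x 0))\<^sup>2"
    using cost_expansion[OF T x \<psi>] by blast
  show ?thesis
  proof (rule proximal_subdifferential_eq_gradient[OF \<sigma>(1), of 1])
    fix \<xi> assume "\<xi> \<in> ball (x 0) 1"
    then have "norm (flow \<xi> 0 - x 0) \<le> 1" by (simp add: flow dist_norm norm_minus_commute)
    from \<sigma>(2)[OF flow(2)[OF T] this]
    have "\<bar>total_cost \<xi> T - total_cost (x 0) T + \<psi> 0 \<bullet> (\<xi> - x 0)\<bar> \<le> \<sigma> * (norm (\<xi> - x 0))\<^sup>2"
      using total_cost_eq[OF x] by (simp add: total_cost_def flow(1))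
    then show "\<bar>- total_cost \<xi> T - - total_cost (x 0) T - \<psi> 0 \<bullet> (\<xi> - x 0)\<bar> \<le> \<sigma> * (norm (\<xi> - x 0))\<^sup>2"
      by (simp add: abs_le_iff algebra_simps)
  qed simp
qed

text \<open>
  The approximation condition in the definition of a limiting solution, in terms of primitives.
\<close>

definition limit_of_terminal_costates :: "(nat \<Rightarrow> real) \<Rightarrow> (real \<Rightarrow> real^'m) \<Rightarrow> (real \<Rightarrow> real^'m) \<Rightarrow> real \<Rightarrow> bool" where
  "limit_of_terminal_costates \<tau> x \<psi> \<mu> \<longleftrightarrow>
     (\<exists>(r::nat \<Rightarrow> nat) xn \<psi>n \<mu>n. strict_mono r \<and>
        (\<forall>n. \<mu>n n \<ge> 0 \<and> (\<forall>T\<ge>0. solves F T (xn n)) \<and>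
             (\<forall>T\<ge>0. solves (costate_field (xn n) (\<mu>n n)) T (\<psi>n n)) \<and> \<psi>n n (\<tau> (r n)) = 0) \<and>
        (\<forall>t\<ge>0. (\<lambda>n. xn n t) \<longlonglongrightarrow> x t) \<and> (\<forall>t\<ge>0. (\<lambda>n. \<psi>n n t) \<longlonglongrightarrow> \<psi> t) \<and> \<mu>n \<longlonglongrightarrow> \<mu>)"

text \<open>
  A nontrivial costate with zero multiplier is therefore visible at time \<open>0\<close>.
\<close>

lemma homogeneous_costate_zero_forward:
  assumes x: "\<And>T. 0 \<le> T \<Longrightarrow> continuous_on {0..T} x"
    and \<psi>: "\<And>T. 0 \<le> T \<Longrightarrow> solves (costate_field x 0) T \<psi>" and z: "\<psi> 0 = 0" and t: "0 \<le> t"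
  shows "\<psi> t = 0"
proof -
  have "solves (costate_field x 0) t (\<lambda>t. 0)"
    using costate_scaleR[OF \<psi>[OF t], of 0] by simp
  from solves_unique[OF costate_field_linear_growth[OF x] \<psi>[OF t] this] z t show ?thesis by simp
qed

text \<open>
  If \<open>\<mu>n n > 0\<close>, then \<open>\<psi>n n / \<mu>n n\<close> is a costate with multiplier \<open>1\<close> that vanishes at the horizon, so its
  initial value is a proximal subgradient. If \<open>\<mu>n n = 0\<close>, then \<open>\<psi>n n\<close> is zero. The latter can happen
  only finitely often, by the alternative that \<open>\<mu>\<close> is positive or \<open>\<psi> 0\<close> is not zero.
\<close>

lemma subgradients_from_terminal_costates:
  assumes \<tau>: "\<And>n. 0 < \<tau> n" "filterlim \<tau> at_top sequentially"
    and lim: "limit_of_terminal_costates \<tau> x \<psi> \<mu>" and \<mu>: "0 \<le> \<mu>" and nz: "\<mu> > 0 \<or> \<psi> 0 \<noteq> 0"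
  shows "\<exists>b t s \<zeta>. (\<forall>n::nat. t n \<in> range \<tau> \<and> s n > 0 \<and>
      \<zeta> n \<in> proximal_subdifferential (\<lambda>b. - total_cost b (t n)) (b n)) \<and>
    b \<longlonglongrightarrow> x 0 \<and> filterlim t at_top sequentially \<and> s \<longlonglongrightarrow> \<mu> \<and> (\<lambda>n. s n *\<^sub>R \<zeta> n) \<longlonglongrightarrow> \<psi> 0"
proof -
  obtain r :: "nat \<Rightarrow> nat" and xn \<psi>n \<mu>n where r: "strict_mono r"
    and \<mu>n0: "\<And>n. \<mu>n n \<ge> 0" and xn: "\<And>n T. 0 \<le> T \<Longrightarrow> solves F T (xn n)"
    and \<psi>n: "\<And>n T. 0 \<le> T \<Longrightarrow> solves (costate_field (xn n) (\<mu>n n)) T (\<psi>n n)"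
    and vanish: "\<And>n. \<psi>n n (\<tau> (r n)) = 0"
    and limx: "\<And>t. 0 \<le> t \<Longrightarrow> (\<lambda>n. xn n t) \<longlonglongrightarrow> x t" and lim\<psi>: "\<And>t. 0 \<le> t \<Longrightarrow> (\<lambda>n. \<psi>n n t) \<longlonglongrightarrow> \<psi> t"
    and lim\<mu>: "\<mu>n \<longlonglongrightarrow> \<mu>"
    using lim unfolding limit_of_terminal_costates_def by metis
  have \<tau>0: "0 \<le> \<tau> n" for n using \<tau>(1)[of n] by simp
  have "\<forall>\<^sub>F n in sequentially. \<mu>n n > 0"
  proof (cases "\<mu> > 0")
    case True
    then show ?thesis using lim\<mu> by (rule order_tendstoD(1)[rotated])
  next
    case False
    then have "\<psi> 0 \<noteq> 0" using nz by simp
    then have "\<forall>\<^sub>F n in sequentially. \<psi>n n 0 \<noteq> 0" using lim\<psi>[of 0] tendsto_imp_eventually_ne by blast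
    then show ?thesis
    proof (rule eventually_mono)
      fix n assume n: "\<psi>n n 0 \<noteq> 0"
      have "\<mu>n n \<noteq> 0"
      proof
        assume "\<mu>n n = 0"
        then have "solves (costate_field (xn n) 0) (\<tau> (r n)) (\<psi>n n)" using \<psi>n[OF \<tau>0, of n] by simp
        from homogeneous_costate_zero_backward[OF \<tau>0 this vanish solves_continuous[OF xn[OF \<tau>0]]] n show False by simp
      qed
      then show "\<mu>n n > 0" using \<mu>n0[of n] by simp
    qed
  qed
  then obtain n0 where n0: "\<And>n. n \<ge> n0 \<Longrightarrow> \<mu>n n > 0" unfolding eventually_sequentially by blast
  \<comment> \<open>Drops the finitely many indices with zero multiplier.\<close>
  define m where "m n = n + n0" for n
  have pos: "\<mu>n (m n) > 0" for n using n0 by (simp add: m_def)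
  define \<zeta> where "\<zeta> n = (1 / \<mu>n (m n)) *\<^sub>R \<psi>n (m n) 0" for n
  show ?thesis
  proof (intro exI conjI allI)
    show "\<tau> (r (m n)) \<in> range \<tau>" for n by simp
    show "\<mu>n (m n) > 0" for n by (rule pos)
    show "\<zeta> n \<in> proximal_subdifferential (\<lambda>b. - total_cost b (\<tau> (r (m n)))) (xn (m n) 0)" for n
    proof -
      have "solves (costate_field (xn (m n)) 1) (\<tau> (r (m n))) (\<lambda>t. (1 / \<mu>n (m n)) *\<^sub>R \<psi>n (m n) t)"
        using costate_scaleR[OF \<psi>n[OF \<tau>0, of "m n"], of "1 / \<mu>n (m n)"] pos[of n] by simp
      from proximal_subdifferential_total_cost[OF \<tau>0 xn[OF \<tau>0] this] vanish show ?thesis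
        by (simp add: \<zeta>_def)
    qed
    show "(\<lambda>n. xn (m n) 0) \<longlonglongrightarrow> x 0"
      unfolding m_def by (rule LIMSEQ_ignore_initial_segment[OF limx]) simp
    show "(\<lambda>n. \<mu>n (m n)) \<longlonglongrightarrow> \<mu>"
      unfolding m_def by (rule LIMSEQ_ignore_initial_segment[OF lim\<mu>])
    have "\<mu>n (m n) *\<^sub>R \<zeta> n = \<psi>n (m n) 0" for n using pos[of n] by (simp add: \<zeta>_def)
    moreover have "(\<lambda>n. \<psi>n (m n) 0) \<longlonglongrightarrow> \<psi> 0"
      unfolding m_def by (rule LIMSEQ_ignore_initial_segment[OF lim\<psi>]) simp
    ultimately show "(\<lambda>n. \<mu>n (m n) *\<^sub>R \<zeta> n) \<longlonglongrightarrow> \<psi> 0" by simp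
    have "filterlim (\<lambda>n. r (m n)) at_top sequentially"
      by (rule filterlim_compose[OF filterlim_subseq[OF r]]) (simp add: m_def filterlim_subseq strict_mono_def)
    then show "filterlim (\<lambda>n. \<tau> (r (m n))) at_top sequentially"
      by (rule filterlim_compose[OF \<tau>(2)])
  qed
qed

text \<open>
  Each subgradient \<open>\<zeta> n\<close> is the initial value of the costate with multiplier \<open>1\<close> vanishing at \<open>t n\<close>;
  scaling by \<open>s n\<close> gives multiplier \<open>s n\<close>. The horizons \<open>t n\<close> may repeat or decrease, so a
  subsequence is chosen along which their indices in \<open>\<tau>\<close> increase.
\<close>

lemma terminal_costates_from_subgradients:
  assumes \<tau>: "\<And>n. 0 < \<tau> n" "incseq \<tau>"
    and x: "\<And>T. 0 \<le> T \<Longrightarrow> solves F T x" and \<psi>: "\<And>T. 0 \<le> T \<Longrightarrow> solves (costate_field x \<mu>) T \<psi>"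
    and t: "\<And>n::nat. t n \<in> range \<tau>" "filterlim t at_top sequentially"
    and s: "\<And>n. s n \<ge> 0" "s \<longlonglongrightarrow> \<mu>" and b: "b \<longlonglongrightarrow> x 0"
    and \<zeta>: "\<And>n. \<zeta> n \<in> proximal_subdifferential (\<lambda>b. - total_cost b (t n)) (b n)" "(\<lambda>n. s n *\<^sub>R \<zeta> n) \<longlonglongrightarrow> \<psi> 0"
  shows "limit_of_terminal_costates \<tau> x \<psi> \<mu>"
proof -
  have t0: "0 \<le> t n" for n using t(1)[of n] \<tau>(1) by (auto simp: less_imp_le)
  have "\<exists>\<phi>. (\<forall>T\<ge>0. solves (costate_field (flow (b n)) 1) T \<phi>) \<and> \<phi> (t n) = 0 \<and> \<phi> 0 = \<zeta> n" for n
  proof -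
    obtain \<phi> where \<phi>: "\<phi> (t n) = 0" "\<And>T. 0 \<le> T \<Longrightarrow> solves (costate_field (flow (b n)) 1) T \<phi>"
      using costate_exists_terminal[where x="flow (b n)" and T="t n" and \<mu>=1, OF solves_continuous[OF flow(2)] t0] by blast
    have "proximal_subdifferential (\<lambda>b. - total_cost b (t n)) (flow (b n) 0) = {\<phi> 0}"
      by (rule proximal_subdifferential_total_cost[OF t0 flow(2)[OF t0] \<phi>(2)[OF t0] \<phi>(1)])
    then have "\<phi> 0 = \<zeta> n" using \<zeta>(1)[of n] by (simp add: flow(1))
    with \<phi> show ?thesis by blast
  qed
  then obtain \<phi> where \<phi>: "\<And>n T. 0 \<le> T \<Longrightarrow> solves (costate_field (flow (b n)) 1) T (\<phi> n)"
    "\<And>n. \<phi> n (t n) = 0" "\<And>n. \<phi> n 0 = \<zeta> n" by metis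
  have "\<exists>k. t n = \<tau> k" for n using t(1)[of n] by auto
  then obtain k where k: "\<And>n. t n = \<tau> (k n)" by metis
  have "filterlim k at_top sequentially"
    unfolding filterlim_at_top
  proof
    fix Z
    have "\<forall>\<^sub>F n in sequentially. \<tau> Z < t n" using t(2) by (simp add: filterlim_at_top_dense)
    then show "\<forall>\<^sub>F n in sequentially. Z \<le> k n"
    proof (rule eventually_mono)
      fix n assume "\<tau> Z < t n"
      then have "\<not> \<tau> (k n) \<le> \<tau> Z" by (simp add: k)
      then show "Z \<le> k n" using incseqD[OF \<tau>(2), of "k n" Z] by (meson nat_le_linear)
    qed
  qed
  then obtain h :: "nat \<Rightarrow> nat" where h: "strict_mono h" "strict_mono (k \<circ> h)"
    by (rule strict_mono_subsequence_of_divergent)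
  have sub: "(\<lambda>n. X (h n)) \<longlonglongrightarrow> L" if "X \<longlonglongrightarrow> L" for X :: "nat \<Rightarrow> 'c::topological_space" and L
    using LIMSEQ_subseq_LIMSEQ[OF that h(1)] by (simp add: comp_def)
  define xn where "xn n = flow (b (h n))" for n
  define \<psi>n where "\<psi>n n t = s (h n) *\<^sub>R \<phi> (h n) t" for n t
  have xn: "solves F T (xn n)" if "0 \<le> T" for n T using flow(2)[OF that] by (simp add: xn_def)
  have \<psi>n: "solves (costate_field (xn n) (s (h n))) T (\<psi>n n)" if "0 \<le> T" for n T
    using costate_scaleR[OF \<phi>(1)[of T "h n", OF that], of "s (h n)"] by (simp add: xn_def \<psi>n_def[abs_def])
  have x0: "(\<lambda>n. xn n 0) \<longlonglongrightarrow> x 0" using sub[OF b] by (simp add: xn_def flow(1))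
  have \<psi>0: "(\<lambda>n. \<psi>n n 0) \<longlonglongrightarrow> \<psi> 0" using sub[OF \<zeta>(2)] by (simp add: \<psi>n_def \<phi>(3))
  show ?thesis
    unfolding limit_of_terminal_costates_def
  proof (intro exI conjI allI impI)
    show "strict_mono (k \<circ> h)" by (rule h)
    show "0 \<le> s (h n)" for n by (rule s)
    show "solves F T (xn n)" if "0 \<le> T" for n T using xn[OF that] .
    show "solves (costate_field (xn n) (s (h n))) T (\<psi>n n)" if "0 \<le> T" for n T using \<psi>n[OF that] .
    show "\<psi>n n (\<tau> ((k \<circ> h) n)) = 0" for n using \<phi>(2)[of "h n"] by (simp add: \<psi>n_def k)
    show "(\<lambda>n. xn n t) \<longlonglongrightarrow> x t" if "0 \<le> t" for t
      by (rule state_convergence[OF x[OF that] xn[OF that] that x0])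
    show "(\<lambda>n. \<psi>n n t) \<longlonglongrightarrow> \<psi> t" if "0 \<le> t" for t
      by (rule costate_convergence[OF x[OF that] xn[OF that] that x0 \<psi>[OF that] \<psi>n[OF that] \<psi>0 sub[OF s(2)]])
    show "(\<lambda>n. s (h n)) \<longlonglongrightarrow> \<mu>" by (rule sub[OF s(2)])
  qed
qed

lemma limit_of_terminal_costates_iff:
  assumes \<tau>: "unboundedly_increasing_positive \<tau>"
    and x: "\<And>T. 0 \<le> T \<Longrightarrow> solves F T x" and \<psi>: "\<And>T. 0 \<le> T \<Longrightarrow> solves (costate_field x \<mu>) T \<psi>" and \<mu>: "0 \<le> \<mu>"
  shows "nontrivial_multiplier \<psi> \<mu> \<and> limit_of_terminal_costates \<tau> x \<psi> \<mu> \<longleftrightarrow>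
    (\<mu> > 0 \<and> \<psi> 0 \<in> (*\<^sub>R) \<mu> ` limiting_subdifferential_at_infinity (\<lambda>b t. - total_cost b t) \<tau> (x 0)) \<or>
    (\<mu> = 0 \<and> \<psi> 0 \<in> singular_subdifferential_at_infinity (\<lambda>b t. - total_cost b t) \<tau> (x 0) - {0})"
proof
  have \<tau>': "\<And>n. 0 < \<tau> n" "incseq \<tau>" "filterlim \<tau> at_top sequentially"
    using \<tau> by (auto simp: unboundedly_increasing_positive_def)
  {
    assume L: "nontrivial_multiplier \<psi> \<mu> \<and> limit_of_terminal_costates \<tau> x \<psi> \<mu>"
    have nz: "\<mu> > 0 \<or> \<psi> 0 \<noteq> 0"
    proof (cases "\<mu> = 0")
      case True
      then obtain t where "0 \<le> t" "\<psi> t \<noteq> 0" using L by (auto simp: nontrivial_multiplier_def)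
      then have "\<psi> 0 \<noteq> 0"
        using homogeneous_costate_zero_forward[OF solves_continuous[OF x] \<psi>[unfolded True]] by metis
      then show ?thesis ..
    qed (use \<mu> in simp)
    obtain b t s \<zeta> where sub: "\<forall>n::nat. t n \<in> range \<tau> \<and> s n > 0 \<and>
        \<zeta> n \<in> proximal_subdifferential (\<lambda>b. - total_cost b (t n)) (b n)"
      and lims: "b \<longlonglongrightarrow> x 0" "filterlim t at_top sequentially" "s \<longlonglongrightarrow> \<mu>" "(\<lambda>n. s n *\<^sub>R \<zeta> n) \<longlonglongrightarrow> \<psi> 0"
      using subgradients_from_terminal_costates[OF \<tau>'(1,3) conjunct2[OF L] \<mu> nz] by (elim exE conjE)
    show "(\<mu> > 0 \<and> \<psi> 0 \<in> (*\<^sub>R) \<mu> ` limiting_subdifferential_at_infinity (\<lambda>b t. - total_cost b t) \<tau> (x 0)) \<or>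
      (\<mu> = 0 \<and> \<psi> 0 \<in> singular_subdifferential_at_infinity (\<lambda>b t. - total_cost b t) \<tau> (x 0) - {0})"
    proof (cases "\<mu> = 0")
      case True
      have "\<psi> 0 \<in> singular_subdifferential_at_infinity (\<lambda>b t. - total_cost b t) \<tau> (x 0)"
        unfolding singular_subdifferential_at_infinity_def
        by (rule CollectI, rule exI[of _ b], rule exI[of _ t], rule exI[of _ s], rule exI[of _ \<zeta>])
          (use sub lims True in \<open>simp add: less_imp_le\<close>)
      then show ?thesis using True nz by simp
    next
      case False
      then have \<mu>0: "\<mu> > 0" using \<mu> by simp
      have "(\<lambda>n. inverse (s n) *\<^sub>R (s n *\<^sub>R \<zeta> n)) \<longlonglongrightarrow> inverse \<mu> *\<^sub>R \<psi> 0"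
        by (intro tendsto_intros lims False)
      moreover have "inverse (s n) *\<^sub>R (s n *\<^sub>R \<zeta> n) = \<zeta> n" for n using sub[rule_format, of n] by simp
      ultimately have \<zeta>: "\<zeta> \<longlonglongrightarrow> inverse \<mu> *\<^sub>R \<psi> 0" by simp
      have "inverse \<mu> *\<^sub>R \<psi> 0 \<in> limiting_subdifferential_at_infinity (\<lambda>b t. - total_cost b t) \<tau> (x 0)"
        unfolding limiting_subdifferential_at_infinity_def
        by (rule CollectI, rule exI[of _ b], rule exI[of _ t], rule exI[of _ \<zeta>]) (use sub lims \<zeta> in simp)
      moreover have "\<psi> 0 = \<mu> *\<^sub>R (inverse \<mu> *\<^sub>R \<psi> 0)" using False by simp
      ultimately show ?thesis using \<mu>0 by (intro disjI1 conjI image_eqI)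
    qed
  }
  assume "(\<mu> > 0 \<and> \<psi> 0 \<in> (*\<^sub>R) \<mu> ` limiting_subdifferential_at_infinity (\<lambda>b t. - total_cost b t) \<tau> (x 0)) \<or>
    (\<mu> = 0 \<and> \<psi> 0 \<in> singular_subdifferential_at_infinity (\<lambda>b t. - total_cost b t) \<tau> (x 0) - {0})"
  then show "nontrivial_multiplier \<psi> \<mu> \<and> limit_of_terminal_costates \<tau> x \<psi> \<mu>"
  proof (elim disjE conjE)
    assume \<mu>0: "\<mu> > 0" and "\<psi> 0 \<in> (*\<^sub>R) \<mu> ` limiting_subdifferential_at_infinity (\<lambda>b t. - total_cost b t) \<tau> (x 0)"
    then obtain z where z: "\<psi> 0 = \<mu> *\<^sub>R z" "z \<in> limiting_subdifferential_at_infinity (\<lambda>b t. - total_cost b t) \<tau> (x 0)" by blast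
    then obtain b t \<zeta> where *: "\<forall>n::nat. t n \<in> range \<tau> \<and> \<zeta> n \<in> proximal_subdifferential (\<lambda>b. - total_cost b (t n)) (b n)"
      "b \<longlonglongrightarrow> x 0" "filterlim t at_top sequentially" "\<zeta> \<longlonglongrightarrow> z"
      unfolding limiting_subdifferential_at_infinity_def mem_Collect_eq by (elim exE conjE)
    have "limit_of_terminal_costates \<tau> x \<psi> \<mu>"
    proof (rule terminal_costates_from_subgradients[OF \<tau>'(1,2) x \<psi>])
      show "(\<lambda>n. \<mu> *\<^sub>R \<zeta> n) \<longlonglongrightarrow> \<psi> 0" unfolding z(1) by (intro tendsto_intros *)
    qed (use * \<mu> in auto)
    then show ?thesis using \<mu>0 by (simp add: nontrivial_multiplier_def)
  next
    assume \<mu>0: "\<mu> = 0" and z: "\<psi> 0 \<in> singular_subdifferential_at_infinity (\<lambda>b t. - total_cost b t) \<tau> (x 0) - {0}"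
    then obtain b t s \<zeta> where *: "\<forall>n::nat. t n \<in> range \<tau> \<and> 0 \<le> s n \<and> \<zeta> n \<in> proximal_subdifferential (\<lambda>b. - total_cost b (t n)) (b n)"
      "b \<longlonglongrightarrow> x 0" "filterlim t at_top sequentially" "s \<longlonglongrightarrow> 0" "(\<lambda>n. s n *\<^sub>R \<zeta> n) \<longlonglongrightarrow> \<psi> 0"
      unfolding singular_subdifferential_at_infinity_def mem_Collect_eq Diff_iff by (elim exE conjE)
    have "limit_of_terminal_costates \<tau> x \<psi> \<mu>"
      by (rule terminal_costates_from_subgradients[OF \<tau>'(1,2) x \<psi>, where t=t and s=s and b=b and \<zeta>=\<zeta>])
        (use * \<mu>0 in auto)
    then show ?thesis using z by (auto simp: nontrivial_multiplier_def)
  qed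
qed

end

section \<open>Control systems\<close>

text \<open>
  Existence comes from representing the derivative by its values on the standard basis, uniqueness
  from nondegeneracy of the inner product.
\<close>

lemma gradient_works:
  fixes g :: "'a::euclidean_space \<Rightarrow> real"
  assumes "g differentiable (at x)"
  shows "(g has_derivative (\<lambda>h. grad g x \<bullet> h)) (at x)"
proof -
  obtain g' where g': "(g has_derivative g') (at x)" using assms by (auto simp: differentiable_def)
  define D where "D = (\<Sum>i\<in>Basis. g' i *\<^sub>R i)"
  have "g' h = h \<bullet> D" for h
  proof -
    have "g' h = (\<Sum>i\<in>Basis. (h \<bullet> i) * g' i)"
      using Linear_Algebra.linear_componentwise[OF has_derivative_linear[OF g'], of h 1] by simp
    then show ?thesis by (simp add: D_def inner_sum_right mult.commute)
  qed
  then have "g' = (\<lambda>h. h \<bullet> D)" by blast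
  then have D: "GDERIV g x :> D" using g' by (simp add: gderiv_def)
  have unique: "D' = D" if "GDERIV g x :> D'" for D'
  proof -
    have eq: "(\<lambda>h. h \<bullet> D') = (\<lambda>h. h \<bullet> D)"
      by (rule has_derivative_unique[OF that[unfolded gderiv_def] D[unfolded gderiv_def]])
    have "\<forall>h. h \<bullet> D' = h \<bullet> D" by (intro allI fun_cong[OF eq])
    then show ?thesis by (rule iffD1[OF vector_eq_ldot])
  qed
  have "grad g x = D" unfolding grad_def by (rule the_equality) (fact D, fact unique)
  then show ?thesis using D by (simp only: gderiv_def inner_commute[of D])
qed

lemma gradient_eqI:
  fixes g :: "'a::euclidean_space \<Rightarrow> real"
  assumes "(g has_derivative (\<lambda>h. D \<bullet> h)) (at x)"
  shows "grad g x = D"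
proof -
  have "(g has_derivative (\<lambda>h. grad g x \<bullet> h)) (at x)"
    using assms by (intro gradient_works) (auto simp: differentiable_def)
  then have "\<forall>h. grad g x \<bullet> h = D \<bullet> h"
    by (intro allI fun_cong[OF has_derivative_unique[OF _ assms]])
  then show ?thesis by (rule iffD1[OF vector_eq_rdot])
qed

lemma ode_solution_cong:
  assumes "\<And>t p. 0 \<le> t \<Longrightarrow> G t p = H t p"
  shows "ode_solution G x \<longleftrightarrow> ode_solution H x"
  unfolding ode_solution_def AE_lebesgue_on_nonneg_iff by (simp add: assms)

lemma locally_integrable_abs:
  assumes "locally_integrable M" "0 \<le> T"
  shows "(\<lambda>t. \<bar>M t\<bar>) absolutely_integrable_on {0..T}"
  using assms by (intro set_integrable_abs) (simp add: locally_integrable_def)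

text \<open>
  On \<open>[0, T]\<close> the pairs of a state in a ball and a value of \<open>u\<close> form a bounded set, since admissible
  controls are locally bounded.
\<close>

lemma bounded_lipschitz_along_control:
  fixes h :: "'a::real_normed_vector \<Rightarrow> 'u::euclidean_space \<Rightarrow> real \<Rightarrow> 'b::real_normed_vector"
  assumes h: "bounded_lipschitz_on_bounded h" and u: "bounded (u ` {0..T})" and T: "0 \<le> T"
  shows "integrably_bounded T (\<lambda>t k. \<forall>x\<in>cball 0 R. norm (h x (u t) t) \<le> k)"
    and "integrably_bounded T (\<lambda>t k. k-lipschitz_on (cball 0 R) (\<lambda>x. h x (u t) t))"
proof -
  define B where "B = cball (0::'a) R \<times> u ` {0..T}"
  have "bounded B" unfolding B_def by (intro bounded_Times u bounded_cball)
  then obtain M K where M: "locally_integrable M" "AE t in lebesgue_on {0..}. \<forall>(x, v)\<in>B. norm (h x v t) \<le> M t"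
    and K: "locally_integrable K" "AE t in lebesgue_on {0..}. \<forall>v. (K t)-lipschitz_on {x. (x, v) \<in> B} (\<lambda>x. h x v t)"
    using h unfolding bounded_lipschitz_on_bounded_def by (elim allE impE exE conjE)
  show "integrably_bounded T (\<lambda>t k. \<forall>x\<in>cball 0 R. norm (h x (u t) t) \<le> k)"
  proof -
    obtain N where N: "negligible N" "\<forall>t\<ge>0. t \<notin> N \<longrightarrow> (\<forall>(x, v)\<in>B. norm (h x v t) \<le> M t)"
      using M(2) unfolding AE_lebesgue_on_nonneg_iff by (elim exE conjE)
    show ?thesis
    proof (rule integrably_boundedI[OF locally_integrable_abs[OF M(1) T] _ N(1)])
      fix t assume t: "t \<in> {0..T} - N"
      show "\<forall>x\<in>cball 0 R. norm (h x (u t) t) \<le> \<bar>M t\<bar>"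
      proof
        fix x assume "x \<in> cball (0::'a) R"
        then have "(x, u t) \<in> B" using t by (auto simp: B_def)
        then have "norm (h x (u t) t) \<le> M t" using N(2) t by auto
        then show "norm (h x (u t) t) \<le> \<bar>M t\<bar>" by simp
      qed
    qed simp
  qed
  show "integrably_bounded T (\<lambda>t k. k-lipschitz_on (cball 0 R) (\<lambda>x. h x (u t) t))"
  proof -
    obtain N where N: "negligible N" "\<forall>t\<ge>0. t \<notin> N \<longrightarrow> (\<forall>v. (K t)-lipschitz_on {x. (x, v) \<in> B} (\<lambda>x. h x v t))"
      using K(2) unfolding AE_lebesgue_on_nonneg_iff by (elim exE conjE)
    show ?thesis
    proof (rule integrably_boundedI[OF locally_integrable_abs[OF K(1) T] _ N(1)])
      fix t assume t: "t \<in> {0..T} - N"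
      have "{x. (x, u t) \<in> B} = cball 0 R" using t by (auto simp: B_def)
      then have "(K t)-lipschitz_on (cball 0 R) (\<lambda>x. h x (u t) t)" using N(2) t by (metis DiffD1 DiffD2 atLeastAtMost_iff)
      then show "\<bar>K t\<bar>-lipschitz_on (cball 0 R) (\<lambda>x. h x (u t) t)" by (rule lipschitz_on_le) simp
    qed simp
  qed
qed

lemma (in control_problem) smooth_system_along_control:
  assumes u: "u \<in> admissible_controls U"
  shows "smooth_system (\<lambda>t x. f x (u t) t) (\<lambda>t x. f\<^sub>0 x (u t) t)
    (\<lambda>t x. state_jacobian f x (u t) t) (\<lambda>t x. state_gradient f\<^sub>0 x (u t) t)"
proof
  have ub: "bounded (u ` {0..T})" if "0 \<le> T" for T using u that by (simp add: admissible_controls_def)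
  show F': "((\<lambda>x. f x (u t) t) has_derivative (\<lambda>h. state_jacobian f x (u t) t *v h)) (at x)" if "0 \<le> t" for t x
    using f_C1[OF that, of "u t"] unfolding state_jacobian_def by (simp add: jacobian_works[symmetric])
  show g': "((\<lambda>x. f\<^sub>0 x (u t) t) has_derivative (\<lambda>h. state_gradient f\<^sub>0 x (u t) t \<bullet> h)) (at x)" if "0 \<le> t" for t x
    using f0_C1[OF that, of "u t"] unfolding state_gradient_def by (intro gradient_works) simp
  note car = caratheodory[OF u, unfolded caratheodory_along_def]
  have continuous: "continuous_on UNIV (\<lambda>x. f x (u t) t)" "continuous_on UNIV (\<lambda>x. f\<^sub>0 x (u t) t)" if "0 \<le> t" for t
    unfolding continuous_on_eq_continuous_at[OF open_UNIV]
    using has_derivative_continuous[OF F'[OF that]] has_derivative_continuous[OF g'[OF that]] by simp_all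
  have F_car: "caratheodory (\<lambda>t x. f x (u t) t)"
    unfolding caratheodory_def using car continuous by simp
  show "caratheodory (\<lambda>t x. f\<^sub>0 x (u t) t)"
    unfolding caratheodory_def using car continuous by simp
  show "caratheodory (\<lambda>t x. state_jacobian f x (u t) t)" "caratheodory (\<lambda>t x. state_gradient f\<^sub>0 x (u t) t)"
    unfolding caratheodory_def using car f_C1 f0_C1 by simp_all
  have growth: "integrably_bounded T (\<lambda>t k. \<forall>z. norm (f z (u t) t) \<le> k * (1 + norm z))" if T: "0 \<le> T" for T
  proof -
    obtain L N where L: "locally_integrable L" "negligible N"
      "\<forall>t\<ge>0. t \<notin> N \<longrightarrow> (\<forall>x. norm (f x (u t) t) \<le> L t * (1 + norm x))"
      using f_sublinear_growth[OF u] unfolding AE_lebesgue_on_nonneg_iff by (elim exE conjE)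
    show ?thesis
    proof (rule integrably_boundedI[OF locally_integrable_abs[OF L(1) T] _ L(2)])
      fix t assume t: "t \<in> {0..T} - N"
      show "\<forall>z. norm (f z (u t) t) \<le> \<bar>L t\<bar> * (1 + norm z)"
      proof
        fix z
        have "norm (f z (u t) t) \<le> L t * (1 + norm z)" using L(3) t by simp
        also have "\<dots> \<le> \<bar>L t\<bar> * (1 + norm z)" by (intro mult_right_mono) auto
        finally show "norm (f z (u t) t) \<le> \<bar>L t\<bar> * (1 + norm z)" .
      qed
    qed simp
  qed
  show "linear_growth_field (\<lambda>t x. f x (u t) t)"
    unfolding linear_growth_field_def
    using F_car growth bounded_lipschitz_along_control(2)[OF f_bounds ub] by simp
  fix T R :: real assume T: "0 \<le> T"
  note b0 = bounded_lipschitz_along_control[OF f0_bounds ub[OF T] T, of R]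
    and bA = bounded_lipschitz_along_control[OF df_bounds ub[OF T] T, of R]
    and bq = bounded_lipschitz_along_control[OF df0_bounds ub[OF T] T, of R]
  have up: "\<forall>x\<in>S. P x \<le> k'" if "\<forall>x\<in>S. P x \<le> k" "k \<le> k'" for S :: "(real^'a) set" and P and k k' :: real
    using that by (meson order_trans)
  have "integrably_bounded T (\<lambda>t k. ((\<forall>x\<in>cball 0 R. norm (f\<^sub>0 x (u t) t) \<le> k) \<and>
      ((\<forall>x\<in>cball 0 R. norm (state_jacobian f x (u t) t) \<le> k) \<and> (\<forall>x\<in>cball 0 R. norm (state_gradient f\<^sub>0 x (u t) t) \<le> k))) \<and>
      (k-lipschitz_on (cball 0 R) (\<lambda>x. state_jacobian f x (u t) t) \<and>
       k-lipschitz_on (cball 0 R) (\<lambda>x. state_gradient f\<^sub>0 x (u t) t)))"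
    by (intro integrably_bounded_conj b0(1) bA bq; (elim conjE)?; (intro conjI)?; (erule (1) up | erule (1) lipschitz_on_le))
  then show "integrably_bounded T (\<lambda>t k. (\<forall>x\<in>cball 0 R. norm (f\<^sub>0 x (u t) t) \<le> k \<and>
      norm (state_jacobian f x (u t) t) \<le> k \<and> norm (state_gradient f\<^sub>0 x (u t) t) \<le> k) \<and>
      k-lipschitz_on (cball 0 R) (\<lambda>x. state_jacobian f x (u t) t) \<and>
      k-lipschitz_on (cball 0 R) (\<lambda>x. state_gradient f\<^sub>0 x (u t) t))"
    by (simp add: ball_conj_distrib conj_assoc)
qed

text \<open>
  Existence and uniqueness of solutions make the description in the definition of \<open>trajectory\<close> proper.
\<close>

lemma trajectory_solves:
  assumes S: "smooth_system (\<lambda>t x. f x (u t) t) g A q"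
  shows "trajectory f b u 0 = b" "\<And>T. 0 \<le> T \<Longrightarrow> solves (\<lambda>t x. f x (u t) t) T (trajectory f b u)"
proof -
  interpret smooth_system "\<lambda>t x. f x (u t) t" g A q by fact
  let ?F = "\<lambda>t x. f x (u t) t"
  note iff = ode_solution_iff_solves[OF F_field]
  have "\<exists>!x. x \<in> extensional {0..} \<and> x 0 = b \<and> ode_solution ?F x"
  proof (rule ex_ex1I)
    show "\<exists>x. x \<in> extensional {0..} \<and> x 0 = b \<and> ode_solution ?F x"
    proof (intro exI conjI)
      show "restrict (flow b) {0..} \<in> extensional {0..}" "restrict (flow b) {0..} 0 = b" by (simp_all add: flow(1))
      show "ode_solution ?F (restrict (flow b) {0..})"
        unfolding iff
      proof (intro allI impI)
        fix T :: real assume "0 \<le> T"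
        from flow(2)[OF this, of b] show "solves ?F T (restrict (flow b) {0..})"
          unfolding solves_def by (rule primitive_on_cong[OF _ _ negligible_empty]) auto
      qed
    qed
    fix x y
    assume x: "x \<in> extensional {0..} \<and> x 0 = b \<and> ode_solution ?F x"
      and y: "y \<in> extensional {0..} \<and> y 0 = b \<and> ode_solution ?F y"
    have sol: "solves ?F t x" "solves ?F t y" if "0 \<le> t" for t
      using x y that unfolding iff by simp_all
    have start: "x 0 = y 0" using x y by simp
    show "x = y"
    proof (rule extensionalityI[where A="{0..}"])
      show "x t = y t" if "t \<in> {0..}" for t
        using that by (intro solves_unique[OF F_field sol start, of t]) simp_all
    qed (simp_all add: x y)
  qed
  from theI'[OF this] have "trajectory f b u 0 = b \<and> ode_solution ?F (trajectory f b u)"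
    unfolding trajectory_def by (elim conjE) (intro conjI)
  then show "trajectory f b u 0 = b" "\<And>T. 0 \<le> T \<Longrightarrow> solves ?F T (trajectory f b u)"
    unfolding iff by simp_all
qed

lemma cost_eq_total_cost:
  assumes S: "smooth_system (\<lambda>t x. f x (u t) t) (\<lambda>t x. f\<^sub>0 x (u t) t) A q"
  shows "cost f f\<^sub>0 b u T = smooth_system.total_cost (\<lambda>t x. f x (u t) t) (\<lambda>t x. f\<^sub>0 x (u t) t) b T"
proof -
  interpret smooth_system "\<lambda>t x. f x (u t) t" "\<lambda>t x. f\<^sub>0 x (u t) t" A q by fact
  show ?thesis
  proof (cases "0 \<le> T")
    case True
    note x = trajectory_solves[where f=f and u=u and b=b, OF S]
    have "cost f f\<^sub>0 b u T = integral {0..T} (\<lambda>t. f\<^sub>0 (trajectory f b u t) (u t) t)"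
      unfolding cost_def
      by (rule set_lebesgue_integral_eq_integral(2)[OF running_cost_integrable[OF solves_continuous[OF x(2)[OF True]] True]])
    also have "\<dots> = total_cost b T" using total_cost_eq[OF x(2)[OF True]] x(1) by simp
    finally show ?thesis .
  next
    case False
    then show ?thesis by (simp add: cost_def total_cost_def set_lebesgue_integral_def)
  qed
qed

lemma adjoint_solution_iff:
  assumes S: "smooth_system (\<lambda>t x. f x (u t) t) (\<lambda>t x. f\<^sub>0 x (u t) t) A q"
    and x: "\<And>T. 0 \<le> T \<Longrightarrow> continuous_on {0..T} x"
  shows "adjoint_solution f f\<^sub>0 x u \<psi> \<mu> \<longleftrightarrow> (\<forall>T\<ge>0. solves (smooth_system.costate_field A q x \<mu>) T \<psi>)"
proof -
  interpret smooth_system "\<lambda>t x. f x (u t) t" "\<lambda>t x. f\<^sub>0 x (u t) t" A q by fact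
  have "- grad (\<lambda>y. hamiltonian f f\<^sub>0 y (u t) p \<mu> t) (x t) = costate_field x \<mu> t p" if t: "0 \<le> t" for t p
  proof -
    have "((\<lambda>y. hamiltonian f f\<^sub>0 y (u t) p \<mu> t) has_derivative (\<lambda>h. p \<bullet> (A t (x t) *v h) - \<mu> * (q t (x t) \<bullet> h))) (at (x t))"
      unfolding hamiltonian_def
      by (intro has_derivative_diff has_derivative_inner_right has_derivative_mult_right F_derivative g_derivative t)
    also have "(\<lambda>h. p \<bullet> (A t (x t) *v h) - \<mu> * (q t (x t) \<bullet> h)) = (\<lambda>h. (p v* A t (x t) - \<mu> *\<^sub>R q t (x t)) \<bullet> h)"
      by (simp add: inner_diff_left dot_lmul_matrix)
    finally have "grad (\<lambda>y. hamiltonian f f\<^sub>0 y (u t) p \<mu> t) (x t) = p v* A t (x t) - \<mu> *\<^sub>R q t (x t)"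
      by (rule gradient_eqI)
    then show ?thesis by (simp add: costate_field_def)
  qed
  then have "adjoint_solution f f\<^sub>0 x u \<psi> \<mu> \<longleftrightarrow> ode_solution (costate_field x \<mu>) \<psi>"
    unfolding adjoint_solution_def by (intro ode_solution_cong) simp
  then show ?thesis using ode_solution_iff_solves[OF costate_field_linear_growth[OF x]] by simp
qed

theorem theorem3p1:
  fixes f :: "real^'m \<Rightarrow> 'u::euclidean_space \<Rightarrow> real \<Rightarrow> real^'m"
    and f\<^sub>0 :: "real^'m \<Rightarrow> 'u \<Rightarrow> real \<Rightarrow> real"
    and l :: "real^'m \<Rightarrow> real"
    and U :: "real \<Rightarrow> 'u set"
    and C :: "(real^'m) set"
    and \<tau> :: "nat \<Rightarrow> real"
    and b\<^sub>s :: "real^'m"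
    and u\<^sub>s :: "real \<Rightarrow> 'u"
    and x\<^sub>s \<psi>\<^sub>s :: "real \<Rightarrow> real^'m"
    and \<mu>\<^sub>s :: real
  assumes "control_problem f f\<^sub>0 l U C"
    and "unboundedly_increasing_positive \<tau>"
    and "uniformly_overtaking_optimal f f\<^sub>0 l U C \<tau> b\<^sub>s u\<^sub>s"
    and "x\<^sub>s = trajectory f b\<^sub>s u\<^sub>s"
    and "PMP_solution f f\<^sub>0 U x\<^sub>s u\<^sub>s \<psi>\<^sub>s \<mu>\<^sub>s"
  shows "limiting_solution f f\<^sub>0 U \<tau> x\<^sub>s u\<^sub>s \<psi>\<^sub>s \<mu>\<^sub>s \<longleftrightarrow>
     (\<mu>\<^sub>s > 0 \<and>
        \<psi>\<^sub>s 0 \<in> (*\<^sub>R) \<mu>\<^sub>s `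
          limiting_subdifferential_at_infinity (\<lambda>b t. - cost f f\<^sub>0 b u\<^sub>s t) \<tau> (x\<^sub>s 0)) \<or>
     (\<mu>\<^sub>s = 0 \<and>
        \<psi>\<^sub>s 0 \<in>
          singular_subdifferential_at_infinity (\<lambda>b t. - cost f f\<^sub>0 b u\<^sub>s t) \<tau> (x\<^sub>s 0) - {0})"
proof -
  let ?F = "\<lambda>t x. f x (u\<^sub>s t) t" and ?g = "\<lambda>t x. f\<^sub>0 x (u\<^sub>s t) t"
    and ?A = "\<lambda>t x. state_jacobian f x (u\<^sub>s t) t" and ?q = "\<lambda>t x. state_gradient f\<^sub>0 x (u\<^sub>s t) t"
  have u: "u\<^sub>s \<in> admissible_controls U"
    using assms(3) by (simp add: uniformly_overtaking_optimal_def)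
  note S = control_problem.smooth_system_along_control[OF assms(1) u]
  interpret smooth_system ?F ?g ?A ?q by (rule S)
  have xs: "solves ?F T x\<^sub>s" if "0 \<le> T" for T
    using trajectory_solves(2)[where f=f and u=u\<^sub>s, OF S that] assms(4) by simp
  have PMP: "0 \<le> \<mu>\<^sub>s" "adjoint_solution f f\<^sub>0 x\<^sub>s u\<^sub>s \<psi>\<^sub>s \<mu>\<^sub>s"
    using assms(5) by (simp_all add: PMP_solution_def)
  have \<psi>s: "solves (costate_field x\<^sub>s \<mu>\<^sub>s) T \<psi>\<^sub>s" if "0 \<le> T" for T
    using adjoint_solution_iff[where f=f and f\<^sub>0=f\<^sub>0 and u=u\<^sub>s, OF S solves_continuous[OF xs]] PMP(2) that by blast
  have state: "ode_solution ?F x \<longleftrightarrow> (\<forall>T\<ge>0. solves ?F T x)" for x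
    by (rule ode_solution_iff_solves[OF F_field])
  have step: "ode_solution ?F x \<and> adjoint_solution f f\<^sub>0 x u\<^sub>s \<psi> \<mu> \<and> Z \<longleftrightarrow>
      (\<forall>T\<ge>0. solves ?F T x) \<and> (\<forall>T\<ge>0. solves (costate_field x \<mu>) T \<psi>) \<and> Z" for x \<psi> \<mu> Z
    using adjoint_solution_iff[where f=f and f\<^sub>0=f\<^sub>0 and u=u\<^sub>s and x=x and \<psi>=\<psi> and \<mu>=\<mu>, OF S] solves_continuous[of ?F _ x] unfolding state by blast
  have "limiting_solution f f\<^sub>0 U \<tau> x\<^sub>s u\<^sub>s \<psi>\<^sub>s \<mu>\<^sub>s \<longleftrightarrow>
      nontrivial_multiplier \<psi>\<^sub>s \<mu>\<^sub>s \<and> limit_of_terminal_costates \<tau> x\<^sub>s \<psi>\<^sub>s \<mu>\<^sub>s"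
    unfolding limiting_solution_def limit_of_terminal_costates_def step using assms(5) by simp
  also note limit_of_terminal_costates_iff[OF assms(2) xs \<psi>s PMP(1)]
  finally show ?thesis unfolding cost_eq_total_cost[where f=f and f\<^sub>0=f\<^sub>0 and u=u\<^sub>s, OF S] .
qed

end
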